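(* Let $p$ be an odd prime and let $G$ be a non-abelian group of order $p^6$. Then $\mathrm{Aut}_c(G)=\mathrm{Aut}_z(G)$ if and only if $G$ belongs to one of the isoclinism families $\Phi_{14}$ or $\Phi_{15}$.
   Context: $\mathrm{Aut}_c(G)$ is the group of all class preserving automorphisms of $G$, i.e. automorphisms $\alpha$ such that $\alpha(x)$ is conjugate to $x$ in $G$ for every $x\in G$. $\mathrm{Aut}_z(G)$ is the group of all central automorphisms of $G$, i.e. automorphisms $\phi$ such that $g^{-1}\phi(g)\in Z(G)$ for every $g\in G$. Commutators are $[x,y]=x^{-1}y^{-1}xy$ and $\gamma_2(G)$ is the commutator subgroup. Two groups $G,H$ are isoclinic if there are isomorphisms $\theta:G/Z(G)\to H/Z(H)$ and $\varphi:\gamma_2(G)\to\gamma_2(H)$ such that $\varphi([a,b])=[a',b']$ whenever $a'Z(H)=\theta(aZ(G))$ and $b'Z(H)=\theta(bZ(G))$. The families are numbered as in James' classification of groups of order $p^n$, $n\le 6$, $p$ odd; in the presentations below, all commutators of pairs of generators not listed (other than inverses of listed ones) are trivial. $\Phi_{14}$ consists of all groups isoclinic to the group of order $p^6$ $$\langle \alpha_1,\alpha_2,\beta \mid [\alpha_1,\alpha_2]=\beta,\ \alpha_1^{p^2}=\alpha_2^{p^2}=\beta^{p^2}=1\rangle.$$ $\Phi_{15}$ consists of all groups isoclinic to the group of order $p^6$ $$\langle \alpha_1,\alpha_2,\alpha_3,\alpha_4,\beta_1,\beta_2 \mid [\alpha_1,\alpha_2]=[\alpha_3,\alpha_4]=\beta_1,\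 [\alpha_1,\alpha_3]=\beta_2,\ [\alpha_2,\alpha_4]=\beta_2^{g},\ \alpha_i^p=\beta_j^p=1\rangle,$$ where $1\le i\le 4$, $1\le j\le 2$, and $g$ is the smallest positive integer that is a primitive root modulo $p$. *)

theory Defs
  imports "HOL-Algebra.Algebra" "HOL-Number_Theory.Residue_Primitive_Roots"
begin

section \<open>Class preserving and central automorphisms\<close>

definition center :: "('a, 'b) monoid_scheme \<Rightarrow> 'a set" where
  "center G = {z \<in> carrier G. \<forall>x\<in>carrier G. z \<otimes>\<^bsub>G\<^esub> x = x \<otimes>\<^bsub>G\<^esub> z}"

text \<open>Automorphisms are taken from \<^const>\<open>auto\<close>; its members are extensional
  outside the carrier, so equality of sets of automorphisms is the intended one.
  Both sets below are subgroups of \<^const>\<open>AutoGroup\<close>.\<close>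

definition Aut_c :: "('a, 'b) monoid_scheme \<Rightarrow> ('a \<Rightarrow> 'a) set" where
  "Aut_c G = {\<alpha> \<in> auto G. \<forall>x\<in>carrier G. \<exists>g\<in>carrier G.
     \<alpha> x = inv\<^bsub>G\<^esub> g \<otimes>\<^bsub>G\<^esub> x \<otimes>\<^bsub>G\<^esub> g}"

definition Aut_z :: "('a, 'b) monoid_scheme \<Rightarrow> ('a \<Rightarrow> 'a) set" where
  "Aut_z G = {\<phi> \<in> auto G. \<forall>g\<in>carrier G. inv\<^bsub>G\<^esub> g \<otimes>\<^bsub>G\<^esub> \<phi> g \<in> center G}"


section \<open>Isoclinism\<close>

definition commutator :: "('a, 'b) monoid_scheme \<Rightarrow> 'a \<Rightarrow> 'a \<Rightarrow> 'a" where
  "commutator G x y = inv\<^bsub>G\<^esub> x \<otimes>\<^bsub>G\<^esub> inv\<^bsub>G\<^esub> y \<otimes>\<^bsub>G\<^esub> x \<otimes>\<^bsub>G\<^esub> y"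

text \<open>The library's \<^const>\<open>derived\<close> is generated by the elements
  \<open>x y x\<inverse> y\<inverse>\<close>. These are the commutators of \<open>x\<inverse>\<close> and \<open>y\<inverse>\<close> in the sense above, so the
  generated subgroup is the same.\<close>

abbreviation gamma2 :: "('a, 'b) monoid_scheme \<Rightarrow> 'a set" where
  "gamma2 G \<equiv> derived G (carrier G)"

definition isoclinic :: "('a, 'b) monoid_scheme \<Rightarrow> ('c, 'd) monoid_scheme \<Rightarrow> bool" where
  "isoclinic G H \<longleftrightarrow>
     (\<exists>\<theta> \<in> iso (G Mod center G) (H Mod center H).
      \<exists>\<phi> \<in> iso (G\<lparr>carrier := gamma2 G\<rparr>) (H\<lparr>carrier := gamma2 H\<rparr>).
        \<forall>a\<in>carrier G. \<forall>b\<in>carrier G. \<forall>a'\<in>carrier H. \<forall>b'\<in>carrier H.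
          center H #>\<^bsub>H\<^esub> a' = \<theta> (center G #>\<^bsub>G\<^esub> a) \<longrightarrow>
          center H #>\<^bsub>H\<^esub> b' = \<theta> (center G #>\<^bsub>G\<^esub> b) \<longrightarrow>
          \<phi> (commutator G a b) = commutator H a' b')"


section \<open>Groups given by generators and relations\<close>

text \<open>The generators are all elements of the type \<open>'x\<close>. A word is a list of letters;
  \<open>(x, True)\<close> stands for \<open>x\<close> and \<open>(x, False)\<close> for \<open>x\<inverse>\<close>. A pair \<open>(u, v)\<close> in a set of relations
  stands for the relation \<open>u = v\<close>.\<close>

type_synonym 'x word = "('x \<times> bool) list"

definition wgen :: "'x \<Rightarrow> 'x word" where
  "wgen x = [(x, True)]"

definition winv :: "'x word \<Rightarrow> 'x word" where
  "winv w = rev (map (\<lambda>(x, e). (x, \<not> e)) w)"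

definition wpow :: "'x word \<Rightarrow> nat \<Rightarrow> 'x word" where
  "wpow w n = concat (replicate n w)"

definition wcomm :: "'x word \<Rightarrow> 'x word \<Rightarrow> 'x word" where
  "wcomm u v = winv u @ winv v @ u @ v"

inductive word_cong :: "('x word \<times> 'x word) set \<Rightarrow> 'x word \<Rightarrow> 'x word \<Rightarrow> bool"
  for R where
  relation: "(u, v) \<in> R \<Longrightarrow> word_cong R u v"
| cancel: "word_cong R [(x, e), (x, \<not> e)] []"
| refl: "word_cong R u u"
| sym: "word_cong R u v \<Longrightarrow> word_cong R v u"
| trans: "word_cong R u v \<Longrightarrow> word_cong R v w \<Longrightarrow> word_cong R u w"
| append: "word_cong R u u' \<Longrightarrow> word_cong R v v' \<Longrightarrow> word_cong R (u @ v) (u' @ v')"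

definition word_rel :: "('x word \<times> 'x word) set \<Rightarrow> ('x word \<times> 'x word) set" where
  "word_rel R = {(u, v). word_cong R u v}"

definition presented_group :: "('x word \<times> 'x word) set \<Rightarrow> 'x word set monoid" where
  "presented_group R =
     \<lparr>carrier = UNIV // word_rel R,
      monoid.mult = (\<lambda>A B. \<Union>u\<in>A. \<Union>v\<in>B. word_rel R `` {u @ v}),
      one = word_rel R `` {[]}\<rparr>"

text \<open>\<open>L\<close> is the set of pairs of generators whose commutators are listed in a presentation;
  the commutators of all other pairs, up to swapping, are trivial. (The pairs \<open>(x, x)\<close> only
  contribute redundant relations.)\<close>

definition unlisted_comms :: "('x \<times> 'x) set \<Rightarrow> ('x word \<times> 'x word) set" where
  "unlisted_comms L =
     {(wcomm (wgen x) (wgen y), []) | x y. (x, y) \<notin> L \<and> (y, x) \<notin> L}"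


section \<open>The families\<close>

datatype gen14 = A14_1 | A14_2 | B14

definition rels14 :: "nat \<Rightarrow> (gen14 word \<times> gen14 word) set" where
  "rels14 p =
     {(wcomm (wgen A14_1) (wgen A14_2), wgen B14)}
     \<union> unlisted_comms {(A14_1, A14_2)}
     \<union> {(wpow (wgen A14_1) (p^ 2), []), (wpow (wgen A14_2) (p^ 2), []),
        (wpow (wgen B14) (p^ 2), [])}"

definition Phi14 :: "nat \<Rightarrow> ('a, 'b) monoid_scheme set" where
  "Phi14 p = {G. group G \<and> isoclinic G (presented_group (rels14 p))}"

datatype gen15 = A15_1 | A15_2 | A15_3 | A15_4 | B15_1 | B15_2

definition least_primroot :: "nat \<Rightarrow> nat" where
  "least_primroot p = (LEAST g. 0 < g \<and> residue_primroot p g)"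

definition rels15 :: "nat \<Rightarrow> (gen15 word \<times> gen15 word) set" where
  "rels15 p =
     {(wcomm (wgen A15_1) (wgen A15_2), wgen B15_1),
      (wcomm (wgen A15_3) (wgen A15_4), wgen B15_1),
      (wcomm (wgen A15_1) (wgen A15_3), wgen B15_2),
      (wcomm (wgen A15_2) (wgen A15_4), wpow (wgen B15_2) (least_primroot p))}
     \<union> unlisted_comms {(A15_1, A15_2), (A15_3, A15_4), (A15_1, A15_3), (A15_2, A15_4)}
     \<union> {(wpow (wgen x) p, []) | x. True}"

definition Phi15 :: "nat \<Rightarrow> ('a, 'b) monoid_scheme set" where
  "Phi15 p = {G. group G \<and> isoclinic G (presented_group (rels15 p))}"


section \<open>Basic facts\<close>

lemma equiv_word_rel: "equiv UNIV (word_rel R)"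
proof (rule equivI)
  show "refl (word_rel R)"
    by (simp add: word_rel_def refl_on_def word_cong.refl)
  show "sym (word_rel R)"
    by (rule symI) (simp add: word_rel_def, rule word_cong.sym)
  show "trans (word_rel R)"
    by (rule transI) (simp add: word_rel_def, rule word_cong.trans)
qed simp

lemma word_class_eq_iff: "word_rel R `` {u} = word_rel R `` {v} \<longleftrightarrow> word_cong R u v"
  using eq_equiv_class_iff[OF equiv_word_rel, of u v R] by (simp add: word_rel_def)

lemma presented_group_mult:
  "(word_rel R `` {u}) \<otimes>\<^bsub>presented_group R\<^esub> (word_rel R `` {v}) = word_rel R `` {u @ v}"
proof -
  define U V where "U = word_rel R `` {u}" and "V = word_rel R `` {v}"
  have eq: "word_rel R `` {u' @ v'} = word_rel R `` {u @ v}" if "u' \<in> U" "v' \<in> V" for u' v'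
  proof -
    have "word_cong R u u'" "word_cong R v v'"
      using that by (simp_all add: U_def V_def word_rel_def)
    then show ?thesis
      unfolding word_class_eq_iff by (rule word_cong.sym[OF word_cong.append])
  qed
  have ne: "U \<noteq> {}" "V \<noteq> {}"
    using word_cong.refl by (force simp: U_def V_def word_rel_def)+
  have "U \<otimes>\<^bsub>presented_group R\<^esub> V = (\<Union>u'\<in>U. \<Union>v'\<in>V. word_rel R `` {u' @ v'})"
    by (simp add: presented_group_def)
  also have "\<dots> = (\<Union>u'\<in>U. \<Union>v'\<in>V. word_rel R `` {u @ v})"
    by (intro SUP_cong HOL.refl eq)
  also have "\<dots> = word_rel R `` {u @ v}"
    using ne by simp
  finally show ?thesis
    unfolding U_def V_def .
qed

lemma word_cong_winv: "word_cong R (winv w @ w) []"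
proof (induction w)
  case Nil
  then show ?case by (simp add: winv_def word_cong.refl)
next
  case (Cons a w)
  obtain x e where a: "a = (x, e)" by fastforce
  have "word_cong R [(x, \<not> e), (x, e)] []"
    using word_cong.cancel[of R x "\<not> e"] by simp
  then have "word_cong R (winv w @ ([(x, \<not> e), (x, e)] @ w)) (winv w @ ([] @ w))"
    by (intro word_cong.append word_cong.refl)
  then show ?case
    using word_cong.trans[OF _ Cons.IH] by (simp add: a winv_def)
qed

lemma group_presented_group: "group (presented_group R)"
proof (rule groupI)
  have car: "carrier (presented_group R) = range (\<lambda>w. word_rel R `` {w})"
    by (auto simp: presented_group_def quotient_def)
  have one: "\<one>\<^bsub>presented_group R\<^esub> = word_rel R `` {[]}"
    by (simp add: presented_group_def)
  show "\<one>\<^bsub>presented_group R\<^esub> \<in> carrier (presented_group R)"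
    by (simp add: car one)
  fix x assume x: "x \<in> carrier (presented_group R)"
  then obtain u where u: "x = word_rel R `` {u}" by (auto simp: car)
  show "\<one>\<^bsub>presented_group R\<^esub> \<otimes>\<^bsub>presented_group R\<^esub> x = x"
    by (simp add: one u presented_group_mult)
  show "\<exists>y\<in>carrier (presented_group R). y \<otimes>\<^bsub>presented_group R\<^esub> x = \<one>\<^bsub>presented_group R\<^esub>"
  proof (rule bexI[of _ "word_rel R `` {winv u}"])
    show "word_rel R `` {winv u} \<otimes>\<^bsub>presented_group R\<^esub> x = \<one>\<^bsub>presented_group R\<^esub>"
      unfolding u one presented_group_mult word_class_eq_iff by (rule word_cong_winv)
  qed (simp add: car)
  fix y assume y: "y \<in> carrier (presented_group R)"
  then obtain v where v: "y = word_rel R `` {v}" by (auto simp: car)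
  show "x \<otimes>\<^bsub>presented_group R\<^esub> y \<in> carrier (presented_group R)"
    by (simp add: u v presented_group_mult car)
  fix z assume "z \<in> carrier (presented_group R)"
  then obtain w where w: "z = word_rel R `` {w}" by (auto simp: car)
  show "x \<otimes>\<^bsub>presented_group R\<^esub> y \<otimes>\<^bsub>presented_group R\<^esub> z
      = x \<otimes>\<^bsub>presented_group R\<^esub> (y \<otimes>\<^bsub>presented_group R\<^esub> z)"
    by (simp add: u v w presented_group_mult)
qed

end

theory Submission
  imports Defs "HOL-Library.Product_Plus" "HOL-Number_Theory.Euler_Criterion"
begin

text \<open>If \<open>Aut_c G = Aut_z G\<close>, then inner automorphisms are central, so \<open>G\<close> has class two, and
  every homomorphism \<open>f\<close> from \<open>G\<close> to \<open>Z(G)\<close> for which \<open>x \<mapsto> x f(x)\<close> is injective satisfies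
  \<open>f(x) \<in> [x, G]\<close>. Enough such homomorphisms exist, because characters of finite abelian groups
  separate points, to conclude that \<open>\<gamma>\<^sub>2(G) = Z(G)\<close> and that \<open>[g, G] = Z(G)\<close> whenever the order of
  \<open>g\<close> modulo \<open>Z(G)\<close> is the exponent \<open>p\<^sup>e\<close> of \<open>G / Z(G)\<close>. Counting the centralizer of \<open>g\<close> leaves
  \<open>|Z(G)| = p\<close>, which is impossible as \<open>G / Z(G)\<close> would be a symplectic space of dimension five,
  or \<open>|Z(G)| = p\<^sup>2\<close>. In the latter case either \<open>e = 2\<close> and \<open>G\<close> is isoclinic to a Heisenberg group
  over the integers modulo \<open>p\<^sup>2\<close>, or \<open>e = 1\<close> and the commutator is an alternating map from a space
  of dimension four to one of dimension two all of whose nonzero vectors \<open>g\<close> have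
  \<open>[g, G] = Z(G)\<close>; completing the square brings it to the normal form of \<open>\<Phi>\<^sub>1\<^sub>5\<close>.

  Conversely, "every element of \<open>\<gamma>\<^sub>2\<close> that could be a commutator with \<open>x\<close> for reasons of order is
  one" is invariant under isoclinism and holds for both presented groups.\<close>

section \<open>Commutators and isoclinism in class two\<close>

text \<open>The bound on the center comes from one inequality: \<open>g\<close> and Z(G) lie in the
  centralizer of \<open>g\<close>, whose index is |[g, G]| = |Z(G)|, so |Z(G)| = p^i gives p^(2 i +
  e) <= p^6. The values z that [g, G] is known to contain are those with z^(p^e) = 1, and these
  exhaust Z(G) because [x, y]^(p^e) = [x^(p^e), y] = 1. The obstacle in the converse is that a
  member of a family is known only through G / Z(G) and gamma_2(G), whereas \<open>Aut_z G\<close>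
  depends on Z(G). The order p^6 closes this gap: |H / Z(H)| |gamma_2(H)| = p^6 for both presented
  groups H, hence |Z(G)| = |gamma_2(G)|. No isoclinism is built by hand. G and H are shown to have
  the same commutator data in integer exponents, so integers with congruences replace residue rings
  and quotient maps. Oddness of p serves to form s / 2 modulo p and to have non-residues, which are
  then unique up to squares.\<close>

context group
begin

lemma inv_mult_cancel [simp]:
  assumes "x \<in> carrier G" "y \<in> carrier G"
  shows "inv x \<otimes> (x \<otimes> y) = y" and "x \<otimes> (inv x \<otimes> y) = y"
  using assms by (simp_all add: m_assoc [symmetric])

lemma commutator_closed [simp]:
  "x \<in> carrier G \<Longrightarrow> y \<in> carrier G \<Longrightarrow> commutator G x y \<in> carrier G"
  by (simp add: commutator_def)

lemma mult_commutator:
  "x \<in> carrier G \<Longrightarrow> y \<in> carrier G \<Longrightarrow> y \<otimes> x \<otimes> commutator G x y = x \<otimes> y"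
  by (simp add: commutator_def m_assoc)

lemma conjugate_eq_mult_commutator:
  "x \<in> carrier G \<Longrightarrow> g \<in> carrier G \<Longrightarrow> inv g \<otimes> x \<otimes> g = x \<otimes> commutator G x g"
  by (simp add: commutator_def m_assoc)

lemma commutator_eq_one_iff:
  assumes "x \<in> carrier G" "y \<in> carrier G"
  shows "commutator G x y = \<one> \<longleftrightarrow> x \<otimes> y = y \<otimes> x"
  using mult_commutator[OF assms] assms
  by (metis commutator_closed l_cancel_one m_closed)

lemma inv_commutator:
  "x \<in> carrier G \<Longrightarrow> y \<in> carrier G \<Longrightarrow> inv (commutator G x y) = commutator G y x"
  by (simp add: commutator_def inv_mult_group m_assoc)

lemma commutator_self [simp]: "x \<in> carrier G \<Longrightarrow> commutator G x x = \<one>"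
  by (simp add: commutator_eq_one_iff)

lemma center_closed: "z \<in> center G \<Longrightarrow> z \<in> carrier G"
  by (simp add: center_def)

lemma center_commute: "z \<in> center G \<Longrightarrow> x \<in> carrier G \<Longrightarrow> z \<otimes> x = x \<otimes> z"
  by (simp add: center_def)

lemma mem_center_iff:
  "x \<in> carrier G \<Longrightarrow> x \<in> center G \<longleftrightarrow> (\<forall>y\<in>carrier G. commutator G x y = \<one>)"
  by (auto simp: center_def commutator_eq_one_iff)

lemma subgroup_center: "subgroup (center G) G"
proof (rule subgroupI)
  show "center G \<noteq> {}" by (auto simp: center_def intro!: exI[of _ \<one>])
  fix a assume a: "a \<in> center G"
  show "inv a \<in> center G"
    unfolding center_def
  proof (intro CollectI conjI ballI)
    show "inv a \<in> carrier G" using a center_closed by simp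
    fix x assume x: "x \<in> carrier G"
    have ac: "a \<in> carrier G" "a \<otimes> x = x \<otimes> a"
      using a x center_closed center_commute by blast+
    have "x \<otimes> inv a = inv a \<otimes> (a \<otimes> x) \<otimes> inv a" using ac(1) x by simp
    also have "\<dots> = inv a \<otimes> x" using ac(1) x by (simp add: ac(2) m_assoc)
    finally show "inv a \<otimes> x = x \<otimes> inv a" by simp
  qed
  fix b assume b: "b \<in> center G"
  show "a \<otimes> b \<in> center G"
    unfolding center_def
  proof (intro CollectI conjI ballI)
    show "a \<otimes> b \<in> carrier G" using a b center_closed by simp
    fix x assume x: "x \<in> carrier G"
    have ac: "a \<in> carrier G" "a \<otimes> x = x \<otimes> a" "b \<in> carrier G" "b \<otimes> x = x \<otimes> b"
      using a b x center_closed center_commute by blast+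
    have "a \<otimes> b \<otimes> x = a \<otimes> x \<otimes> b" using ac(1,3) x by (simp add: ac(4) m_assoc)
    also have "\<dots> = x \<otimes> (a \<otimes> b)" using ac(1,3) x by (simp add: ac(2) m_assoc)
    finally show "a \<otimes> b \<otimes> x = x \<otimes> (a \<otimes> b)" .
  qed
qed (auto simp: center_def)

lemmas center_mult_closed = subgroup.m_closed[OF subgroup_center]
lemmas center_inv_closed = subgroup.m_inv_closed[OF subgroup_center]
lemmas one_mem_center [simp] = subgroup.one_closed[OF subgroup_center]

lemma center_int_pow_closed: "z \<in> center G \<Longrightarrow> z [^] (i::int) \<in> center G"
  using subgroup_int_pow_closed[OF subgroup_center] .

lemma normal_center: "center G \<lhd> G"
proof (rule normal_invI[OF subgroup_center])
  fix x h assume "x \<in> carrier G" "h \<in> center G"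
  then show "x \<otimes> h \<otimes> inv x \<in> center G"
    by (metis center_closed center_commute inv_closed inv_solve_right m_closed)
qed

lemma commutator_in_gamma2:
  assumes "x \<in> carrier G" "y \<in> carrier G"
  shows "commutator G x y \<in> gamma2 G"
proof -
  have "commutator G x y = inv x \<otimes> inv y \<otimes> inv (inv x) \<otimes> inv (inv y)"
    using assms by (simp add: commutator_def)
  then have "commutator G x y \<in> derived_set G (carrier G)"
    using assms inv_closed by blast
  then show ?thesis
    unfolding derived_def by (rule generate.incl)
qed

lemma gamma2_subset_iff:
  assumes "subgroup K G"
  shows "gamma2 G \<subseteq> K \<longleftrightarrow> (\<forall>x\<in>carrier G. \<forall>y\<in>carrier G. commutator G x y \<in> K)"
proof
  assume r: "\<forall>x\<in>carrier G. \<forall>y\<in>carrier G. commutator G x y \<in> K"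
  have "derived_set G (carrier G) \<subseteq> K"
  proof clarify
    fix x y assume xy: "x \<in> carrier G" "y \<in> carrier G"
    then have "x \<otimes> y \<otimes> inv x \<otimes> inv y = commutator G (inv x) (inv y)"
      by (simp add: commutator_def)
    then show "x \<otimes> y \<otimes> inv x \<otimes> inv y \<in> K" using r xy by simp
  qed
  then show "gamma2 G \<subseteq> K"
    unfolding derived_def by (rule generate_subgroup_incl[OF _ assms])
qed (use commutator_in_gamma2 in blast)

lemma subgroup_gamma2: "subgroup (gamma2 G) G"
  by (rule derived_is_subgroup) simp

text \<open>In general [x y, z] = y^-1 [x, z] y [y, z]. Centrality is asked of the single commutator
  [x, z], so that the rule can be used in inductions over generators, before class two is
  established.\<close>

lemma commutator_mult_left_if:
  assumes "x \<in> carrier G" "y \<in> carrier G" "z \<in> carrier G" "commutator G x z \<in> center G"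
  shows "commutator G (x \<otimes> y) z = commutator G x z \<otimes> commutator G y z"
proof -
  have "commutator G (x \<otimes> y) z = inv y \<otimes> commutator G x z \<otimes> (inv z \<otimes> y \<otimes> z)"
    using assms by (simp add: commutator_def m_assoc inv_mult_group)
  also have "inv y \<otimes> commutator G x z = commutator G x z \<otimes> inv y"
    using assms center_commute by simp
  finally show ?thesis
    using assms by (simp add: commutator_def m_assoc)
qed

lemma commutator_mult_right_if:
  assumes "x \<in> carrier G" "y \<in> carrier G" "z \<in> carrier G" "commutator G z x \<in> center G"
  shows "commutator G z (x \<otimes> y) = commutator G z x \<otimes> commutator G z y"
proof -
  have "commutator G x z \<in> center G"
    using assms center_inv_closed inv_commutator by metis
  then have "commutator G (x \<otimes> y) z = commutator G x z \<otimes> commutator G y z"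
    using assms commutator_mult_left_if by blast
  then have "inv (commutator G (x \<otimes> y) z) = inv (commutator G y z) \<otimes> inv (commutator G x z)"
    using assms(1-3) by (simp add: inv_mult_group)
  moreover have "commutator G z y \<otimes> commutator G z x = commutator G z x \<otimes> commutator G z y"
    using center_commute[OF assms(4)] assms(2,3) by simp
  ultimately show ?thesis
    using assms by (simp add: inv_commutator)
qed

lemma commutator_inv_left_if:
  assumes "x \<in> carrier G" "z \<in> carrier G" "commutator G x z \<in> center G"
  shows "commutator G (inv x) z = inv (commutator G x z)"
proof -
  have "commutator G x z \<otimes> commutator G (inv x) z = commutator G \<one> z"
    using commutator_mult_left_if[of x "inv x" z] assms by simp
  also have "\<dots> = \<one>" using assms by (simp add: commutator_eq_one_iff)
  finally have "inv (commutator G (inv x) z) = commutator G x z"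
    using assms by (intro inv_equality) simp_all
  then show ?thesis using assms by (metis commutator_closed inv_closed inv_inv)
qed

lemma commutator_inv_right_if:
  assumes "x \<in> carrier G" "z \<in> carrier G" "commutator G z x \<in> center G"
  shows "commutator G z (inv x) = inv (commutator G z x)"
proof -
  have "commutator G z x \<otimes> commutator G z (inv x) = commutator G z \<one>"
    using commutator_mult_right_if[of x "inv x" z] assms by simp
  also have "\<dots> = \<one>" using assms by (simp add: commutator_eq_one_iff)
  finally have "inv (commutator G z (inv x)) = commutator G z x"
    using assms by (intro inv_equality) simp_all
  then show ?thesis using assms by (metis commutator_closed inv_closed inv_inv)
qed

text \<open>One argument at a time: the left one runs through the generated group while the right
  one stays in \<open>A\<close>, then the right one runs. In each product step the commutator that
  has to be moved is central by the induction hypothesis.\<close>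

lemma commutators_central_if_generators:
  assumes A: "A \<subseteq> carrier G" and gen: "carrier G = generate G A"
    and c: "\<And>x y. x \<in> A \<Longrightarrow> y \<in> A \<Longrightarrow> commutator G x y \<in> center G"
    and x: "x \<in> carrier G" and y: "y \<in> carrier G"
  shows "commutator G x y \<in> center G"
proof -
  have car: "h \<in> carrier G" if "h \<in> generate G A" for h
    using that gen by simp
  have comm_one: "commutator G u \<one> = \<one>" "commutator G \<one> u = \<one>" if "u \<in> carrier G" for u
    using that by (simp_all add: commutator_eq_one_iff)
  have l: "commutator G u v \<in> center G" if "u \<in> generate G A" "v \<in> A" for u v
    using that(1)
  proof (induction u rule: generate.induct)
    case one
    have "v \<in> carrier G" using that A by blast
    then show ?case by (simp add: comm_one)
  next
    case (incl h)
    then show ?case using that c by blast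
  next
    case (inv h)
    then have "h \<in> carrier G" "v \<in> carrier G" "commutator G h v \<in> center G"
      using that A c by blast+
    then show ?case by (simp add: commutator_inv_left_if center_inv_closed)
  next
    case (eng h1 h2)
    then have "h1 \<in> carrier G" "h2 \<in> carrier G" "v \<in> carrier G"
      using that A car by blast+
    then show ?case using eng.IH by (simp add: commutator_mult_left_if center_mult_closed)
  qed
  have "commutator G u v \<in> center G" if "v \<in> generate G A" "u \<in> carrier G" for u v
    using that(1)
  proof (induction v rule: generate.induct)
    case one
    then show ?case using that by (simp add: comm_one)
  next
    case (incl h)
    then show ?case using that(2) l unfolding gen by blast
  next
    case (inv h)
    then have "h \<in> carrier G" using A by blast
    moreover have "commutator G u h \<in> center G"
      using that(2) l inv unfolding gen by blast
    ultimately show ?case using that(2) by (simp add: commutator_inv_right_if center_inv_closed)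
  next
    case (eng h1 h2)
    then have "h1 \<in> carrier G" "h2 \<in> carrier G"
      using car by blast+
    then show ?case
      using eng.IH that(2) by (simp add: commutator_mult_right_if center_mult_closed)
  qed
  then show ?thesis using x y gen by blast
qed

end

section \<open>Bilinearity of the commutator in class two\<close>

locale class2_group = group G for G (structure) +
  assumes commutator_central:
    "x \<in> carrier G \<Longrightarrow> y \<in> carrier G \<Longrightarrow> commutator G x y \<in> center G"
begin

lemma gamma2_subset_center: "gamma2 G \<subseteq> center G"
  using gamma2_subset_iff[OF subgroup_center] commutator_central by blast



lemma commutator_mult_left:
  "x \<in> carrier G \<Longrightarrow> y \<in> carrier G \<Longrightarrow> z \<in> carrier G \<Longrightarrow>
    commutator G (x \<otimes> y) z = commutator G x z \<otimes> commutator G y z"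
  using commutator_mult_left_if commutator_central by blast

lemma commutator_mult_right:
  "x \<in> carrier G \<Longrightarrow> y \<in> carrier G \<Longrightarrow> z \<in> carrier G \<Longrightarrow>
    commutator G z (x \<otimes> y) = commutator G z x \<otimes> commutator G z y"
  using commutator_mult_right_if commutator_central by blast

lemma commutator_inv_left:
  "x \<in> carrier G \<Longrightarrow> y \<in> carrier G \<Longrightarrow> commutator G (inv x) y = inv (commutator G x y)"
  using commutator_inv_left_if commutator_central by blast

lemma commutator_inv_right:
  "x \<in> carrier G \<Longrightarrow> y \<in> carrier G \<Longrightarrow> commutator G x (inv y) = inv (commutator G x y)"
  using commutator_inv_right_if commutator_central by blast

lemma commutator_one_left [simp]: "x \<in> carrier G \<Longrightarrow> commutator G \<one> x = \<one>"
  by (simp add: commutator_eq_one_iff)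

lemma commutator_one_right [simp]: "x \<in> carrier G \<Longrightarrow> commutator G x \<one> = \<one>"
  by (simp add: commutator_eq_one_iff)

lemma commutator_hom_left: "y \<in> carrier G \<Longrightarrow> (\<lambda>x. commutator G x y) \<in> hom G G"
  by (rule homI) (simp_all add: commutator_mult_left)

lemma commutator_hom_right: "x \<in> carrier G \<Longrightarrow> commutator G x \<in> hom G G"
  by (rule homI) (simp_all add: commutator_mult_right)

lemma commutator_int_pow_left:
  assumes "x \<in> carrier G" "y \<in> carrier G"
  shows "commutator G (x [^] (i::int)) y = commutator G x y [^] i"
  using group_hom.hom_int_pow[OF group_hom.intro[OF is_group is_group
        group_hom_axioms.intro[OF commutator_hom_left[OF assms(2)]]] assms(1)] .

lemma commutator_int_pow_right:
  assumes "x \<in> carrier G" "y \<in> carrier G"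
  shows "commutator G x (y [^] (i::int)) = commutator G x y [^] i"
  using group_hom.hom_int_pow[OF group_hom.intro[OF is_group is_group
        group_hom_axioms.intro[OF commutator_hom_right[OF assms(1)]]] assms(2)] .

lemma commutator_center_left [simp]:
  "z \<in> center G \<Longrightarrow> x \<in> carrier G \<Longrightarrow> commutator G z x = \<one>"
  using center_closed mem_center_iff by blast

lemma commutator_center_right [simp]:
  "z \<in> center G \<Longrightarrow> x \<in> carrier G \<Longrightarrow> commutator G x z = \<one>"
  by (simp add: center_closed center_commute commutator_eq_one_iff)

lemma commutator_center_mult_left:
  "z \<in> center G \<Longrightarrow> x \<in> carrier G \<Longrightarrow> y \<in> carrier G \<Longrightarrow>
    commutator G (z \<otimes> x) y = commutator G x y"
  by (simp add: commutator_mult_left center_closed)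

lemma commutator_center_mult_right:
  "z \<in> center G \<Longrightarrow> x \<in> carrier G \<Longrightarrow> y \<in> carrier G \<Longrightarrow>
    commutator G y (z \<otimes> x) = commutator G y x"
  by (simp add: commutator_mult_right center_closed)

text \<open>By bilinearity [x y^-1, u] is the quotient of [x, u] and [y, u], so the coset of
  \<open>x\<close> carries the same information as the map u \<mapsto> [x, u]. Cosets can thus be
  compared through commutators.\<close>

lemma coset_center_eq_iff:
  assumes x: "x \<in> carrier G" and y: "y \<in> carrier G"
  shows "center G #> x = center G #> y \<longleftrightarrow>
    (\<forall>u\<in>carrier G. commutator G x u = commutator G y u)"
proof -
  have "center G #> x = center G #> y \<longleftrightarrow> x \<otimes> inv y \<in> center G"
  proof
    assume "center G #> x = center G #> y"
    then have "x \<in> center G #> y"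
      using rcos_self[OF x subgroup_center] by simp
    then obtain z where "z \<in> center G" "x = z \<otimes> y"
      by (auto simp: r_coset_def)
    then show "x \<otimes> inv y \<in> center G"
      using y center_closed by (simp add: m_assoc)
  next
    assume "x \<otimes> inv y \<in> center G"
    then have "(x \<otimes> inv y) \<otimes> y \<in> center G #> y"
      by (auto simp: r_coset_def)
    then have "x \<in> center G #> y" using x y by (simp add: m_assoc)
    then show "center G #> x = center G #> y"
      using repr_independence[OF _ y subgroup_center] by simp
  qed
  also have "\<dots> \<longleftrightarrow> (\<forall>u\<in>carrier G. commutator G (x \<otimes> inv y) u = \<one>)"
    using x y by (intro mem_center_iff) simp
  also have "\<dots> \<longleftrightarrow> (\<forall>u\<in>carrier G. commutator G x u = commutator G y u)"
  proof (rule ball_cong[OF HOL.refl])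
    fix u assume u: "u \<in> carrier G"
    have "commutator G (x \<otimes> inv y) u = commutator G x u \<otimes> inv (commutator G y u)"
      using x y u by (simp add: commutator_mult_left commutator_inv_left)
    then show "commutator G (x \<otimes> inv y) u = \<one> \<longleftrightarrow> commutator G x u = commutator G y u"
      using inv_solve_right'[of \<one> "commutator G x u" "commutator G y u"] x y u by auto
  qed
  finally show ?thesis .
qed

end

text \<open>Both groups are images of one parameter type under maps that identify the same
  parameters, so \<open>f t\<close> \<mapsto> \<open>f' t\<close> is well defined and injective.
  \<open>inv_into\<close> picks any parameter, and \<open>eq\<close> makes the choice
  harmless.\<close>

lemma iso_from_parametrization:
  fixes G :: "('a, 'e) monoid_scheme" and H :: "('c, 'd) monoid_scheme"
    and f :: "'t::plus \<Rightarrow> 'a" and f' :: "'t \<Rightarrow> 'c"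
  assumes G: "carrier G = range f" and H: "carrier H = range f'"
    and f: "\<And>s t. f (s + t) = f s \<otimes>\<^bsub>G\<^esub> f t" and f': "\<And>s t. f' (s + t) = f' s \<otimes>\<^bsub>H\<^esub> f' t"
    and eq: "\<And>s t. f s = f t \<longleftrightarrow> f' s = f' t"
  shows "\<exists>\<phi>\<in>iso G H. \<forall>t. \<phi> (f t) = f' t"
proof (intro bexI allI)
  let ?\<phi> = "f' \<circ> inv_into UNIV f"
  show v: "?\<phi> (f t) = f' t" for t
    using eq[of "inv_into UNIV f (f t)" t] by (simp add: f_inv_into_f)
  show "?\<phi> \<in> iso G H"
  proof (rule isoI)
    show "?\<phi> \<in> hom G H"
    proof (rule homI)
      fix x y assume "x \<in> carrier G" "y \<in> carrier G"
      then obtain s t where "x = f s" "y = f t" using G by auto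
      then show "?\<phi> (x \<otimes>\<^bsub>G\<^esub> y) = ?\<phi> x \<otimes>\<^bsub>H\<^esub> ?\<phi> y"
        using v f f' by metis
    qed (auto simp: H)
    show "bij_betw ?\<phi> (carrier G) (carrier H)"
    proof (rule bij_betw_imageI)
      show "inj_on ?\<phi> (carrier G)"
        unfolding G using v eq by (intro inj_onI) (metis imageE)
      show "?\<phi> ` carrier G = carrier H"
        unfolding G H image_image v ..
    qed
  qed
qed

text \<open>A group of class two is determined up to isoclinism by the data \<open>c\<close>, \<open>E\<close>, where \<open>E q r\<close>
  says when the parameters \<open>q\<close> and \<open>r\<close> describe the same element of the derived subgroup.\<close>

locale coordinates = class2_group G for G (structure) +
  fixes a :: "'t::plus \<Rightarrow> 'a" and b :: "'s::plus \<Rightarrow> 'a"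
    and c :: "'t \<Rightarrow> 't \<Rightarrow> 's" and E :: "'s \<Rightarrow> 's \<Rightarrow> bool"
  assumes a_closed [simp]: "a t \<in> carrier G"
    and a_cover: "x \<in> carrier G \<Longrightarrow> \<exists>t. \<exists>z\<in>center G. x = z \<otimes> a t"
    and commutator_a: "commutator G (a s) (a t) = b (c s t)"
    and c_add: "c (s + t) u = c s u + c t u"
    and b_add: "b (q + r) = b q \<otimes> b r"
    and b_eq_iff: "b q = b r \<longleftrightarrow> E q r"
    and c_surj: "\<exists>s t. q = c s t"
begin

lemma b_central: "b q \<in> center G"
  using c_surj[of q] commutator_a commutator_central a_closed by metis

lemma coset_center_eq_iff_a:
  assumes x: "x \<in> carrier G" and y: "y \<in> carrier G"
  shows "center G #> x = center G #> y \<longleftrightarrow>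
    (\<forall>u. commutator G x (a u) = commutator G y (a u))"
proof
  assume "center G #> x = center G #> y"
  then show "\<forall>u. commutator G x (a u) = commutator G y (a u)"
    using coset_center_eq_iff[OF x y] by simp
next
  assume r: "\<forall>u. commutator G x (a u) = commutator G y (a u)"
  have "commutator G x v = commutator G y v" if v: "v \<in> carrier G" for v
  proof -
    obtain u z where "z \<in> center G" "v = z \<otimes> a u" using a_cover[OF v] by blast
    then show ?thesis using r x y by (simp add: commutator_center_mult_right)
  qed
  then show "center G #> x = center G #> y"
    using coset_center_eq_iff[OF x y] by blast
qed

text \<open>The right-hand side speaks of \<open>c\<close> and \<open>E\<close> alone, hence is the
  same condition for any two groups with these data.\<close>

lemma coset_a_eq_iff:
  "center G #> a s = center G #> a t \<longleftrightarrow> (\<forall>u. E (c s u) (c t u))"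
  by (simp add: coset_center_eq_iff_a commutator_a b_eq_iff)

lemma carrier_Mod: "carrier (G Mod center G) = range (\<lambda>t. center G #> a t)"
proof -
  have "\<exists>t. center G #> x = center G #> a t" if x: "x \<in> carrier G" for x
  proof -
    obtain t z where "z \<in> center G" "x = z \<otimes> a t" using a_cover[OF x] by blast
    then have "x \<in> center G #> a t" by (auto simp: r_coset_def)
    then show ?thesis using repr_independence[OF _ a_closed subgroup_center] by auto
  qed
  moreover have "carrier (G Mod center G) = {center G #> x | x. x \<in> carrier G}"
    by (auto simp: FactGroup_def RCOSETS_def)
  moreover have "\<And>t. \<exists>x. center G #> a t = center G #> x \<and> x \<in> carrier G"
    using a_closed by blast
  ultimately show ?thesis by (auto simp: image_iff)
qed

lemma coset_a_cover: "x \<in> carrier G \<Longrightarrow> \<exists>t. center G #> x = center G #> a t"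
proof -
  assume "x \<in> carrier G"
  then have "center G #> x \<in> carrier (G Mod center G)"
    by (auto simp: FactGroup_def RCOSETS_def)
  then show ?thesis by (auto simp: carrier_Mod)
qed

text \<open>\<open>a\<close> is not assumed multiplicative. As \<open>c\<close> is additive in its
  first argument, \<open>a (s + t)\<close> and \<open>a s \<otimes> a t\<close> have the same
  commutators with every \<open>a u\<close>, which suffices modulo the center.\<close>

lemma coset_a_add:
  "center G #> a (s + t) = (center G #> a s) \<otimes>\<^bsub>G Mod center G\<^esub> (center G #> a t)"
proof -
  have "center G #> a (s + t) = center G #> (a s \<otimes> a t)"
    by (simp add: coset_center_eq_iff_a commutator_a commutator_mult_left c_add b_add)
  then show ?thesis by (simp add: FactGroup_def normal.rcos_sum[OF normal_center])
qed

lemma gamma2_eq: "gamma2 G = range b"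
proof
  have "b q \<in> gamma2 G" for q
    using c_surj[of q] commutator_a commutator_in_gamma2 a_closed by metis
  then show "range b \<subseteq> gamma2 G" by auto
  have cb: "\<exists>q. commutator G x y = b q" if xy: "x \<in> carrier G" "y \<in> carrier G" for x y
  proof -
    obtain s z where "z \<in> center G" "x = z \<otimes> a s" using a_cover[OF xy(1)] by blast
    moreover obtain t w where "w \<in> center G" "y = w \<otimes> a t" using a_cover[OF xy(2)] by blast
    ultimately
    have "commutator G x y = b (c s t)"
      by (simp add: commutator_center_mult_left commutator_center_mult_right
          center_closed commutator_a)
    then show ?thesis ..
  qed
  have "subgroup (range b) G"
  proof (rule subgroupI)
    show "range b \<subseteq> carrier G" using b_central center_closed by auto
    fix x assume "x \<in> range b"
    \<comment> \<open>Closure under inverses is not part of the data. It comes from [x, y]^-1 =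
      [y, x], since \<open>c_surj\<close> makes every \<open>b q\<close> a single
      commutator.\<close>
    then obtain s t where x: "x = commutator G (a s) (a t)"
      using c_surj commutator_a by (metis imageE)
    then have "inv x = commutator G (a t) (a s)" by (simp add: inv_commutator)
    then show "inv x \<in> range b" by (simp add: commutator_a)
    fix y assume "y \<in> range b"
    with \<open>x \<in> range b\<close> show "x \<otimes> y \<in> range b" by (auto simp: b_add [symmetric])
  qed auto
  then show "gamma2 G \<subseteq> range b"
    using gamma2_subset_iff cb by blast
qed

end

lemma isoclinic_coordinates:
  assumes "coordinates G a b c E" "coordinates H a' b' c E"
  shows "isoclinic G H"
proof -
  interpret G: coordinates G a b c E by fact
  interpret H: coordinates H a' b' c E by fact
  have "\<exists>\<theta>\<in>iso (G Mod center G) (H Mod center H). \<forall>t.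
      \<theta> (center G #>\<^bsub>G\<^esub> a t) = center H #>\<^bsub>H\<^esub> a' t"
    by (rule iso_from_parametrization[where f = "\<lambda>t. center G #>\<^bsub>G\<^esub> a t"
          and f' = "\<lambda>t. center H #>\<^bsub>H\<^esub> a' t"])
      (rule G.carrier_Mod H.carrier_Mod G.coset_a_add H.coset_a_add
        G.coset_a_eq_iff[THEN HOL.trans, OF H.coset_a_eq_iff[symmetric]])+
  then obtain \<theta> where \<theta>: "\<theta> \<in> iso (G Mod center G) (H Mod center H)"
    "\<And>t. \<theta> (center G #>\<^bsub>G\<^esub> a t) = center H #>\<^bsub>H\<^esub> a' t" by blast
  have "\<exists>\<phi>\<in>iso (G\<lparr>carrier := gamma2 G\<rparr>) (H\<lparr>carrier := gamma2 H\<rparr>). \<forall>q. \<phi> (b q) = b' q"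
    by (rule iso_from_parametrization[where f = b and f' = b'])
      (simp_all add: G.gamma2_eq H.gamma2_eq G.b_add H.b_add G.b_eq_iff H.b_eq_iff)
  then obtain \<phi> where \<phi>: "\<phi> \<in> iso (G\<lparr>carrier := gamma2 G\<rparr>) (H\<lparr>carrier := gamma2 H\<rparr>)"
    "\<And>q. \<phi> (b q) = b' q" by blast
  show ?thesis
    unfolding isoclinic_def
  proof (intro bexI[OF _ \<theta>(1)] bexI[OF _ \<phi>(1)] ballI impI)
    fix x y x' y'
    assume xy: "x \<in> carrier G" "y \<in> carrier G" "x' \<in> carrier H" "y' \<in> carrier H"
      and x': "center H #>\<^bsub>H\<^esub> x' = \<theta> (center G #>\<^bsub>G\<^esub> x)"
      and y': "center H #>\<^bsub>H\<^esub> y' = \<theta> (center G #>\<^bsub>G\<^esub> y)"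
    obtain s t where s: "center G #>\<^bsub>G\<^esub> x = center G #>\<^bsub>G\<^esub> a s"
      and t: "center G #>\<^bsub>G\<^esub> y = center G #>\<^bsub>G\<^esub> a t"
      using xy G.coset_a_cover by meson
    have s': "center H #>\<^bsub>H\<^esub> x' = center H #>\<^bsub>H\<^esub> a' s" using s x' \<theta>(2) by simp
    have t': "center H #>\<^bsub>H\<^esub> y' = center H #>\<^bsub>H\<^esub> a' t" using t y' \<theta>(2) by simp
    have "commutator G x y = b (c s t)"
    proof -
      have "commutator G x y = commutator G (a s) y"
        using s xy by (simp add: G.coset_center_eq_iff)
      \<comment> \<open>\<open>coset_center_eq_iff\<close> replaces the left argument, so the right
        one is reached by inverting.\<close>
      also have "\<dots> = inv\<^bsub>G\<^esub> (commutator G y (a s))" using xy by (simp add: G.inv_commutator)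
      also have "\<dots> = inv\<^bsub>G\<^esub> (commutator G (a t) (a s))"
        using t xy by (simp add: G.coset_center_eq_iff)
      also have "\<dots> = commutator G (a s) (a t)" by (simp add: G.inv_commutator)
      finally show ?thesis by (simp add: G.commutator_a)
    qed
    moreover have "commutator H x' y' = b' (c s t)"
    proof -
      have "commutator H x' y' = commutator H (a' s) y'"
        using s' xy by (simp add: H.coset_center_eq_iff)
      also have "\<dots> = inv\<^bsub>H\<^esub> (commutator H y' (a' s))" using xy by (simp add: H.inv_commutator)
      also have "\<dots> = inv\<^bsub>H\<^esub> (commutator H (a' t) (a' s))"
        using t' xy by (simp add: H.coset_center_eq_iff)
      also have "\<dots> = commutator H (a' s) (a' t)" by (simp add: H.inv_commutator)
      finally show ?thesis by (simp add: H.commutator_a)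
    qed
    ultimately show "\<phi> (commutator G x y) = commutator H x' y'"
      by (simp add: \<phi>(2))
  qed
qed

section \<open>Adjoining an element to a subgroup; orders modulo a subgroup\<close>

definition adjoin :: "('a, 'b) monoid_scheme \<Rightarrow> 'a set \<Rightarrow> 'a \<Rightarrow> 'a set" where
  "adjoin G K x = {k \<otimes>\<^bsub>G\<^esub> x [^]\<^bsub>G\<^esub> (i::int) | k i. k \<in> K}"

text \<open>For normal \<open>K\<close> this is the order of the coset of \<open>x\<close> in G / K,
  and for \<open>K\<close> = {1} the order of \<open>x\<close>; membership of powers takes the place
  of a quotient group.\<close>

definition ord_mod :: "('a, 'b) monoid_scheme \<Rightarrow> 'a set \<Rightarrow> 'a \<Rightarrow> nat" where
  "ord_mod G K x = (LEAST d. 0 < d \<and> x [^]\<^bsub>G\<^esub> d \<in> K)"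

context group
begin

lemma conjugate_mem:
  assumes K: "subgroup K G" and "gamma2 G \<subseteq> K" and l: "l \<in> K" and g: "g \<in> carrier G"
  shows "g \<otimes> l \<otimes> inv g \<in> K"
proof -
  have lc: "l \<in> carrier G" using subgroup.mem_carrier[OF K l] .
  then have "g \<otimes> l \<otimes> inv g = l \<otimes> commutator G l (inv g)"
    using g by (simp add: commutator_def m_assoc)
  moreover have "commutator G l (inv g) \<in> K"
    using assms(2) commutator_in_gamma2 lc g by auto
  ultimately show ?thesis using subgroup.m_closed[OF K l] by simp
qed

lemma mult_adjoin_form:
  assumes "k \<in> carrier G" "l \<in> carrier G" "x \<in> carrier G"
  shows "(k \<otimes> x [^] (i::int)) \<otimes> (l \<otimes> x [^] (j::int)) =
    (k \<otimes> (x [^] i \<otimes> l \<otimes> inv (x [^] i))) \<otimes> x [^] (i + j)"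
  using assms by (simp add: m_assoc int_pow_mult)

text \<open>A subgroup above gamma_2(G) is normal, so a power of \<open>x\<close> can be moved past
  an element of \<open>K\<close> at the cost of a conjugate, which stays in
  \<open>K\<close>.\<close>

lemma subgroup_adjoin:
  assumes K: "subgroup K G" and g2: "gamma2 G \<subseteq> K" and x: "x \<in> carrier G"
  shows "subgroup (adjoin G K x) G"
proof (rule subgroupI)
  note Kc = subgroup.mem_carrier[OF K]
  show "adjoin G K x \<subseteq> carrier G"
    using Kc x by (auto simp: adjoin_def)
  have "\<one> \<otimes> x [^] (0::int) \<in> adjoin G K x"
    unfolding adjoin_def using subgroup.one_closed[OF K] by blast
  then show "adjoin G K x \<noteq> {}" by blast
  fix u assume "u \<in> adjoin G K x"
  then obtain k and i :: int where u: "u = k \<otimes> x [^] i" "k \<in> K"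
    by (auto simp: adjoin_def)
  have "inv u = x [^] (-i) \<otimes> inv k \<otimes> inv (x [^] (-i)) \<otimes> x [^] (-i)"
    using u Kc x by (simp add: inv_mult_group int_pow_neg m_assoc)
  moreover have "x [^] (-i) \<otimes> inv k \<otimes> inv (x [^] (-i)) \<in> K"
    using conjugate_mem[OF K g2 subgroup.m_inv_closed[OF K u(2)]] x by simp
  ultimately show "inv u \<in> adjoin G K x"
    unfolding adjoin_def by blast
  fix v assume "v \<in> adjoin G K x"
  then obtain l and j :: int where v: "v = l \<otimes> x [^] j" "l \<in> K"
    by (auto simp: adjoin_def)
  have "u \<otimes> v = (k \<otimes> (x [^] i \<otimes> l \<otimes> inv (x [^] i))) \<otimes> x [^] (i + j)"
    unfolding u v using mult_adjoin_form Kc u v x by blast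
  moreover have "k \<otimes> (x [^] i \<otimes> l \<otimes> inv (x [^] i)) \<in> K"
    using conjugate_mem[OF K g2 v(2)] u(2) x subgroup.m_closed[OF K] by simp
  ultimately show "u \<otimes> v \<in> adjoin G K x"
    unfolding adjoin_def by blast
qed

lemma subset_adjoin:
  assumes K: "subgroup K G" and x: "x \<in> carrier G"
  shows "K \<subseteq> adjoin G K x"
proof
  fix k assume "k \<in> K"
  then have "k = k \<otimes> x [^] (0::int)" using subgroup.mem_carrier[OF K] by simp
  then show "k \<in> adjoin G K x" unfolding adjoin_def using \<open>k \<in> K\<close> by blast
qed

lemma mem_adjoin:
  assumes K: "subgroup K G" and x: "x \<in> carrier G"
  shows "x \<in> adjoin G K x"
proof -
  have "x = \<one> \<otimes> x [^] (1::int)" using x by simp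
  then show ?thesis unfolding adjoin_def using subgroup.one_closed[OF K] by blast
qed

lemma adjoin_subset:
  assumes "subgroup D G" "K \<subseteq> D" "x \<in> D"
  shows "adjoin G K x \<subseteq> D"
  using assms subgroup.m_closed[OF assms(1)] subgroup_int_pow_closed[OF assms(1)]
  by (auto simp: adjoin_def)

lemma
  assumes fin: "finite (carrier G)" and K: "subgroup K G" and x: "x \<in> carrier G"
  shows ord_mod_pos: "0 < ord_mod G K x"
    and int_pow_mem_iff: "x [^] (i::int) \<in> K \<longleftrightarrow> int (ord_mod G K x) dvd i"
proof -
  let ?d = "ord_mod G K x"
  have "0 < order G \<and> x [^] order G \<in> K"
    using fin x subgroup.one_closed[OF K] order_gt_0_iff_finite pow_order_eq_1 by simp
  then have d: "0 < ?d \<and> x [^] ?d \<in> K"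
    unfolding ord_mod_def by (rule LeastI)
  then show "0 < ?d" by simp
  have xd: "x [^] (int ?d * q) \<in> K" for q
    using subgroup_int_pow_closed[OF K, of "x [^] ?d" q] d x
    by (simp add: int_pow_pow int_pow_int [symmetric])
  show "x [^] i \<in> K \<longleftrightarrow> int ?d dvd i"
  proof
    assume i: "x [^] i \<in> K"
    define r where "r = nat (i mod int ?d)"
    have r: "int r = i mod int ?d" using d by (simp add: r_def)
    have "x [^] r = x [^] i \<otimes> inv (x [^] (int ?d * (i div int ?d)))"
    proof -
      have "int r = i - int ?d * (i div int ?d)"
        unfolding r by (simp add: minus_mult_div_eq_mod)
      then show ?thesis
        using x int_pow_diff[OF x, of i "int ?d * (i div int ?d)"] int_pow_int[of G x r] by simp
    qed
    then have xr: "x [^] r \<in> K"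
      using subgroup.m_closed[OF K i subgroup.m_inv_closed[OF K xd]] by simp
    have "r = 0"
    proof (rule ccontr)
      assume "r \<noteq> 0"
      then have "?d \<le> r"
        using xr Least_le[of "\<lambda>d. 0 < d \<and> x [^] d \<in> K" r] by (simp add: ord_mod_def)
      moreover have "int r < int ?d" unfolding r using d by simp
      ultimately show False by simp
    qed
    then show "int ?d dvd i" using r by (simp add: dvd_eq_mod_eq_0)
  next
    assume "int ?d dvd i"
    then obtain q where "i = int ?d * q" ..
    then show "x [^] i \<in> K" using xd by simp
  qed
qed

lemma nat_pow_mem_iff:
  assumes "finite (carrier G)" "subgroup K G" "x \<in> carrier G"
  shows "x [^] (n::nat) \<in> K \<longleftrightarrow> ord_mod G K x dvd n"
  using int_pow_mem_iff[OF assms, of "int n"] by (simp add: int_pow_int)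

text \<open>Every element of the adjoined set is k x^i for exactly one k in \<open>K\<close> and one
  i with 0 <= i < d, where d is the order of \<open>x\<close> modulo \<open>K\<close>.\<close>

lemma card_adjoin:
  assumes fin: "finite (carrier G)" and K: "subgroup K G" and x: "x \<in> carrier G"
  shows "card (adjoin G K x) = ord_mod G K x * card K"
proof -
  let ?d = "ord_mod G K x"
  note Kc = subgroup.mem_carrier[OF K]
  define f where "f = (\<lambda>(i, k). k \<otimes> x [^] (i::int))"
  have "inj_on f ({0..<int ?d} \<times> K)"
  proof (rule inj_onI, clarify)
    fix i k j l
    assume ij: "i \<in> {0..<int ?d}" "j \<in> {0..<int ?d}" and kl: "k \<in> K" "l \<in> K"
      and "f (i, k) = f (j, l)"
    then have eq: "k \<otimes> x [^] i = l \<otimes> x [^] j" by (simp add: f_def)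
    have "x [^] (i - j) = inv k \<otimes> (k \<otimes> x [^] i) \<otimes> inv (x [^] j)"
      using kl Kc x by (simp add: int_pow_diff)
    also have "\<dots> = inv k \<otimes> l"
      unfolding eq using kl Kc x by (simp add: m_assoc)
    finally have "x [^] (i - j) \<in> K"
      using subgroup.m_closed[OF K subgroup.m_inv_closed[OF K kl(1)] kl(2)] by simp
    then have "int ?d dvd i - j" using int_pow_mem_iff[OF fin K x] by simp
    then have "i = j" using ij zdvd_imp_le[of "int ?d" "i - j"] zdvd_imp_le[of "int ?d" "j - i"]
      by (cases "i < j"; cases "j < i") (auto simp: dvd_diff_commute)
    moreover have "k = l" using eq kl Kc x \<open>i = j\<close> by simp
    ultimately show "i = j \<and> k = l" by simp
  qed
  moreover have "f ` ({0..<int ?d} \<times> K) = adjoin G K x"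
  proof
    show "f ` ({0..<int ?d} \<times> K) \<subseteq> adjoin G K x" by (auto simp: f_def adjoin_def)
    show "adjoin G K x \<subseteq> f ` ({0..<int ?d} \<times> K)"
    proof
      fix u assume "u \<in> adjoin G K x"
      then obtain k and i :: int where u: "u = k \<otimes> x [^] i" "k \<in> K"
        by (auto simp: adjoin_def)
      let ?r = "i mod int ?d"
      have xr: "x [^] (i - ?r) \<in> K"
        using int_pow_mem_iff[OF fin K x] by simp
      have "u = (k \<otimes> x [^] (i - ?r)) \<otimes> x [^] ?r"
        using u Kc x int_pow_mult[OF x, of "i - ?r" ?r] by (simp add: m_assoc)
      moreover have "k \<otimes> x [^] (i - ?r) \<in> K" using subgroup.m_closed[OF K u(2) xr] .
      moreover have "?r \<in> {0..<int ?d}" using ord_mod_pos[OF fin K x] by simp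
      ultimately show "u \<in> f ` ({0..<int ?d} \<times> K)" by (auto simp: f_def image_iff)
    qed
  qed
  ultimately have "card (adjoin G K x) = card ({0..<int ?d} \<times> K)"
    using card_image by metis
  then show ?thesis by (simp add: card_cartesian_product)
qed

lemma card_image_mult_card_kernel:
  assumes fin: "finite (carrier G)" and D: "subgroup D G" and H: "group H"
    and h: "\<And>x y. x \<in> D \<Longrightarrow> y \<in> D \<Longrightarrow> h (x \<otimes> y) = h x \<otimes>\<^bsub>H\<^esub> h y"
    and hc: "\<And>x. x \<in> D \<Longrightarrow> h x \<in> carrier H"
  shows "card D = card (h ` D) * card {x \<in> D. h x = \<one>\<^bsub>H\<^esub>}"
proof -
  let ?D = "G\<lparr>carrier := D\<rparr>"
  interpret D: group ?D using subgroup_imp_group[OF D] .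
  have hom: "h \<in> hom ?D H" using h hc by (intro homI) simp_all
  then have "group_hom ?D H h"
    by (intro group_hom.intro D.is_group H group_hom_axioms.intro)
  then have "subgroup (h ` D) H" using group_hom.img_is_subgroup by fastforce
  then have L: "group (H\<lparr>carrier := h ` D\<rparr>)" (is "group ?L")
    using group.subgroup_imp_group[OF H] by blast
  interpret h: group_hom ?D ?L h
    using h by (intro group_hom.intro D.is_group L group_hom_axioms.intro homI) simp_all
  have "card (rcosets\<^bsub>?D\<^esub> kernel ?D ?L h) * card (kernel ?D ?L h) = order ?D"
    using D.lagrange[OF h.subgroup_kernel] .
  moreover have "bij_betw (\<lambda>Y. the_elem (h ` Y)) (carrier (?D Mod kernel ?D ?L h)) (h ` D)"
    using h.FactGroup_iso_set by (simp add: iso_def)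
  from bij_betw_same_card[OF this]
  have "card (rcosets\<^bsub>?D\<^esub> kernel ?D ?L h) = card (h ` D)" by (simp add: FactGroup_def)
  ultimately show ?thesis by (simp add: order_def kernel_def)
qed

end

lemma (in class2_group) adjoin_chain:
  assumes "subgroup K G" "center G \<subseteq> K" "x \<in> carrier G"
  shows "subgroup (adjoin G K x) G" "center G \<subseteq> adjoin G K x" "K \<subseteq> adjoin G K x"
    "x \<in> adjoin G K x"
  using assms gamma2_subset_center subgroup_adjoin subset_adjoin mem_adjoin
  by (meson subset_trans)+

section \<open>The two normal forms\<close>

text \<open>The determinant: in class two, the commutator of x^i y^j and x^k y^l is [x, y] raised to
  this exponent.\<close>

definition comm14 :: "int \<times> int \<Rightarrow> int \<times> int \<Rightarrow> int" where
  "comm14 = (\<lambda>(i, j) (k, l). i * l - j * k)"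

definition eq14 :: "nat \<Rightarrow> int \<Rightarrow> int \<Rightarrow> bool" where
  "eq14 n q r \<longleftrightarrow> int n dvd q - r"

text \<open>For generators with the commutators of \<open>rels15\<close>, the exponents of beta_1
  and beta_2 in the commutator of two products of powers: the pairs 12 and 34 contribute to beta_1,
  the pairs 13 and, with weight \<open>g\<close>, 24 to beta_2.\<close>

definition comm15 :: "int \<Rightarrow> int \<times> int \<times> int \<times> int \<Rightarrow> int \<times> int \<times> int \<times> int \<Rightarrow> int \<times> int" where
  "comm15 g = (\<lambda>(i1, i2, i3, i4) (j1, j2, j3, j4).
     (i1 * j2 - i2 * j1 + i3 * j4 - i4 * j3, i1 * j3 - i3 * j1 + g * (i2 * j4 - i4 * j2)))"

definition eq15 :: "nat \<Rightarrow> int \<times> int \<Rightarrow> int \<times> int \<Rightarrow> bool" where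
  "eq15 p = (\<lambda>(m, n) (m', n'). int p dvd m - m' \<and> int p dvd n - n')"

text \<open>The binary form \<open>X\<^sup>2 - g Y\<^sup>2\<close> is anisotropic modulo \<open>p\<close>, that is, \<open>g\<close> is a non-residue.\<close>

definition nonresidue :: "nat \<Rightarrow> int \<Rightarrow> bool" where
  "nonresidue p g \<longleftrightarrow> (\<forall>x y. int p dvd x\<^sup>2 - g * y\<^sup>2 \<longrightarrow> int p dvd x \<and> int p dvd y)"

text \<open>In class two [x, w]^m = [x^m, w], so the condition on powers is necessary for
  \<open>y\<close> to be a commutator with \<open>x\<close>; the property says that it is
  sufficient. It involves G / Z(G), gamma_2(G) and commutators, all of which an isoclinism
  transports.\<close>

definition full_commutators :: "('a, 'b) monoid_scheme \<Rightarrow> bool" where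
  "full_commutators G \<longleftrightarrow> (\<forall>x\<in>carrier G. \<forall>y\<in>gamma2 G.
     (\<forall>m::nat. x [^]\<^bsub>G\<^esub> m \<in> center G \<longrightarrow> y [^]\<^bsub>G\<^esub> m = \<one>\<^bsub>G\<^esub>) \<longrightarrow>
     (\<exists>w\<in>carrier G. commutator G x w = y))"

lemma card_range_transversal:
  assumes "\<And>s. \<exists>t\<in>T. f s = f t" "inj_on f T"
  shows "card (range f) = card T"
proof -
  have "range f = f ` T" using assms(1) by fast
  then show ?thesis using card_image[OF assms(2)] by simp
qed

lemma dvd_diff_residues_iff:
  fixes i j :: int
  assumes "i \<in> {0..<int n}" "j \<in> {0..<int n}"
  shows "int n dvd i - j \<longleftrightarrow> i = j"
  using assms by (simp add: mod_eq_dvd_iff [symmetric])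

lemma (in class2_group) coordinates14:
  assumes x: "x \<in> carrier G" and y: "y \<in> carrier G"
    and cover: "carrier G = adjoin G (adjoin G (center G) x) y"
    and ord: "\<And>k::int. commutator G x y [^] k = \<one> \<longleftrightarrow> int n dvd k"
  shows "coordinates G (\<lambda>(i, j). x [^] i \<otimes> y [^] j) (\<lambda>k. commutator G x y [^] k) comm14 (eq14 n)"
proof
  \<comment> \<open>All commutators below are powers of [x, y]. Written as \<open>\<beta>\<close> of
    an exponent they multiply by adding integers, and the claim becomes integer algebra.\<close>
  define \<beta> where "\<beta> = (\<lambda>k::int. commutator G x y [^] k)"
  have \<beta>: "\<beta> q \<otimes> \<beta> r = \<beta> (q + r)" "\<beta> q [^] i = \<beta> (q * i)" for q r i :: int
    using x y by (simp_all add: \<beta>_def int_pow_mult int_pow_pow)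
  have base: "commutator G x y = \<beta> 1" "commutator G y x = \<beta> (-1)" "\<one> = \<beta> 0"
    using x y by (simp_all add: \<beta>_def int_pow_neg inv_commutator)
  fix s t u :: "int \<times> int" and q r :: int and w
  show "(case t of (i, j) \<Rightarrow> x [^] i \<otimes> y [^] j) \<in> carrier G"
    using x y by (simp split: prod.split)
  show "\<exists>t :: int \<times> int. \<exists>z\<in>center G. w = z \<otimes> (case t of (i, j) \<Rightarrow> x [^] i \<otimes> y [^] j)" if "w \<in> carrier G"
  proof -
    obtain z i j where "z \<in> center G" "w = z \<otimes> x [^] (i::int) \<otimes> y [^] (j::int)"
      using \<open>w \<in> carrier G\<close> unfolding cover adjoin_def by auto
    moreover from this have "w = z \<otimes> (case (i, j) of (i, j) \<Rightarrow> x [^] i \<otimes> y [^] j)"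
      using x y center_closed by (simp add: m_assoc)
    ultimately show ?thesis by - (rule exI[of _ "(i, j)"], rule bexI[of _ z])
  qed
  obtain i j k l where "s = (i, j)" "t = (k, l)" by fastforce
  then show "commutator G (case s of (i, j) \<Rightarrow> x [^] i \<otimes> y [^] j)
      (case t of (i, j) \<Rightarrow> x [^] i \<otimes> y [^] j) = commutator G x y [^] comm14 s t"
    using x y
    by (simp add: commutator_mult_left commutator_mult_right commutator_int_pow_left
        commutator_int_pow_right base \<beta> flip: \<beta>_def)
      (simp add: comm14_def algebra_simps)
  show "comm14 (s + t) u = comm14 s u + comm14 t u"
    by (cases s; cases t; cases u) (simp add: comm14_def algebra_simps)
  show "commutator G x y [^] (q + r) = commutator G x y [^] q \<otimes> commutator G x y [^] r"
    using x y by (simp add: int_pow_mult)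
  have "commutator G x y [^] q = commutator G x y [^] r \<longleftrightarrow> commutator G x y [^] (q - r) = \<one>"
    using x y inv_solve_right'[of \<one> "commutator G x y [^] q" "commutator G x y [^] r"]
    by (auto simp: int_pow_diff)
  then show "commutator G x y [^] q = commutator G x y [^] r \<longleftrightarrow> eq14 n q r"
    by (simp add: ord eq14_def)
  show "\<exists>s t. q = comm14 s t"
    by (intro exI[of _ "(1, 0)"] exI[of _ "(0, q)"]) (simp add: comm14_def)
qed

lemma (in group) central_pair_pow:
  assumes u: "u \<in> center G" and v: "v \<in> center G"
  shows central_pair_mult: "(u [^] (k::int) \<otimes> v [^] (l::int)) \<otimes> (u [^] k' \<otimes> v [^] l') =
      u [^] (k + k') \<otimes> v [^] (l + l')"
    and central_pair_int_pow: "(u [^] k \<otimes> v [^] l) [^] (i::int) = u [^] (k * i) \<otimes> v [^] (l * i)"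
    and central_pair_inv: "inv (u [^] k \<otimes> v [^] l) = u [^] (- k) \<otimes> v [^] (- l)"
proof -
  note c = u[THEN center_closed] v[THEN center_closed]
  have vu: "v [^] m \<otimes> u [^] n = u [^] n \<otimes> v [^] m" for m n :: int
    using center_commute[OF center_int_pow_closed[OF v]] c by simp
  have "(u [^] k \<otimes> v [^] l) \<otimes> (u [^] k' \<otimes> v [^] l') =
      u [^] k \<otimes> (v [^] l \<otimes> u [^] k') \<otimes> v [^] l'"
    using c by (simp add: m_assoc)
  then show "(u [^] k \<otimes> v [^] l) \<otimes> (u [^] k' \<otimes> v [^] l') = u [^] (k + k') \<otimes> v [^] (l + l')"
    using c by (simp add: vu int_pow_mult m_assoc)
  show pow: "(u [^] k \<otimes> v [^] l) [^] i = u [^] (k * i) \<otimes> v [^] (l * i)" for i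
    using c vu by (simp add: int_pow_mult_distrib int_pow_pow)
  show "inv (u [^] k \<otimes> v [^] l) = u [^] (- k) \<otimes> v [^] (- l)"
    using pow[of "-1"] c by (simp add: int_pow_neg)
qed

lemma (in class2_group) coordinates15:
  assumes a: "a1 \<in> carrier G" "a2 \<in> carrier G" "a3 \<in> carrier G" "a4 \<in> carrier G"
    and b: "b1 \<in> center G" "b2 \<in> center G"
    and comm: "commutator G a1 a2 = b1" "commutator G a3 a4 = b1" "commutator G a1 a3 = b2"
      "commutator G a2 a4 = b2 [^] g" "commutator G a1 a4 = \<one>" "commutator G a2 a3 = \<one>"
    and cover: "carrier G = adjoin G (adjoin G (adjoin G (adjoin G (center G) a1) a2) a3) a4"
    and ord: "\<And>(m::int) (n::int). b1 [^] m \<otimes> b2 [^] n = \<one> \<longleftrightarrow> int p dvd m \<and> int p dvd n"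
  shows "coordinates G (\<lambda>(i1, i2, i3, i4). a1 [^] i1 \<otimes> a2 [^] i2 \<otimes> a3 [^] i3 \<otimes> a4 [^] i4)
    (\<lambda>(m, n). b1 [^] m \<otimes> b2 [^] n) (comm15 g) (eq15 p)"
proof
  note bc = b[THEN center_closed]
  define \<beta> where "\<beta> = (\<lambda>(m::int) (n::int). b1 [^] m \<otimes> b2 [^] n)"
  have \<beta>c: "\<beta> m n \<in> carrier G" for m n using bc by (simp add: \<beta>_def)
  have \<beta>: "\<beta> m n \<otimes> \<beta> m' n' = \<beta> (m + m') (n + n')" for m n m' n'
    unfolding \<beta>_def by (rule central_pair_mult[OF b])
  have \<beta>_pow: "\<beta> m n [^] i = \<beta> (m * i) (n * i)" for m n i :: int
    unfolding \<beta>_def by (rule central_pair_int_pow[OF b])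
  have \<beta>_inv: "inv (\<beta> m n) = \<beta> (- m) (- n)" for m n
    unfolding \<beta>_def by (rule central_pair_inv[OF b])
  have base: "commutator G a1 a2 = \<beta> 1 0" "commutator G a3 a4 = \<beta> 1 0"
      "commutator G a1 a3 = \<beta> 0 1" "commutator G a2 a4 = \<beta> 0 g"
      "commutator G a1 a4 = \<beta> 0 0" "commutator G a2 a3 = \<beta> 0 0"
    using bc by (simp_all add: comm \<beta>_def)
  have base': "commutator G a2 a1 = \<beta> (-1) 0" "commutator G a4 a3 = \<beta> (-1) 0"
      "commutator G a3 a1 = \<beta> 0 (-1)" "commutator G a4 a2 = \<beta> 0 (-g)"
      "commutator G a4 a1 = \<beta> 0 0" "commutator G a3 a2 = \<beta> 0 0" "\<one> = \<beta> 0 0"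
    using a by (simp_all add: inv_commutator [symmetric] base \<beta>_inv) (simp add: \<beta>_def)
  fix s t u :: "int \<times> int \<times> int \<times> int" and q r :: "int \<times> int" and w
  show "(case t of (i1, i2, i3, i4) \<Rightarrow> a1 [^] i1 \<otimes> a2 [^] i2 \<otimes> a3 [^] i3 \<otimes> a4 [^] i4) \<in> carrier G"
    using a by (simp split: prod.split)
  show "\<exists>t :: int \<times> int \<times> int \<times> int. \<exists>z\<in>center G. w = z \<otimes>
      (case t of (i1, i2, i3, i4) \<Rightarrow> a1 [^] i1 \<otimes> a2 [^] i2 \<otimes> a3 [^] i3 \<otimes> a4 [^] i4)"
    if "w \<in> carrier G"
  proof -
    obtain z i1 i2 i3 i4 where "z \<in> center G"
      "w = z \<otimes> a1 [^] (i1::int) \<otimes> a2 [^] (i2::int) \<otimes> a3 [^] (i3::int) \<otimes> a4 [^] (i4::int)"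
      using \<open>w \<in> carrier G\<close> unfolding cover adjoin_def by auto
    moreover from this have "w = z \<otimes> (case (i1, i2, i3, i4) of (i1, i2, i3, i4) \<Rightarrow>
        a1 [^] i1 \<otimes> a2 [^] i2 \<otimes> a3 [^] i3 \<otimes> a4 [^] i4)"
      using a center_closed by (simp add: m_assoc)
    ultimately show ?thesis by - (rule exI[of _ "(i1, i2, i3, i4)"], rule bexI[of _ z])
  qed
  obtain i1 i2 i3 i4 where s: "s = (i1, i2, i3, i4)" by (cases s)
  obtain j1 j2 j3 j4 where t: "t = (j1, j2, j3, j4)" by (cases t)
  have "commutator G (a1 [^] i1 \<otimes> a2 [^] i2 \<otimes> a3 [^] i3 \<otimes> a4 [^] i4)
      (a1 [^] j1 \<otimes> a2 [^] j2 \<otimes> a3 [^] j3 \<otimes> a4 [^] j4) =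
    \<beta> (fst (comm15 g s t)) (snd (comm15 g s t))"
    using a by (simp add: commutator_mult_left commutator_mult_right commutator_int_pow_left
        commutator_int_pow_right base base' \<beta> \<beta>_pow)
      (simp add: comm15_def s t algebra_simps)
  then show "commutator G
      (case s of (i1, i2, i3, i4) \<Rightarrow> a1 [^] i1 \<otimes> a2 [^] i2 \<otimes> a3 [^] i3 \<otimes> a4 [^] i4)
      (case t of (i1, i2, i3, i4) \<Rightarrow> a1 [^] i1 \<otimes> a2 [^] i2 \<otimes> a3 [^] i3 \<otimes> a4 [^] i4) =
    (case comm15 g s t of (m, n) \<Rightarrow> b1 [^] m \<otimes> b2 [^] n)"
    by (simp add: s t \<beta>_def case_prod_unfold)
  show "comm15 g (s + t) u = comm15 g s u + comm15 g t u"
    by (cases s; cases t; cases u) (simp add: comm15_def algebra_simps)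
  obtain m n where q: "q = (m, n)" by (cases q)
  obtain m' n' where r: "r = (m', n')" by (cases r)
  show "(case q + r of (m, n) \<Rightarrow> b1 [^] m \<otimes> b2 [^] n) =
      (case q of (m, n) \<Rightarrow> b1 [^] m \<otimes> b2 [^] n) \<otimes> (case r of (m, n) \<Rightarrow> b1 [^] m \<otimes> b2 [^] n)"
    using \<beta>[of m n m' n'] by (simp add: q r \<beta>_def)
  have "\<beta> m n = \<beta> m' n' \<longleftrightarrow> \<beta> m n \<otimes> inv (\<beta> m' n') = \<one>"
    using inv_solve_right'[of \<one> "\<beta> m n" "\<beta> m' n'"] \<beta>c by auto
  also have "\<dots> \<longleftrightarrow> \<beta> (m - m') (n - n') = \<one>"
    by (simp add: \<beta>_inv \<beta>)
  finally show "(case q of (m, n) \<Rightarrow> b1 [^] m \<otimes> b2 [^] n) = (case r of (m, n) \<Rightarrow> b1 [^] m \<otimes> b2 [^] n)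
      \<longleftrightarrow> eq15 p q r"
    by (simp add: q r \<beta>_def ord eq15_def)
  show "\<exists>s t. q = comm15 g s t"
    by (intro exI[of _ "(1, 0, 0, 0)"] exI[of _ "(0, m, n, 0)"]) (simp add: comm15_def q)
qed

section \<open>Non-degeneracy and surjectivity of the two forms\<close>

lemma
  fixes G (structure)
  assumes "coordinates G a b comm14 (eq14 n)" and n: "0 < n"
  shows card_Mod_center14: "card (carrier (G Mod center G)) = n\<^sup>2"
    and card_gamma2_14: "card (gamma2 G) = n"
proof -
  interpret coordinates G a b comm14 "eq14 n" by fact
  have eq: "(\<forall>u. eq14 n (comm14 (i, j) u) (comm14 (k, l) u)) \<longleftrightarrow>
    int n dvd i - k \<and> int n dvd j - l" (is "?L \<longleftrightarrow> ?R") for i j k l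
  proof
    assume ?L
    \<comment> \<open>The determinants of (i, j) with (0, 1) and (-1, 0) are i and j, so these two
      test vectors detect both coordinates.\<close>
    from this[rule_format, of "(0, 1)"] this[rule_format, of "(-1, 0)"]
    show ?R by (simp add: eq14_def comm14_def)
  next
    assume r: ?R
    show ?L
    proof
      fix u :: "int \<times> int"
      obtain u1 u2 where u: "u = (u1, u2)" by (cases u)
      have "comm14 (i, j) u - comm14 (k, l) u = (i - k) * u2 - (j - l) * u1"
        by (simp add: u comm14_def algebra_simps)
      then show "eq14 n (comm14 (i, j) u) (comm14 (k, l) u)"
        using r by (simp add: eq14_def)
    qed
  qed
  have ceq: "center G #> a (i, j) = center G #> a (k, l) \<longleftrightarrow> int n dvd i - k \<and> int n dvd j - l"
    for i j k l
    unfolding coset_a_eq_iff by (rule eq)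
  have "card (range (\<lambda>t. center G #> a t)) = card ({0..<int n} \<times> {0..<int n})"
  proof (rule card_range_transversal)
    fix s :: "int \<times> int"
    obtain i j where s: "s = (i, j)" by (cases s)
    show "\<exists>t\<in>{0..<int n} \<times> {0..<int n}. center G #> a s = center G #> a t"
      using n by (intro bexI[of _ "(i mod int n, j mod int n)"])
        (auto simp: s ceq)
  qed (auto simp: inj_on_def ceq dvd_diff_residues_iff)
  then show "card (carrier (G Mod center G)) = n\<^sup>2"
    by (simp add: carrier_Mod card_cartesian_product power2_eq_square)
  have "card (range b) = card {0..<int n}"
  proof (rule card_range_transversal)
    fix s :: int
    show "\<exists>t\<in>{0..<int n}. b s = b t"
      using n by (intro bexI[of _ "s mod int n"]) (auto simp: b_eq_iff eq14_def)
  qed (auto simp: inj_on_def b_eq_iff eq14_def dvd_diff_residues_iff)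
  then show "card (gamma2 G) = n" by (simp add: gamma2_eq)
qed

text \<open>Non-degeneracy: pairing with (-1, 0, 0, 0) returns the second and third coordinates,
  pairing with (0, 1, 0, 0) the first and -g times the fourth, where \<open>g\<close> can be
  cancelled modulo \<open>p\<close>.\<close>

lemma comm15_eq_iff:
  assumes p: "Factorial_Ring.prime p" and g: "\<not> int p dvd g"
  shows "(\<forall>u. eq15 p (comm15 g (i1, i2, i3, i4) u) (comm15 g (j1, j2, j3, j4) u)) \<longleftrightarrow>
    int p dvd i1 - j1 \<and> int p dvd i2 - j2 \<and> int p dvd i3 - j3 \<and> int p dvd i4 - j4"
    (is "?L \<longleftrightarrow> ?R")
proof
  assume l: ?L
  from l[rule_format, of "(-1, 0, 0, 0)"] have "int p dvd i2 - j2" "int p dvd i3 - j3"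
    by (simp_all add: eq15_def comm15_def)
  moreover from l[rule_format, of "(0, 1, 0, 0)"]
  have "int p dvd i1 - j1" "int p dvd - (g * (i4 - j4))"
    by (simp_all add: eq15_def comm15_def algebra_simps)
  then have "int p dvd i1 - j1" "int p dvd i4 - j4"
    using p g prime_dvd_mult_iff[of "int p" g "i4 - j4"] by simp_all
  ultimately show ?R by simp
next
  assume r: ?R
  show ?L
  proof
    fix u :: "int \<times> int \<times> int \<times> int"
    obtain u1 u2 u3 u4 where u: "u = (u1, u2, u3, u4)" by (cases u)
    have "fst (comm15 g (i1, i2, i3, i4) u) - fst (comm15 g (j1, j2, j3, j4) u) =
        (i1 - j1) * u2 - (i2 - j2) * u1 + (i3 - j3) * u4 - (i4 - j4) * u3"
      "snd (comm15 g (i1, i2, i3, i4) u) - snd (comm15 g (j1, j2, j3, j4) u) =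
        (i1 - j1) * u3 - (i3 - j3) * u1 + (i2 - j2) * (g * u4) - (i4 - j4) * (g * u2)"
      by (simp_all add: u comm15_def algebra_simps)
    then show "eq15 p (comm15 g (i1, i2, i3, i4) u) (comm15 g (j1, j2, j3, j4) u)"
      using r by (simp add: eq15_def case_prod_unfold)
  qed
qed

lemma
  fixes G (structure)
  assumes "coordinates G a b (comm15 g) (eq15 p)"
    and p: "Factorial_Ring.prime p" and g: "\<not> int p dvd g"
  shows card_Mod_center15: "card (carrier (G Mod center G)) = p ^ 4"
    and card_gamma2_15: "card (gamma2 G) = p\<^sup>2"
proof -
  interpret coordinates G a b "comm15 g" "eq15 p" by fact
  have p0: "0 < p" using p prime_gt_0_nat by blast
  let ?I = "{0..<int p}"
  have ceq: "center G #> a (i1, i2, i3, i4) = center G #> a (j1, j2, j3, j4) \<longleftrightarrow>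
    int p dvd i1 - j1 \<and> int p dvd i2 - j2 \<and> int p dvd i3 - j3 \<and> int p dvd i4 - j4"
    for i1 i2 i3 i4 j1 j2 j3 j4
    unfolding coset_a_eq_iff by (rule comm15_eq_iff[OF p g])
  have "card (range (\<lambda>t. center G #> a t)) = card (?I \<times> ?I \<times> ?I \<times> ?I)"
  proof (rule card_range_transversal)
    fix s :: "int \<times> int \<times> int \<times> int"
    obtain i1 i2 i3 i4 where s: "s = (i1, i2, i3, i4)" by (cases s)
    show "\<exists>t\<in>?I \<times> ?I \<times> ?I \<times> ?I. center G #> a s = center G #> a t"
      using p0 by (intro bexI[of _ "(i1 mod int p, i2 mod int p, i3 mod int p, i4 mod int p)"])
        (auto simp: s ceq)
  qed (auto simp: inj_on_def ceq dvd_diff_residues_iff)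
  then show "card (carrier (G Mod center G)) = p ^ 4"
    by (simp add: carrier_Mod card_cartesian_product eval_nat_numeral)
  have "card (range b) = card (?I \<times> ?I)"
  proof (rule card_range_transversal)
    fix s :: "int \<times> int"
    obtain m n where s: "s = (m, n)" by (cases s)
    show "\<exists>t\<in>?I \<times> ?I. b s = b t"
      using p0 by (intro bexI[of _ "(m mod int p, n mod int p)"])
        (auto simp: s b_eq_iff eq15_def)
  qed (auto simp: inj_on_def b_eq_iff eq15_def dvd_diff_residues_iff)
  then show "card (gamma2 G) = p\<^sup>2"
    by (simp add: gamma2_eq card_cartesian_product power2_eq_square)
qed

text \<open>Let d be the gcd of n and the exponents i, j of \<open>x\<close>. Then x^(n/d) is
  central, so the condition on powers gives d | k for y = \<open>b k\<close>, and by Bezout every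
  multiple of d is, modulo n, a determinant with first row (i, j).\<close>

lemma full_commutators14:
  fixes G (structure)
  assumes "coordinates G a b comm14 (eq14 n)" and n: "0 < n"
  shows "full_commutators G"
  unfolding full_commutators_def
proof (intro ballI impI)
  interpret coordinates G a b comm14 "eq14 n" by fact
  fix x y
  assume x: "x \<in> carrier G" and y: "y \<in> gamma2 G"
    and xy: "\<forall>m::nat. x [^] m \<in> center G \<longrightarrow> y [^] m = \<one>"
  obtain t z where tz: "z \<in> center G" "x = z \<otimes> a t" using a_cover[OF x] by blast
  obtain i j where t: "t = (i, j)" by (cases t)
  obtain k where k: "y = b k" using y gamma2_eq by auto
  have bc: "b q \<in> carrier G" for q using b_central center_closed by blast
  have b0: "b 0 = \<one>" using b_add[of 0 0] bc[of 0] by simp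
  have b_pow: "b q [^] (m::nat) = b (int m * q)" for q m
    by (induction m) (simp_all add: b0 b_add [symmetric] algebra_simps)
  have b1: "b q = \<one> \<longleftrightarrow> int n dvd q" for q
    using b_eq_iff[of q 0] by (simp add: b0 eq14_def)
  have xc: "commutator G x (a u) = b (comm14 t u)" for u
    using tz by (simp add: commutator_center_mult_left commutator_a)
  define d where "d = gcd (gcd i j) (int n)"
  have d: "d dvd i" "d dvd j" "d dvd int n" "0 < d"
    using n by (auto simp: d_def intro: dvd_trans gcd_dvd1)
  obtain e where e: "int n = d * e" using d by blast
  have "0 < e" using e n d by (metis of_nat_0_less_iff zero_less_mult_pos)
  then obtain e' where e': "e = int e'" "0 < e'" by (metis pos_int_cases)
  have "x [^] e' \<in> center G"
  proof -
    have "commutator G (x [^] e') v = \<one>" if v: "v \<in> carrier G" for v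
    proof -
      obtain u w where u: "w \<in> center G" "v = w \<otimes> a u" using a_cover[OF v] by blast
      have "commutator G (x [^] e') v = commutator G (x [^] int e') (a u)"
        using u x by (simp add: commutator_center_mult_right int_pow_int)
      also have "\<dots> = b (comm14 t u) [^] int e'"
        using x xc by (simp add: commutator_int_pow_left)
      also have "\<dots> = b (e * comm14 t u)"
        by (simp add: int_pow_int b_pow e')
      also have "\<dots> = \<one>"
      proof -
        have "d dvd comm14 t u" using d by (simp add: comm14_def t split: prod.split)
        then show ?thesis unfolding b1 e by (simp add: mult.commute[of d])
      qed
      finally show ?thesis .
    qed
    then show ?thesis using mem_center_iff[of "x [^] e'"] x by blast
  qed
  then have "y [^] e' = \<one>" using xy by blast
  then have "int n dvd e * k" by (simp add: k b_pow b1 e')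
  then have "d dvd k" using e e' by (simp add: mult.commute)
  then obtain f where f: "k = d * f" ..
  obtain u v where uv: "u * gcd i j + v * int n = d"
    using bezout_int[of "gcd i j" "int n"] d_def by metis
  obtain u' v' where uv': "u' * i + v' * j = gcd i j"
    using bezout_int[of i j] by metis
  \<comment> \<open>One Bezout identity is substituted into the other. The witness below is (u', v')
    turned by a right angle and scaled by f u, because the form is a determinant.\<close>
  have "k = f * (u * (u' * i + v' * j) + v * int n)"
    unfolding uv' uv f by simp
  then have "comm14 t (- f * u * v', f * u * u') - k = int n * (- f * v)"
    by (simp add: t comm14_def algebra_simps)
  then have "eq14 n (comm14 t (- f * u * v', f * u * u')) k"
    by (simp add: eq14_def)
  then have "commutator G x (a (- f * u * v', f * u * u')) = y"
    unfolding xc k b_eq_iff .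
  then show "\<exists>w\<in>carrier G. commutator G x w = y" using a_closed by blast
qed

text \<open>As a linear map in s, the pairing with t is a 2 by 4 matrix. Its columns 1 and 4 have
  determinant t3^2 - g t2^2, its columns 2 and 3 have t1^2 - g t4^2. The form X^2 - g Y^2 is
  anisotropic, so one of these minors is invertible modulo \<open>p\<close> unless t
  vanishes.\<close>

lemma comm15_solvable:
  assumes p: "Factorial_Ring.prime p" and g: "nonresidue p g"
    and t: "\<not> (int p dvd t1 \<and> int p dvd t2 \<and> int p dvd t3 \<and> int p dvd t4)"
  shows "\<exists>s. eq15 p (comm15 g (t1, t2, t3, t4) s) q"
proof -
  obtain m n where q: "q = (m, n)" by (cases q)
  have inv: "\<exists>e. int p dvd D * e - 1" if "\<not> int p dvd D" for D :: int
  proof -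
    have "coprime D (int p)"
      using that p prime_imp_coprime[of "int p" D] by (simp add: coprime_commute)
    from cong_solve_coprime_int[OF this] show ?thesis by (auto simp: cong_iff_dvd_diff)
  qed
  show ?thesis
  proof (cases "int p dvd t3\<^sup>2 - g * t2\<^sup>2")
    case False
    then obtain e where e: "int p dvd (t3\<^sup>2 - g * t2\<^sup>2) * e - 1" using inv by blast
    \<comment> \<open>Cramer's rule on columns 1 and 4; \<open>e\<close> inverts the minor.\<close>
    let ?s = "(e * (m * g * t2 - n * t3), 0, 0, e * (t3 * m - t2 * n))"
    have "fst (comm15 g (t1, t2, t3, t4) ?s) - m = ((t3\<^sup>2 - g * t2\<^sup>2) * e - 1) * m"
      "snd (comm15 g (t1, t2, t3, t4) ?s) - n = ((t3\<^sup>2 - g * t2\<^sup>2) * e - 1) * n"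
      by (simp_all add: comm15_def algebra_simps power2_eq_square)
    then have "eq15 p (comm15 g (t1, t2, t3, t4) ?s) q"
      using e by (simp add: eq15_def case_prod_unfold q)
    then show ?thesis ..
  next
    case True
    then have "int p dvd t3" "int p dvd t2" 
      using g[unfolded nonresidue_def, rule_format, OF True] by auto
    then have "\<not> int p dvd t1\<^sup>2 - g * t4\<^sup>2" 
      using g[unfolded nonresidue_def, rule_format, of t1 t4] t by auto
    then obtain e where e: "int p dvd (t1\<^sup>2 - g * t4\<^sup>2) * e - 1" using inv by blast
    \<comment> \<open>Cramer's rule on columns 2 and 3.\<close>
    let ?s = "(0, e * (m * t1 + t4 * n), e * (t1 * n + g * t4 * m), 0)"
    have "fst (comm15 g (t1, t2, t3, t4) ?s) - m = ((t1\<^sup>2 - g * t4\<^sup>2) * e - 1) * m"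
      "snd (comm15 g (t1, t2, t3, t4) ?s) - n = ((t1\<^sup>2 - g * t4\<^sup>2) * e - 1) * n"
      by (simp_all add: comm15_def algebra_simps power2_eq_square)
    then have "eq15 p (comm15 g (t1, t2, t3, t4) ?s) q"
      using e by (simp add: eq15_def case_prod_unfold q)
    then show ?thesis ..
  qed
qed

lemma full_commutators15:
  fixes G (structure)
  assumes "coordinates G a b (comm15 g) (eq15 p)"
    and p: "Factorial_Ring.prime p" and g: "nonresidue p g"
  shows "full_commutators G"
  unfolding full_commutators_def
proof (intro ballI impI)
  interpret coordinates G a b "comm15 g" "eq15 p" by fact
  fix x y
  assume x: "x \<in> carrier G" and y: "y \<in> gamma2 G"
    and xy: "\<forall>m::nat. x [^] m \<in> center G \<longrightarrow> y [^] m = \<one>"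
  show "\<exists>w\<in>carrier G. commutator G x w = y"
  proof (cases "x \<in> center G")
    case True
    have "y \<in> carrier G" using y gamma2_subset_center center_closed by blast
    \<comment> \<open>A central \<open>x\<close> admits m = 1 in the condition on powers.\<close>
    then have "y = \<one>" using xy[rule_format, of 1] True x by simp
    then show ?thesis using x by (intro bexI[of _ \<one>]) simp_all
  next
    case False
    obtain t z where tz: "z \<in> center G" "x = z \<otimes> a t" using a_cover[OF x] by blast
    obtain t1 t2 t3 t4 where t: "t = (t1, t2, t3, t4)" by (cases t)
    obtain q where q: "y = b q" using y gamma2_eq by auto
    have xc: "commutator G x (a u) = b (comm15 g t u)" for u
      using tz by (simp add: commutator_center_mult_left commutator_a)
    have "\<not> (int p dvd t1 \<and> int p dvd t2 \<and> int p dvd t3 \<and> int p dvd t4)"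
    proof
      assume "int p dvd t1 \<and> int p dvd t2 \<and> int p dvd t3 \<and> int p dvd t4"
      then have "eq15 p (comm15 g t u) (0, 0)" for u
        by (cases u) (simp add: t eq15_def comm15_def)
      then have "commutator G x (a u) = commutator G \<one> (a u)" for u
        using b_eq_iff[of _ "(0, 0)"] b_add[of "(0, 0)" "(0, 0)"] b_central[of "(0, 0)"]
          center_closed by (simp add: xc)
      then have "center G #> x = center G #> \<one>"
        using coset_center_eq_iff_a[OF x one_closed] by blast
      then have "x \<in> center G"
        using rcos_self[OF x subgroup_center] center_closed by (auto simp: r_coset_def)
      then show False using False by blast
    qed
    then obtain s where "eq15 p (comm15 g t s) q" using comm15_solvable[OF p g] t by blast
    then show ?thesis using xc q b_eq_iff a_closed by metis
  qed
qed

section \<open>The presented groups\<close>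

text \<open>A zero with \<open>y\<close> invertible yields the square root x / y of
  \<open>g\<close>, and a square root y of \<open>g\<close> yields the zero (y, 1).\<close>

lemma nonresidue_iff_not_QuadRes:
  assumes p: "Factorial_Ring.prime p"
  shows "nonresidue p g \<longleftrightarrow> \<not> QuadRes (int p) g"
proof
  assume g: "nonresidue p g"
  show "\<not> QuadRes (int p) g"
  proof
    assume "QuadRes (int p) g"
    then obtain y where "int p dvd y\<^sup>2 - g * 1\<^sup>2"
      by (auto simp: QuadRes_def cong_iff_dvd_diff)
    then have "int p dvd 1" using g unfolding nonresidue_def by blast
    then show False using prime_gt_1_nat[OF p] by simp
  qed
next
  assume g: "\<not> QuadRes (int p) g"
  show "nonresidue p g"
    unfolding nonresidue_def
  proof (intro allI impI)
    fix x y assume xy: "int p dvd x\<^sup>2 - g * y\<^sup>2"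
    have "int p dvd y"
    proof (rule ccontr)
      assume "\<not> int p dvd y"
      then have "coprime y (int p)"
        using p prime_imp_coprime[of "int p" y] by (simp add: coprime_commute)
      then obtain e where "[y * e = 1] (mod int p)" using cong_solve_coprime_int by blast
      then obtain k where k: "y * e = 1 + int p * k"
        by (auto simp: cong_iff_dvd_diff dvd_def algebra_simps)
      have "(x * e)\<^sup>2 - g = (x\<^sup>2 - g * y\<^sup>2) * e\<^sup>2 + g * ((y * e)\<^sup>2 - 1)"
        by (simp add: algebra_simps power2_eq_square)
      also have "(y * e)\<^sup>2 - 1 = int p * (2 * k + int p * k\<^sup>2)"
        unfolding k by (simp add: algebra_simps power2_eq_square)
      finally have "int p dvd (x * e)\<^sup>2 - g" using xy by simp
      then show False using g by (auto simp: QuadRes_def cong_iff_dvd_diff)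
    qed
    moreover from this have "int p dvd x\<^sup>2"
      using dvd_add[OF xy, of "g * y\<^sup>2"] by (simp add: power2_eq_square)
    then have "int p dvd x" using p prime_dvd_power[of "int p" x 2] by simp
    ultimately show "int p dvd x \<and> int p dvd y" by simp
  qed
qed

text \<open>If \<open>p\<close> divided \<open>g\<close>, then (0, 1) would be a non-trivial zero of
  the form.\<close>

lemma nonresidue_not_dvd: "Factorial_Ring.prime p \<Longrightarrow> nonresidue p g \<Longrightarrow> \<not> int p dvd g"
  using prime_gt_1_nat[of p] unfolding nonresidue_def
  by (metis dvd_diff_right_iff dvd_0_right int_dvd_int_iff mult.right_neutral nat_dvd_1_iff_1
      less_irrefl of_nat_1 one_power2 power_zero_numeral diff_0 dvd_minus_iff)

text \<open>By Euler's criterion the power (p - 1) / 2 of a non-zero square is 1, which is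
  impossible for an element of order p - 1.\<close>

lemma nonresidue_least_primroot:
  assumes p: "Factorial_Ring.prime p" "odd p"
  shows "nonresidue p (int (least_primroot p))"
proof -
  define g where "g = least_primroot p"
  have p2: "2 < p" using p prime_ge_2_nat[of p] by (cases "p = 2") auto
  obtain x where "residue_primroot p x" using prime_primitive_root_exists[OF _ p(1)] p2 by auto
  then have "0 < x \<and> residue_primroot p x" using p2 by (cases "x = 0") auto
  then have "residue_primroot p g"
    unfolding g_def least_primroot_def by (rule LeastI2) simp
  then have dv: "[g ^ d = 1] (mod p) \<longleftrightarrow> p - 1 dvd d" for d
    using p by (simp add: ord_divides' residue_primroot_def totient_prime)
  have "\<not> QuadRes (int p) (int g)"
  proof
    assume q: "QuadRes (int p) (int g)"
    show False
    \<comment> \<open>\<open>QuadRes\<close> also counts 0 as a square, so the residue 0 is ruled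
      out separately: its positive powers are never 1.\<close>
    proof (cases "[int g = 0] (mod int p)")
      case True
      then have "[g ^ (p - 1) \<noteq> 1] (mod p)"
        using p2 by (auto simp: cong_0_iff cong_def power_0_left)
          (metis One_nat_def Suc_lessD dvd_imp_mod_0 dvd_power less_Suc_eq_0_disj
            mod_less dvd_trans nat_neq_iff not_less0 numeral_2_eq_2 zero_less_diff zero_neq_one)
      then show False using dv by simp
    next
      case False
      then have "[1 = int g ^ ((p - 1) div 2)] (mod int p)"
        using euler_criterion[OF p(1) p2, of "int g"] q by (simp add: Legendre_def)
      then have "[g ^ ((p - 1) div 2) = 1] (mod p)"
        by (metis cong_int_iff cong_sym of_nat_1 of_nat_power)
      then have "p - 1 dvd (p - 1) div 2" using dv by blast
      then have "p - 1 \<le> (p - 1) div 2" using p2 by (intro dvd_imp_le) auto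
      then show False using p2 by linarith
    qed
  qed
  then show ?thesis using nonresidue_iff_not_QuadRes[OF p(1)] g_def by blast
qed

text \<open>By Euler's criterion the product of two non-residues is a square, d g = y^2, and then d
  = g (y / g)^2 modulo \<open>p\<close>.\<close>

lemma nonresidue_ratio_square:
  assumes p: "Factorial_Ring.prime p" "odd p" and d: "nonresidue p d" and g: "nonresidue p g"
  shows "\<exists>s. int p dvd d - g * s\<^sup>2"
proof -
  have p2: "2 < p" using p prime_ge_2_nat[of p] by (cases "p = 2") auto
  let ?h = "(p - 1) div 2"
  have L: "[u ^ ?h = -1] (mod int p)" if "nonresidue p u" for u
    using euler_criterion[OF p(1) p2, of u] nonresidue_not_dvd[OF p(1) that]
      that nonresidue_iff_not_QuadRes[OF p(1)] by (simp add: Legendre_def cong_0_iff cong_sym)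
  have "[(d * g) ^ ?h = 1] (mod int p)"
    using cong_mult[OF L[OF d] L[OF g]] by (simp add: power_mult_distrib)
  then have "[Legendre (d * g) (int p) = 1] (mod int p)"
    using euler_criterion[OF p(1) p2, of "d * g"] cong_trans by blast
  moreover have "\<not> [-1 = 1] (mod int p)" "\<not> [0 = 1] (mod int p)"
    using p2 zdvd_imp_le[of "int p" 2] by (auto simp: cong_iff_dvd_diff)
  ultimately have "QuadRes (int p) (d * g)"
    by (auto simp: Legendre_def split: if_splits)
  then obtain y where y: "int p dvd y\<^sup>2 - d * g"
    by (auto simp: QuadRes_def cong_iff_dvd_diff)
  have "coprime g (int p)"
    using nonresidue_not_dvd[OF p(1) g] p prime_imp_coprime[of "int p" g]
    by (simp add: coprime_commute)
  then obtain e where "[g * e = 1] (mod int p)" using cong_solve_coprime_int by blast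
  then have e: "int p dvd g * e - 1" by (simp add: cong_iff_dvd_diff)
  have "d - g * (y * e)\<^sup>2 = - (g * e\<^sup>2) * (y\<^sup>2 - d * g) - d * (g * e + 1) * (g * e - 1)"
    by (simp add: algebra_simps power2_eq_square)
  then have "int p dvd d - g * (y * e)\<^sup>2" using y e by simp
  then show ?thesis ..
qed

section \<open>Word classes and generators of presented groups\<close>

definition word_class :: "('x word \<times> 'x word) set \<Rightarrow> 'x word \<Rightarrow> 'x word set" where
  "word_class R w = word_rel R `` {w}"

lemma word_class_eqI: "(u, v) \<in> R \<Longrightarrow> word_class R u = word_class R v"
  by (simp add: word_class_def word_class_eq_iff word_cong.relation)

lemma one_presented_group: "\<one>\<^bsub>presented_group R\<^esub> = word_class R []"
  by (simp add: presented_group_def word_class_def)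

lemma carrier_presented_group: "carrier (presented_group R) = range (word_class R)"
  by (auto simp: presented_group_def quotient_def word_class_def)

lemma word_class_mult:
  "word_class R u \<otimes>\<^bsub>presented_group R\<^esub> word_class R v = word_class R (u @ v)"
  by (simp add: word_class_def presented_group_mult)

lemma word_class_closed [simp]: "word_class R w \<in> carrier (presented_group R)"
  by (simp add: carrier_presented_group)

lemma word_class_winv:
  "inv\<^bsub>presented_group R\<^esub> word_class R w = word_class R (winv w)"
proof (rule group.inv_equality[OF group_presented_group])
  show "word_class R (winv w) \<otimes>\<^bsub>presented_group R\<^esub> word_class R w = \<one>\<^bsub>presented_group R\<^esub>"
    unfolding word_class_mult one_presented_group
    by (simp add: word_class_def word_class_eq_iff word_cong_winv)
qed simp_all

lemma commutator_word_class:
  "commutator (presented_group R) (word_class R u) (word_class R v) = word_class R (wcomm u v)"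
  by (simp add: commutator_def word_class_winv word_class_mult wcomm_def)

lemma word_class_pow:
  "word_class R w [^]\<^bsub>presented_group R\<^esub> (n::nat) = word_class R (wpow w n)"
proof (induction n)
  case 0
  then show ?case
    using group.is_monoid[OF group_presented_group, of R]
    by (simp add: wpow_def one_presented_group [symmetric] monoid.nat_pow_0)
next
  case (Suc n)
  have "wpow w (Suc n) = wpow w n @ w"
    by (simp add: wpow_def flip: replicate_append_same)
  then show ?case
    using group.is_monoid[OF group_presented_group, of R] Suc
    by (simp add: monoid.nat_pow_Suc word_class_mult)
qed

lemma carrier_presented_group_generate:
  "carrier (presented_group R) = generate (presented_group R) (range (\<lambda>x. word_class R (wgen x)))"
    (is "_ = generate ?H ?A")
proof
  interpret group ?H by (rule group_presented_group)
  have "word_class R w \<in> generate ?H ?A" for w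
  proof (induction w)
    case Nil
    then show ?case using generate.one[of ?H ?A] by (simp add: one_presented_group)
  next
    case (Cons l w)
    obtain x e where l: "l = (x, e)" by (cases l)
    have "word_class R [(x, e)] \<in> generate ?H ?A"
    proof (cases e)
      case True
      then show ?thesis by (intro generate.incl) (auto simp: wgen_def)
    next
      case False
      then have "word_class R [(x, e)] = inv\<^bsub>?H\<^esub> word_class R (wgen x)"
        by (simp add: word_class_winv winv_def wgen_def)
      moreover have "inv\<^bsub>?H\<^esub> word_class R (wgen x) \<in> generate ?H ?A"
        by (intro generate.inv) auto
      ultimately show ?thesis by simp
    qed
    from generate.eng[OF this Cons] show ?case by (simp add: word_class_mult l)
  qed
  then show "carrier ?H \<subseteq> generate ?H ?A" by (auto simp: carrier_presented_group)
  show "generate ?H ?A \<subseteq> carrier ?H" by (rule generate_incl) auto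
qed

text \<open>The product rule on the right asks for [x, h1] to be central, which holds since it is 1
  by induction; so the lemma is available before class two is known.\<close>

lemma (in group) mem_center_if_generators:
  assumes A: "A \<subseteq> carrier G" and gen: "carrier G = generate G A" and x: "x \<in> carrier G"
    and c: "\<And>y. y \<in> A \<Longrightarrow> commutator G x y = \<one>"
  shows "x \<in> center G"
proof -
  have "commutator G x y = \<one>" if "y \<in> generate G A" for y
    using that
  proof (induction y rule: generate.induct)
    case one
    then show ?case using x by (simp add: commutator_eq_one_iff)
  next
    case (incl h)
    then show ?case by (rule c)
  next
    case (inv h)
    then have "h \<in> carrier G" using A by blast
    then show ?case using c[OF inv] x by (simp add: commutator_inv_right_if)
  next
    case (eng h1 h2)
    then have "h1 \<in> carrier G" "h2 \<in> carrier G" using gen by simp_all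
    then show ?case using eng.IH x by (simp add: commutator_mult_right_if)
  qed
  then show ?thesis using mem_center_iff[OF x] gen by simp
qed

lemma class2_presented_group:
  assumes "\<And>x y. commutator (presented_group R) (word_class R (wgen x)) (word_class R (wgen y))
      \<in> center (presented_group R)"
  shows "class2_group (presented_group R)"
proof -
  interpret group "presented_group R" by (rule group_presented_group)
  show ?thesis
  proof
    fix u v
    assume "u \<in> carrier (presented_group R)" "v \<in> carrier (presented_group R)"
    then show "commutator (presented_group R) u v \<in> center (presented_group R)"
      by (rule commutators_central_if_generators[OF _ carrier_presented_group_generate, rotated 2])
        (use assms in auto)
  qed
qed

text \<open>Evaluating words in an integral model, read modulo \<open>n\<close> through the congruence \<open>Q\<close> below,
  shows that the presented groups do not collapse, without building a finite model group.\<close>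

definition word_eval :: "('m \<Rightarrow> 'm \<Rightarrow> 'm) \<Rightarrow> 'm \<Rightarrow> ('x \<times> bool \<Rightarrow> 'm) \<Rightarrow> 'x word \<Rightarrow> 'm" where
  "word_eval f e l w = foldr (\<lambda>x. f (l x)) w e"

lemma word_eval_append:
  assumes "\<And>x y z. f (f x y) z = f x (f y z)" "\<And>x. f e x = x"
  shows "word_eval f e l (u @ v) = f (word_eval f e l u) (word_eval f e l v)"
  by (induction u) (simp_all add: word_eval_def assms)

text \<open>The model has an associative law with left unit \<open>e\<close>, and letters have
  inverses up to the congruence \<open>Q\<close>. This is what integer tuples with a congruence
  provide.\<close>

lemma word_cong_invariant:
  assumes f: "\<And>x y z. f (f x y) z = f x (f y z)" "\<And>x. f e x = x"
    and Q: "\<And>x. Q x x" "\<And>x y. Q x y \<Longrightarrow> Q y x" "\<And>x y z. Q x y \<Longrightarrow> Q y z \<Longrightarrow> Q x z"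
      "\<And>x y x' y'. Q x x' \<Longrightarrow> Q y y' \<Longrightarrow> Q (f x y) (f x' y')"
    and cancel: "\<And>x b. Q (word_eval f e l [(x, b), (x, \<not> b)]) e"
    and rel: "\<And>u v. (u, v) \<in> R \<Longrightarrow> Q (word_eval f e l u) (word_eval f e l v)"
    and uv: "word_cong R u v"
  shows "Q (word_eval f e l u) (word_eval f e l v)"
  using uv
proof induction
  case (cancel x b)
  then show ?case using assms(7)[of x b] by (simp add: word_eval_def)
next
  case (append u u' v v')
  then show ?case using Q(4) by (simp add: word_eval_append[OF f])
qed (use Q rel in blast)+

text \<open>The last coordinate is arranged so that the commutator of the two generators evaluates to
  \<open>(0, 0, 1)\<close>; similarly for \<open>mul15\<close>.\<close>

definition mul14 :: "int \<times> int \<times> int \<Rightarrow> int \<times> int \<times> int \<Rightarrow> int \<times> int \<times> int" where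
  "mul14 = (\<lambda>(i, j, k) (i', j', k'). (i + i', j + j', k + k' - j * i'))"

fun letter14 :: "gen14 \<times> bool \<Rightarrow> int \<times> int \<times> int" where
  "letter14 (A14_1, e) = ((if e then 1 else -1), 0, 0)"
| "letter14 (A14_2, e) = (0, (if e then 1 else -1), 0)"
| "letter14 (B14, e) = (0, 0, (if e then 1 else -1))"

definition cong3 :: "nat \<Rightarrow> int \<times> int \<times> int \<Rightarrow> int \<times> int \<times> int \<Rightarrow> bool" where
  "cong3 n = (\<lambda>(i, j, k) (i', j', k'). [i = i'] (mod int n) \<and> [j = j'] (mod int n) \<and> [k = k'] (mod int n))"

abbreviation "eval14 \<equiv> word_eval mul14 (0, 0, 0) letter14"

lemma word_eval_simps [simp]:
  "word_eval f e l [] = e" "word_eval f e l (x # w) = f (l x) (word_eval f e l w)"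
  by (simp_all add: word_eval_def)

lemma wpow_wgen_simps [simp]:
  "wpow (wgen x) 0 = []" "wpow (wgen x) (Suc n) = (x, True) # wpow (wgen x) n"
  by (simp_all add: wpow_def wgen_def)

lemma eval14_wpow:
  "eval14 (wpow (wgen x) n) =
    (case x of A14_1 \<Rightarrow> (int n, 0, 0) | A14_2 \<Rightarrow> (0, int n, 0) | B14 \<Rightarrow> (0, 0, int n))"
  by (induction n; cases x) (simp_all add: mul14_def)

text \<open>The defining relations hold in the model modulo p^2. The purpose is to bound the order
  of beta in the presented group from below.\<close>

lemma word_cong14:
  assumes "word_cong (rels14 p) u v"
  shows "cong3 (p\<^sup>2) (eval14 u) (eval14 v)"
proof (rule word_cong_invariant[where R = "rels14 p", OF _ _ _ _ _ _ _ _ assms])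
  fix x :: gen14 and b
  show "cong3 (p\<^sup>2) (eval14 [(x, b), (x, \<not> b)]) (0, 0, 0)"
    by (cases x) (simp_all add: mul14_def cong3_def)
next
  fix u v :: "gen14 word" assume "(u, v) \<in> rels14 p"
  moreover have "cong3 (p\<^sup>2) (eval14 (wcomm (wgen x) (wgen y))) (eval14 [])"
    if "(x, y) \<notin> {(A14_1, A14_2)}" "(y, x) \<notin> {(A14_1, A14_2)}" for x y
    using that by (cases x; cases y)
      (simp_all add: mul14_def cong3_def wcomm_def winv_def wgen_def)
  moreover have "cong3 (p\<^sup>2) (eval14 (wcomm (wgen A14_1) (wgen A14_2))) (eval14 (wgen B14))"
    by (simp_all add: mul14_def cong3_def wcomm_def winv_def wgen_def)
  moreover have "cong3 (p\<^sup>2) (eval14 (wpow (wgen x) (p\<^sup>2))) (eval14 [])" for x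
    by (cases x; simp add: eval14_wpow) (simp_all add: cong3_def cong_def)
  ultimately show "cong3 (p\<^sup>2) (eval14 u) (eval14 v)"
    unfolding rels14_def unlisted_comms_def by blast
qed (auto simp: mul14_def cong3_def algebra_simps intro: cong_sym cong_trans cong_add cong_diff cong_mult)

text \<open>The relations make beta central, the group of class two and generated modulo its center
  by the two alphas. They also bound the order of beta by p^2; equality is taken from the integral
  model.\<close>

lemma coordinates_presented14:
  assumes p: "0 < p"
  shows "\<exists>a b. coordinates (presented_group (rels14 p)) a b comm14 (eq14 (p\<^sup>2))"
proof -
  let ?R = "rels14 p"
  let ?H = "presented_group ?R"
  define cl where "cl x = word_class ?R (wgen x)" for x
  interpret group ?H by (rule group_presented_group)
  have clc [simp]: "cl x \<in> carrier ?H" for x by (simp add: cl_def)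
  have gen: "carrier ?H = generate ?H (range cl)"
    using carrier_presented_group_generate[of ?R] by (simp add: cl_def [abs_def])
  have triv: "commutator ?H (cl x) (cl y) = \<one>\<^bsub>?H\<^esub>"
    if "(x, y) \<noteq> (A14_1, A14_2)" "(y, x) \<noteq> (A14_1, A14_2)" for x y
    unfolding cl_def commutator_word_class one_presented_group
    by (rule word_class_eqI) (use that in \<open>auto simp: rels14_def unlisted_comms_def\<close>)
  have ab: "commutator ?H (cl A14_1) (cl A14_2) = cl B14"
    unfolding cl_def commutator_word_class
    by (rule word_class_eqI) (auto simp: rels14_def)
  \<comment> \<open>The generator beta occurs in no listed pair, so it commutes with every
    generator.\<close>
  have central: "cl B14 \<in> center ?H"
    by (rule mem_center_if_generators[OF _ gen]) (auto simp: triv)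
  interpret class2_group ?H
  proof (rule class2_presented_group, fold cl_def)
    fix x y
    show "commutator ?H (cl x) (cl y) \<in> center ?H"
    proof (cases "(x, y) = (A14_1, A14_2) \<or> (y, x) = (A14_1, A14_2)")
      case True
      then show ?thesis
        using ab central inv_commutator[of "cl A14_1" "cl A14_2"] center_inv_closed by force
    qed (auto simp: triv)
  qed
  let ?K = "adjoin ?H (adjoin ?H (center ?H) (cl A14_1)) (cl A14_2)"
  note K1 = adjoin_chain[OF subgroup_center subset_refl clc, of A14_1]
  note K2 = adjoin_chain[OF K1(1,2) clc, of A14_2]
  have "cl x \<in> ?K" for x
    using K1(4) K2(2,3,4) central by (cases x) blast+
  then have "generate ?H (range cl) \<subseteq> ?K"
    by (intro generate_subgroup_incl K2(1)) auto
  then have cover: "carrier ?H = ?K"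
    using gen subgroup.subset[OF K2(1)] by blast
  have n: "cl B14 [^]\<^bsub>?H\<^esub> (k::nat) = \<one>\<^bsub>?H\<^esub> \<longleftrightarrow> p\<^sup>2 dvd k" for k
  proof
    assume "cl B14 [^]\<^bsub>?H\<^esub> k = \<one>\<^bsub>?H\<^esub>"
    then have "word_cong ?R (wpow (wgen B14) k) []"
      unfolding cl_def word_class_pow one_presented_group
      by (simp add: word_class_def word_class_eq_iff)
    from word_cong14[OF this] have "int (p\<^sup>2) dvd int k"
      by (simp add: eval14_wpow) (simp add: cong3_def cong_0_iff)
    then show "p\<^sup>2 dvd k" by (simp only: int_dvd_int_iff)
  next
    have "cl B14 [^]\<^bsub>?H\<^esub> (p\<^sup>2) = \<one>\<^bsub>?H\<^esub>"
      unfolding cl_def word_class_pow one_presented_group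
      by (rule word_class_eqI) (simp add: rels14_def)
    moreover assume "p\<^sup>2 dvd k"
    ultimately show "cl B14 [^]\<^bsub>?H\<^esub> k = \<one>\<^bsub>?H\<^esub>"
      by (metis clc dvdE nat_pow_one nat_pow_pow)
  qed
  have "cl B14 [^]\<^bsub>?H\<^esub> (k::int) = \<one>\<^bsub>?H\<^esub> \<longleftrightarrow> int (p\<^sup>2) dvd k" for k
  proof (cases k rule: int_cases2)
    case (nonneg m)
    then show ?thesis using n[of m] by (simp add: int_pow_int flip: int_dvd_int_iff)
  next
    case (nonpos m)
    then show ?thesis using n[of m]
      by (simp add: int_pow_neg int_pow_int inv_eq_1_iff flip: int_dvd_int_iff)
  qed
  then show ?thesis
    using coordinates14[OF clc clc cover, of "p\<^sup>2"] ab by auto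
qed

definition mul15 :: "int \<Rightarrow> int \<times> int \<times> int \<times> int \<times> int \<times> int \<Rightarrow>
    int \<times> int \<times> int \<times> int \<times> int \<times> int \<Rightarrow> int \<times> int \<times> int \<times> int \<times> int \<times> int" where
  "mul15 g = (\<lambda>(i1, i2, i3, i4, m, n) (j1, j2, j3, j4, m', n').
     (i1 + j1, i2 + j2, i3 + j3, i4 + j4,
      m + m' - i2 * j1 - i4 * j3, n + n' - i3 * j1 - g * (i4 * j2)))"

fun letter15 :: "gen15 \<times> bool \<Rightarrow> int \<times> int \<times> int \<times> int \<times> int \<times> int" where
  "letter15 (A15_1, e) = ((if e then 1 else -1), 0, 0, 0, 0, 0)"
| "letter15 (A15_2, e) = (0, (if e then 1 else -1), 0, 0, 0, 0)"
| "letter15 (A15_3, e) = (0, 0, (if e then 1 else -1), 0, 0, 0)"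
| "letter15 (A15_4, e) = (0, 0, 0, (if e then 1 else -1), 0, 0)"
| "letter15 (B15_1, e) = (0, 0, 0, 0, (if e then 1 else -1), 0)"
| "letter15 (B15_2, e) = (0, 0, 0, 0, 0, (if e then 1 else -1))"

definition cong6 :: "nat \<Rightarrow> int \<times> int \<times> int \<times> int \<times> int \<times> int \<Rightarrow>
    int \<times> int \<times> int \<times> int \<times> int \<times> int \<Rightarrow> bool" where
  "cong6 p = (\<lambda>(i1, i2, i3, i4, m, n) (j1, j2, j3, j4, m', n').
     [i1 = j1] (mod int p) \<and> [i2 = j2] (mod int p) \<and> [i3 = j3] (mod int p) \<and>
     [i4 = j4] (mod int p) \<and> [m = m'] (mod int p) \<and> [n = n'] (mod int p))"

abbreviation "eval15 g \<equiv> word_eval (mul15 g) (0, 0, 0, 0, 0, 0) letter15"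

lemma eval15_wpow:
  "eval15 g (wpow (wgen x) n) =
    (case x of A15_1 \<Rightarrow> (int n, 0, 0, 0, 0, 0) | A15_2 \<Rightarrow> (0, int n, 0, 0, 0, 0)
     | A15_3 \<Rightarrow> (0, 0, int n, 0, 0, 0) | A15_4 \<Rightarrow> (0, 0, 0, int n, 0, 0)
     | B15_1 \<Rightarrow> (0, 0, 0, 0, int n, 0) | B15_2 \<Rightarrow> (0, 0, 0, 0, 0, int n))"
  by (induction n; cases x) (simp_all add: mul15_def)

lemma mul15_assoc: "mul15 g (mul15 g x y) z = mul15 g x (mul15 g y z)"
  by (simp add: mul15_def algebra_simps split: prod.split)

lemma eval15_append: "eval15 g (u @ v) = mul15 g (eval15 g u) (eval15 g v)"
  by (rule word_eval_append) (simp_all add: mul15_assoc, simp add: mul15_def split: prod.split)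

abbreviation listed15 :: "(gen15 \<times> gen15) set" where
  "listed15 \<equiv> {(A15_1, A15_2), (A15_3, A15_4), (A15_1, A15_3), (A15_2, A15_4)}"

lemma word_cong15:
  assumes "word_cong (rels15 p) u v"
  shows "cong6 p (eval15 (int (least_primroot p)) u) (eval15 (int (least_primroot p)) v)"
proof -
  define g where "g = least_primroot p"
  have "cong6 p (eval15 (int g) u) (eval15 (int g) v)"
  proof (rule word_cong_invariant[where R = "rels15 p", OF _ _ _ _ _ _ _ _ assms])
    fix x :: gen15 and b
    show "cong6 p (eval15 (int g) [(x, b), (x, \<not> b)]) (0, 0, 0, 0, 0, 0)"
      by (cases x) (simp_all add: mul15_def cong6_def)
  next
    fix u v :: "gen15 word" assume uv: "(u, v) \<in> rels15 p"
    have unl: "cong6 p (eval15 (int g) (wcomm (wgen x) (wgen y))) (eval15 (int g) [])"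
      if "(x, y) \<notin> listed15" "(y, x) \<notin> listed15" for x y
      using that by (cases x; cases y)
        (simp_all add: mul15_def cong6_def wcomm_def winv_def wgen_def)
    have lis: "cong6 p (eval15 (int g) (wcomm (wgen A15_1) (wgen A15_2))) (eval15 (int g) (wgen B15_1))"
      "cong6 p (eval15 (int g) (wcomm (wgen A15_3) (wgen A15_4))) (eval15 (int g) (wgen B15_1))"
      "cong6 p (eval15 (int g) (wcomm (wgen A15_1) (wgen A15_3))) (eval15 (int g) (wgen B15_2))"
      by (simp_all add: mul15_def cong6_def wcomm_def winv_def wgen_def)
    have lis': "cong6 p (eval15 (int g) (wcomm (wgen A15_2) (wgen A15_4)))
        (eval15 (int g) (wpow (wgen B15_2) g))"
      unfolding eval15_wpow
      by (simp add: mul15_def cong6_def wcomm_def winv_def wgen_def)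
    have pw: "cong6 p (eval15 (int g) (wpow (wgen x) p)) (eval15 (int g) [])" for x
      by (cases x; simp add: eval15_wpow) (simp_all add: cong6_def cong_def)
    show "cong6 p (eval15 (int g) u) (eval15 (int g) v)"
      using uv unfolding rels15_def unlisted_comms_def g_def [symmetric]
      by (elim UnE insertE emptyE CollectE exE conjE Pair_inject)
        (hypsubst | (rule lis | rule lis' | rule pw | (rule unl; assumption)))+
  next
    fix x y x' y' assume "cong6 p x x'" "cong6 p y y'"
    then show "cong6 p (mul15 (int g) x y) (mul15 (int g) x' y')"
      by (auto simp: mul15_def cong6_def intro!: cong_add cong_diff cong_mult)
  qed (auto simp: mul15_assoc, auto simp: mul15_def cong6_def intro: cong_sym cong_trans)
  then show ?thesis by (simp add: g_def)
qed

text \<open>The relations give class two, the commutators and the exponent of the betas. That beta_1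
  and beta_2 are independent modulo \<open>p\<close> is seen in the model, where they occupy
  separate coordinates.\<close>

lemma coordinates_presented15:
  assumes p: "0 < p"
  shows "\<exists>a b. coordinates (presented_group (rels15 p)) a b
    (comm15 (int (least_primroot p))) (eq15 p)"
proof -
  let ?R = "rels15 p"
  let ?H = "presented_group ?R"
  define g where "g = least_primroot p"
  define cl where "cl x = word_class ?R (wgen x)" for x
  interpret group ?H by (rule group_presented_group)
  have clc [simp]: "cl x \<in> carrier ?H" for x by (simp add: cl_def)
  have gen: "carrier ?H = generate ?H (range cl)"
    using carrier_presented_group_generate[of ?R] by (simp add: cl_def [abs_def])
  have triv: "commutator ?H (cl x) (cl y) = \<one>\<^bsub>?H\<^esub>"
    if "(x, y) \<notin> listed15" "(y, x) \<notin> listed15" for x y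
  proof -
    have "(wcomm (wgen x) (wgen y), []) \<in> unlisted_comms listed15"
      unfolding unlisted_comms_def using that by blast
    then have "(wcomm (wgen x) (wgen y), []) \<in> ?R" unfolding rels15_def by blast
    then show ?thesis
      unfolding cl_def commutator_word_class one_presented_group by (rule word_class_eqI)
  qed
  have ab: "commutator ?H (cl A15_1) (cl A15_2) = cl B15_1"
    "commutator ?H (cl A15_3) (cl A15_4) = cl B15_1"
    "commutator ?H (cl A15_1) (cl A15_3) = cl B15_2"
    "commutator ?H (cl A15_2) (cl A15_4) = cl B15_2 [^]\<^bsub>?H\<^esub> int g"
    unfolding cl_def commutator_word_class int_pow_int word_class_pow
    by (rule word_class_eqI, simp add: rels15_def g_def)+
  have central: "cl B15_1 \<in> center ?H" "cl B15_2 \<in> center ?H"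
    by (rule mem_center_if_generators[OF _ gen]; auto simp: triv)+
  have listed: "commutator ?H (cl x) (cl y) \<in> center ?H" if "(x, y) \<in> listed15" for x y
    using that ab central center_int_pow_closed by auto
  interpret class2_group ?H
  proof (rule class2_presented_group, fold cl_def)
    fix x y
    consider "(x, y) \<in> listed15" | "(y, x) \<in> listed15"
      | "(x, y) \<notin> listed15" "(y, x) \<notin> listed15" by blast
    then show "commutator ?H (cl x) (cl y) \<in> center ?H"
    proof cases
      case 2
      then show ?thesis using listed center_inv_closed inv_commutator clc by metis
    qed (simp_all add: listed triv)
  qed
  let ?K1 = "adjoin ?H (center ?H) (cl A15_1)"
  let ?K2 = "adjoin ?H ?K1 (cl A15_2)"
  let ?K3 = "adjoin ?H ?K2 (cl A15_3)"
  let ?K4 = "adjoin ?H ?K3 (cl A15_4)"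
  note K1 = adjoin_chain[OF subgroup_center subset_refl clc, of A15_1]
  note K2 = adjoin_chain[OF K1(1,2) clc, of A15_2]
  note K3 = adjoin_chain[OF K2(1,2) clc, of A15_3]
  note K4 = adjoin_chain[OF K3(1,2) clc, of A15_4]
  have "cl x \<in> ?K4" for x
    using K1(4) K2(3,4) K3(3,4) K4(2,3,4) central by (cases x) blast+
  then have "generate ?H (range cl) \<subseteq> ?K4"
    by (intro generate_subgroup_incl K4(1)) auto
  then have cover: "carrier ?H = ?K4"
    using gen subgroup.subset[OF K4(1)] by blast
  have p1: "cl x [^]\<^bsub>?H\<^esub> p = \<one>\<^bsub>?H\<^esub>" for x
    unfolding cl_def word_class_pow one_presented_group
    by (rule word_class_eqI) (auto simp: rels15_def)
  \<comment> \<open>\<open>word_cong15\<close> speaks of words, that is of natural powers, so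
    integer exponents are first reduced to residues.\<close>
  have red: "cl x [^]\<^bsub>?H\<^esub> (k::int) = cl x [^]\<^bsub>?H\<^esub> nat (k mod int p)" for x k
  proof -
    have "cl x [^]\<^bsub>?H\<^esub> (int p * (k div int p)) = \<one>\<^bsub>?H\<^esub>"
      by (simp add: int_pow_pow [symmetric] int_pow_int p1)
    then have "cl x [^]\<^bsub>?H\<^esub> (int p * (k div int p) + k mod int p) = cl x [^]\<^bsub>?H\<^esub> (k mod int p)"
      unfolding int_pow_mult[OF clc] by simp
    moreover have "k mod int p = int (nat (k mod int p))" using p by simp
    ultimately show ?thesis by (metis mult_div_mod_eq int_pow_int)
  qed
  have ord: "cl B15_1 [^]\<^bsub>?H\<^esub> (m::int) \<otimes>\<^bsub>?H\<^esub> cl B15_2 [^]\<^bsub>?H\<^esub> (n::int) = \<one>\<^bsub>?H\<^esub> \<longleftrightarrow>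
    int p dvd m \<and> int p dvd n" for m n
  proof
    assume "cl B15_1 [^]\<^bsub>?H\<^esub> m \<otimes>\<^bsub>?H\<^esub> cl B15_2 [^]\<^bsub>?H\<^esub> n = \<one>\<^bsub>?H\<^esub>"
    then have "word_cong ?R (wpow (wgen B15_1) (nat (m mod int p)) @
        wpow (wgen B15_2) (nat (n mod int p))) []"
      unfolding red unfolding cl_def word_class_pow word_class_mult one_presented_group
      by (simp add: word_class_def word_class_eq_iff)
    from word_cong15[OF this] have "int p dvd m mod int p" "int p dvd n mod int p"
      using p by (simp_all add: eval15_append eval15_wpow)
        (simp_all add: mul15_def cong6_def cong_0_iff)
    then show "int p dvd m \<and> int p dvd n" by (simp add: dvd_mod_iff)
  next
    assume "int p dvd m \<and> int p dvd n"
    then show "cl B15_1 [^]\<^bsub>?H\<^esub> m \<otimes>\<^bsub>?H\<^esub> cl B15_2 [^]\<^bsub>?H\<^esub> n = \<one>\<^bsub>?H\<^esub>"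
      unfolding red by (simp add: dvd_imp_mod_0)
  qed
  show ?thesis
    unfolding g_def [symmetric]
    using coordinates15[OF clc clc clc clc central ab _ _ cover ord] triv by auto
qed

section \<open>Characters and central automorphisms\<close>

context group
begin

text \<open>A homomorphism from \<open>H\<close> to the integers modulo \<open>n\<close>, kept as an
  integer-valued function so that its values can serve as exponents of group elements.\<close>

definition additive_mod :: "nat \<Rightarrow> 'a set \<Rightarrow> ('a \<Rightarrow> int) \<Rightarrow> bool" where
  "additive_mod n H \<chi> \<longleftrightarrow> (\<forall>x\<in>H. \<forall>y\<in>H. int n dvd \<chi> (x \<otimes> y) - (\<chi> x + \<chi> y))"

lemma additive_modE:
  assumes "additive_mod n H \<chi>" "x \<in> H" "y \<in> H"
  obtains k where "\<chi> (x \<otimes> y) = \<chi> x + \<chi> y + int n * k"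
proof -
  have "int n dvd \<chi> (x \<otimes> y) - (\<chi> x + \<chi> y)"
    using assms by (simp add: additive_mod_def)
  then obtain k where "\<chi> (x \<otimes> y) - (\<chi> x + \<chi> y) = int n * k" ..
  then have "\<chi> (x \<otimes> y) = \<chi> x + \<chi> y + int n * k" by simp
  then show ?thesis by (rule that)
qed

lemma additive_mod_one:
  assumes "additive_mod n H \<chi>" "subgroup H G"
  shows "int n dvd \<chi> \<one>"
proof -
  have "\<one> \<in> H" using subgroup.one_closed[OF assms(2)] .
  then obtain k where "\<chi> (\<one> \<otimes> \<one>) = \<chi> \<one> + \<chi> \<one> + int n * k"
    using additive_modE[OF assms(1)] by metis
  then have "\<chi> \<one> = int n * (- k)" by simp
  then show ?thesis by (rule dvdI)
qed

lemma additive_mod_nat_pow: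
  assumes add: "additive_mod n H \<chi>" and H: "subgroup H G" and x: "x \<in> H"
  shows "int n dvd \<chi> (x [^] (m::nat)) - int m * \<chi> x"
proof (induction m)
  case 0
  then show ?case using additive_mod_one[OF add H] by simp
next
  case (Suc m)
  have "x [^] int m \<in> H" using subgroup_int_pow_closed[OF H x] .
  then have xm: "x [^] m \<in> H" by (simp add: int_pow_int)
  obtain k where k: "\<chi> (x [^] m \<otimes> x) = \<chi> (x [^] m) + \<chi> x + int n * k"
    using additive_modE[OF add xm x] .
  obtain l where "\<chi> (x [^] m) - int m * \<chi> x = int n * l" using Suc ..
  then have "\<chi> (x [^] Suc m) - int (Suc m) * \<chi> x = int n * (k + l)"
    by (simp add: k algebra_simps)
  then show ?case by (rule dvdI)
qed

lemma additive_mod_inv: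
  assumes add: "additive_mod n H \<chi>" and H: "subgroup H G" and x: "x \<in> H"
  shows "int n dvd \<chi> (inv x) + \<chi> x"
proof -
  obtain k where "\<chi> (inv x \<otimes> x) = \<chi> (inv x) + \<chi> x + int n * k"
    using additive_modE[OF add subgroup.m_inv_closed[OF H x] x] .
  moreover obtain l where "\<chi> \<one> = int n * l" using additive_mod_one[OF add H] ..
  ultimately have "\<chi> (inv x) + \<chi> x = int n * (l - k)"
    using subgroup.mem_carrier[OF H x] by (simp add: algebra_simps)
  then show ?thesis by (rule dvdI)
qed

lemma additive_mod_int_pow:
  assumes add: "additive_mod n H \<chi>" and H: "subgroup H G" and x: "x \<in> H"
  shows "int n dvd \<chi> (x [^] (i::int)) - i * \<chi> x"
proof (cases i rule: int_cases2)
  case (nonneg m)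
  then show ?thesis using additive_mod_nat_pow[OF add H x, of m] by (simp add: int_pow_int)
next
  case (nonpos m)
  note xi = subgroup.m_inv_closed[OF H x]
  obtain k where k: "\<chi> (inv x [^] m) - int m * \<chi> (inv x) = int n * k"
    using additive_mod_nat_pow[OF add H xi, of m] ..
  obtain l where l: "\<chi> (inv x) + \<chi> x = int n * l" using additive_mod_inv[OF add H x] ..
  have "x [^] i = inv x [^] m"
    using subgroup.mem_carrier[OF H x] by (simp add: nonpos int_pow_neg int_pow_int nat_pow_inv)
  then have "\<chi> (x [^] i) - i * \<chi> x = int n * k + int m * (\<chi> (inv x) + \<chi> x)"
    using k by (simp add: nonpos algebra_simps)
  also have "\<dots> = int n * (k + int m * l)" unfolding l by (simp add: algebra_simps)
  finally show ?thesis by (rule dvdI)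
qed

text \<open>A character of \<open>H\<close> extends to \<open>a\<close> with any value
  \<open>w\<close> such that d w = \<chi>(a^d) modulo \<open>n\<close>, where d is the order of
  \<open>a\<close> modulo \<open>H\<close>. The extension is multiplicative because rearranging a
  product produces a commutator, which lies in \<open>K\<close> and is killed.\<close>

lemma additive_mod_adjoin:
  assumes fin: "finite (carrier G)" and H: "subgroup H G" and K: "gamma2 G \<subseteq> K" "K \<subseteq> H"
    and add: "additive_mod n H \<chi>" and \<chi>K: "\<And>k. k \<in> K \<Longrightarrow> int n dvd \<chi> k"
    and a: "a \<in> carrier G"
    and w: "int n dvd \<chi> (a [^] ord_mod G H a) - int (ord_mod G H a) * w"
  shows "\<exists>\<psi>. additive_mod n (adjoin G H a) \<psi> \<and> (\<forall>h\<in>H. int n dvd \<psi> h - \<chi> h) \<and> int n dvd \<psi> a - w"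
proof -
  let ?d = "ord_mod G H a"
  note Hc = subgroup.mem_carrier[OF H]
  have dH: "a [^] ?d \<in> H" using nat_pow_mem_iff[OF fin H a, of ?d] by simp
  \<comment> \<open>Well-definedness: if h a^i = h' a^j, then i - j is a multiple of d, and the
    condition on \<open>w\<close> balances this against h and h'.\<close>
  have key: "int n dvd (\<chi> h + i * w) - (\<chi> h' + j * w)"
    if h: "h \<in> H" "h' \<in> H" and eq: "h \<otimes> a [^] i = h' \<otimes> a [^] j" for h h' and i j :: int
  proof -
    have "a [^] (i - j) = inv h \<otimes> (h \<otimes> a [^] i) \<otimes> inv (a [^] j)"
      using h Hc a by (simp add: int_pow_diff)
    also have "\<dots> = inv h \<otimes> h'"
      unfolding eq using h Hc a by (simp add: m_assoc)
    finally have aij: "a [^] (i - j) = inv h \<otimes> h'" .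
    then have "a [^] (i - j) \<in> H"
      using subgroup.m_closed[OF H subgroup.m_inv_closed[OF H h(1)] h(2)] by simp
    then obtain q where q: "i - j = int ?d * q" using int_pow_mem_iff[OF fin H a] by blast
    have "a [^] (i - j) = (a [^] ?d) [^] q"
      using a by (simp add: q int_pow_pow flip: int_pow_int)
    then obtain k1 where k1: "\<chi> (inv h \<otimes> h') - q * \<chi> (a [^] ?d) = int n * k1"
      using additive_mod_int_pow[OF add H dH, of q] aij by (metis dvdE)
    obtain k2 where k2: "\<chi> (inv h \<otimes> h') = \<chi> (inv h) + \<chi> h' + int n * k2"
      using additive_modE[OF add subgroup.m_inv_closed[OF H h(1)] h(2)] .
    obtain k3 where k3: "\<chi> (inv h) + \<chi> h = int n * k3" using additive_mod_inv[OF add H h(1)] ..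
    obtain k4 where k4: "\<chi> (a [^] ?d) - int ?d * w = int n * k4" using w ..
    have "(\<chi> h + i * w) - (\<chi> h' + j * w) = (i - j) * w + (\<chi> h - \<chi> h')"
      by (simp add: algebra_simps)
    also have "(i - j) * w = q * (\<chi> (a [^] ?d) - int n * k4)"
      unfolding q using k4 by (simp add: algebra_simps)
    also have "\<dots> = \<chi> (inv h \<otimes> h') - int n * k1 - int n * (q * k4)"
      using k1 by (simp add: algebra_simps)
    also have "\<dots> + (\<chi> h - \<chi> h') = int n * (k3 + k2 - k1 - q * k4)"
      using k2 k3 by (simp add: algebra_simps)
    finally show ?thesis by (rule dvdI)
  qed
  \<comment> \<open>Some representation is chosen for each element; by \<open>key\<close> the value
    modulo \<open>n\<close> does not depend on it.\<close>
  define \<psi> where "\<psi> u = (let (h, i) = (SOME (h, i). h \<in> H \<and> u = h \<otimes> a [^] (i::int)) in \<chi> h + i * w)"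
    for u
  have \<psi>: "\<exists>k. \<psi> (h \<otimes> a [^] i) = \<chi> h + i * w + int n * k" if h: "h \<in> H" for h and i :: int
  proof -
    let ?P = "\<lambda>(h', j). h' \<in> H \<and> h \<otimes> a [^] i = h' \<otimes> a [^] (j::int)"
    obtain h' j where s: "(SOME x. ?P x) = (h', j)" by fastforce
    have "?P (h, i)" using h by simp
    then have "?P (SOME x. ?P x)" by (rule someI)
    then have "h' \<in> H" "h' \<otimes> a [^] j = h \<otimes> a [^] i" by (simp_all add: s)
    then have "int n dvd (\<chi> h' + j * w) - (\<chi> h + i * w)" using key h by blast
    then obtain k where "(\<chi> h' + j * w) - (\<chi> h + i * w) = int n * k" ..
    then have "\<psi> (h \<otimes> a [^] i) = \<chi> h + i * w + int n * k"
      by (simp add: \<psi>_def s)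
    then show ?thesis ..
  qed
  have "additive_mod n (adjoin G H a) \<psi>"
    unfolding additive_mod_def
  proof (intro ballI)
    fix u v assume "u \<in> adjoin G H a" "v \<in> adjoin G H a"
    then obtain h h' and i j :: int where u: "u = h \<otimes> a [^] i" "h \<in> H"
      and v: "v = h' \<otimes> a [^] j" "h' \<in> H" by (auto simp: adjoin_def)
    let ?x = "a [^] i"
    \<comment> \<open>\<open>c\<close> is the price of moving a^i past h'; being a commutator, it
      lies in \<open>K\<close>.\<close>
    define c where "c = ?x \<otimes> h' \<otimes> inv ?x \<otimes> inv h'"
    have xc: "?x \<in> carrier G" using a by simp
    have "c = commutator G (inv ?x) (inv h')"
      using xc v Hc by (simp add: c_def commutator_def)
    then have c: "c \<in> K" using commutator_in_gamma2 xc v Hc K by auto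
    have cH: "c \<in> H" using c K by blast
    have conj: "?x \<otimes> h' \<otimes> inv ?x = c \<otimes> h'"
      using xc v Hc by (simp add: c_def m_assoc)
    have uv: "u \<otimes> v = (h \<otimes> (c \<otimes> h')) \<otimes> a [^] (i + j)"
      unfolding u v conj [symmetric] using mult_adjoin_form Hc u v a by blast
    have chH: "c \<otimes> h' \<in> H" using subgroup.m_closed[OF H cH v(2)] .
    obtain k1 where k1: "\<psi> (u \<otimes> v) = \<chi> (h \<otimes> (c \<otimes> h')) + (i + j) * w + int n * k1"
      using \<psi>[OF subgroup.m_closed[OF H u(2) chH], of "i + j"] uv by auto
    obtain k2 where k2: "\<chi> (h \<otimes> (c \<otimes> h')) = \<chi> h + \<chi> (c \<otimes> h') + int n * k2"
      using additive_modE[OF add u(2) chH] .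
    obtain k3 where k3: "\<chi> (c \<otimes> h') = \<chi> c + \<chi> h' + int n * k3"
      using additive_modE[OF add cH v(2)] .
    obtain k4 where k4: "\<chi> c = int n * k4" using \<chi>K[OF c] ..
    obtain k5 where k5: "\<psi> u = \<chi> h + i * w + int n * k5" using \<psi>[OF u(2)] u(1) by blast
    obtain k6 where k6: "\<psi> v = \<chi> h' + j * w + int n * k6" using \<psi>[OF v(2)] v(1) by blast
    have "\<psi> (u \<otimes> v) - (\<psi> u + \<psi> v) = int n * (k1 + k2 + k3 + k4 - k5 - k6)"
      unfolding k1 k2 k3 k4 k5 k6 by (simp add: algebra_simps)
    then show "int n dvd \<psi> (u \<otimes> v) - (\<psi> u + \<psi> v)" by (rule dvdI)
  qed
  moreover have "int n dvd \<psi> h - \<chi> h" if "h \<in> H" for h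
    using \<psi>[OF that, of 0] Hc[OF that] by auto
  moreover have "int n dvd \<psi> a - w"
  proof -
    obtain k where "\<psi> a = \<chi> \<one> + w + int n * k"
      using \<psi>[OF subgroup.one_closed[OF H], of 1] a by auto
    moreover obtain l where "\<chi> \<one> = int n * l" using additive_mod_one[OF add H] ..
    ultimately have "\<psi> a - w = int n * (l + k)" by (simp add: algebra_simps)
    then show ?thesis by (rule dvdI)
  qed
  ultimately show ?thesis by blast
qed

text \<open>Z/n is injective for abelian groups of exponent dividing \<open>n\<close>, here G / K:
  with n = d e, the congruence e \<chi>(a^d) = \<chi>(a^n) = 0 modulo \<open>n\<close> forces d to
  divide \<chi>(a^d), so an admissible value at \<open>a\<close> exists. Elements are adjoined until
  \<open>H\<close> is the whole group.\<close>

lemma additive_mod_extension: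
  assumes fin: "finite (carrier G)" and K: "gamma2 G \<subseteq> K" "subgroup K G"
    and n: "0 < n" "\<And>x. x \<in> carrier G \<Longrightarrow> x [^] n \<in> K"
  shows "subgroup H G \<Longrightarrow> K \<subseteq> H \<Longrightarrow> additive_mod n H \<chi> \<Longrightarrow> (\<And>k. k \<in> K \<Longrightarrow> int n dvd \<chi> k) \<Longrightarrow>
    \<exists>\<psi>. additive_mod n (carrier G) \<psi> \<and> (\<forall>h\<in>H. int n dvd \<psi> h - \<chi> h)"
proof (induction "card (carrier G - H)" arbitrary: H \<chi> rule: less_induct)
  case less
  note H = less.prems(1) and KH = less.prems(2) and add = less.prems(3) and \<chi>K = less.prems(4)
  show ?case
  proof (cases "H = carrier G")
    case True
    then show ?thesis using add by (intro exI[of _ \<chi>]) simp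
  next
    case False
    then obtain a where a: "a \<in> carrier G" "a \<notin> H" using subgroup.subset[OF H] by blast
    let ?d = "ord_mod G H a"
    have "a [^] n \<in> H" using n(2) a KH by blast
    then have "?d dvd n" using nat_pow_mem_iff[OF fin H a(1)] by simp
    then obtain e where e: "n = ?d * e" ..
    have e0: "0 < e" using n(1) e by (cases e) auto
    have dH: "a [^] ?d \<in> H" using nat_pow_mem_iff[OF fin H a(1), of ?d] by simp
    have "a [^] n = (a [^] ?d) [^] e" using a by (subst e) (simp add: nat_pow_pow)
    then have "int n dvd \<chi> (a [^] n) - int e * \<chi> (a [^] ?d)"
      using additive_mod_nat_pow[OF add H dH, of e] by simp
    moreover have "int n dvd \<chi> (a [^] n)" using \<chi>K n(2) a by blast
    ultimately have "int n dvd int e * \<chi> (a [^] ?d)" by (simp add: dvd_diff_right_iff)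
    then have "int e * int ?d dvd int e * \<chi> (a [^] ?d)" by (subst (asm) e) (simp add: mult.commute)
    then have "int ?d dvd \<chi> (a [^] ?d)" using e0 by simp
    then obtain w where "\<chi> (a [^] ?d) = int ?d * w" ..
    then have w: "int n dvd \<chi> (a [^] ?d) - int ?d * w" by simp
    obtain \<psi> where \<psi>: "additive_mod n (adjoin G H a) \<psi>" "\<forall>h\<in>H. int n dvd \<psi> h - \<chi> h"
      using additive_mod_adjoin[OF fin H K(1) KH add \<chi>K a(1) w] by blast
    have sub: "subgroup (adjoin G H a) G"
      using subgroup_adjoin[OF H _ a(1)] K(1) KH by blast
    have HA: "H \<subseteq> adjoin G H a" using subset_adjoin[OF H a(1)] .
    have "carrier G - adjoin G H a \<subset> carrier G - H"
      using HA mem_adjoin[OF H a(1)] a by blast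
    then have lt: "card (carrier G - adjoin G H a) < card (carrier G - H)"
      using fin by (intro psubset_card_mono) auto
    have "int n dvd \<psi> k" if k: "k \<in> K" for k
    proof -
      have "int n dvd (\<psi> k - \<chi> k) + \<chi> k"
        using \<psi>(2) KH k \<chi>K[OF k] by (intro dvd_add) auto
      then show ?thesis by simp
    qed
    then obtain \<psi>' where \<psi>': "additive_mod n (carrier G) \<psi>'"
      "\<forall>h\<in>adjoin G H a. int n dvd \<psi>' h - \<psi> h"
      using less.hyps[OF lt sub subset_trans[OF KH HA] \<psi>(1)] by blast
    have "int n dvd \<psi>' h - \<chi> h" if h: "h \<in> H" for h
    proof -
      have "int n dvd (\<psi>' h - \<psi> h) + (\<psi> h - \<chi> h)"
        using \<psi>'(2) \<psi>(2) HA h by (intro dvd_add) auto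
      then show ?thesis by simp
    qed
    then show ?thesis using \<psi>'(1) by blast
  qed
qed

text \<open>The function \<open>\<psi>\<close> is a character of \<open>G / K\<close> with values in the integers modulo \<open>n\<close> under which
  the image of \<open>g\<close> has the same order as \<open>g\<close> modulo \<open>K\<close>.\<close>

lemma exists_character:
  assumes fin: "finite (carrier G)" and K: "gamma2 G \<subseteq> K" "subgroup K G"
    and n: "0 < n" "\<And>x. x \<in> carrier G \<Longrightarrow> x [^] n \<in> K" and g: "g \<in> carrier G"
  shows "\<exists>\<psi>. additive_mod n (carrier G) \<psi> \<and> (\<forall>k\<in>K. int n dvd \<psi> k) \<and>
    int n dvd \<psi> g - int (n div ord_mod G K g)"
proof -
  let ?d = "ord_mod G K g"
  have "?d dvd n" using nat_pow_mem_iff[OF fin K(2) g] n(2)[OF g] by simp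
  then have "int ?d * int (n div ?d) = int n" by (simp flip: of_nat_mult)
  \<comment> \<open>The zero character on \<open>K\<close> may take the value n / d at
    \<open>g\<close>, since d times n / d is 0 modulo \<open>n\<close>.\<close>
  then have w: "int n dvd 0 - int ?d * int (n div ?d)" by simp
  obtain \<chi> where \<chi>: "additive_mod n (adjoin G K g) \<chi>" "\<forall>h\<in>K. int n dvd \<chi> h - 0"
    "int n dvd \<chi> g - int (n div ?d)"
    using additive_mod_adjoin[OF fin K(2) K(1) subset_refl _ _ g w]
    by (auto simp: additive_mod_def)
  have sub: "subgroup (adjoin G K g) G" by (rule subgroup_adjoin[OF K(2,1) g])
  have KA: "K \<subseteq> adjoin G K g" using subset_adjoin[OF K(2) g] .
  obtain \<psi> where \<psi>: "additive_mod n (carrier G) \<psi>" "\<forall>h\<in>adjoin G K g. int n dvd \<psi> h - \<chi> h"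
    using additive_mod_extension[OF fin K n sub KA \<chi>(1)] \<chi>(2) by auto
  have "int n dvd (\<psi> k - \<chi> k) + \<chi> k" if "k \<in> K" for k
    using \<psi>(2) \<chi>(2) KA that by (intro dvd_add) auto
  moreover have "int n dvd (\<psi> g - \<chi> g) + (\<chi> g - int (n div ?d))"
    using \<psi>(2) \<chi>(3) mem_adjoin[OF K(2) g] by (intro dvd_add) auto
  ultimately show ?thesis using \<psi>(1) by auto
qed

text \<open>The character of \<open>exists_character\<close> is composed with i \<mapsto> z^i, which
  is well defined modulo \<open>n\<close> because z^n = 1.\<close>

lemma exists_central_hom:
  assumes fin: "finite (carrier G)" and K: "gamma2 G \<subseteq> K" "subgroup K G"
    and n: "0 < n" "\<And>x. x \<in> carrier G \<Longrightarrow> x [^] n \<in> K" and g: "g \<in> carrier G"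
    and z: "z \<in> center G" "z [^] n = \<one>"
  shows "\<exists>f. f \<in> hom G G \<and> f ` carrier G \<subseteq> center G \<and> (\<forall>k\<in>K. f k = \<one>) \<and>
    f g = z [^] (n div ord_mod G K g)"
proof -
  obtain \<psi> where \<psi>: "additive_mod n (carrier G) \<psi>" "\<forall>k\<in>K. int n dvd \<psi> k"
    "int n dvd \<psi> g - int (n div ord_mod G K g)"
    using exists_character[OF fin K n g] by blast
  have zc: "z \<in> carrier G" using z center_closed by blast
  have zeq: "z [^] i = z [^] j" if ij: "int n dvd i - j" for i j :: int
  proof -
    obtain q where "i - j = int n * q" using ij ..
    then have "z [^] (i - j) = \<one>"
      using zc z(2) by (simp add: int_pow_int flip: int_pow_pow)
    then show ?thesis
      using zc inv_solve_right'[of \<one> "z [^] i" "z [^] j"] by (simp add: int_pow_diff)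
  qed
  let ?f = "\<lambda>x. z [^] \<psi> x"
  have "?f (x \<otimes> y) = ?f x \<otimes> ?f y" if "x \<in> carrier G" "y \<in> carrier G" for x y
    using zeq[of "\<psi> (x \<otimes> y)" "\<psi> x + \<psi> y"] \<psi>(1) that zc
    by (simp add: additive_mod_def int_pow_mult)
  then have "?f \<in> hom G G" using zc by (intro homI) auto
  moreover have "?f ` carrier G \<subseteq> center G" using center_int_pow_closed[OF z(1)] by blast
  moreover have "\<forall>k\<in>K. ?f k = \<one>" using zeq[of _ 0] \<psi>(2) by simp
  moreover have "?f g = z [^] (n div ord_mod G K g)"
    using zeq[OF \<psi>(3)] by (simp add: int_pow_int)
  ultimately show ?thesis by blast
qed

text \<open>As \<open>f\<close> has central values, x \<mapsto> x f(x) is a homomorphism. A kernel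
  element satisfies f(x) = x^-1, hence is central and excluded by \<open>triv\<close>; finiteness
  gives surjectivity. The restriction supplies the extensionality demanded by
  \<open>auto\<close>.\<close>

lemma restrict_mem_Aut_z:
  assumes fin: "finite (carrier G)" and f: "f \<in> hom G G" "f ` carrier G \<subseteq> center G"
    and triv: "\<And>z. z \<in> center G \<Longrightarrow> f z = inv z \<Longrightarrow> z = \<one>"
  shows "restrict (\<lambda>x. x \<otimes> f x) (carrier G) \<in> Aut_z G"
proof -
  let ?\<phi> = "\<lambda>x. x \<otimes> f x"
  have fZ: "f x \<in> center G" if "x \<in> carrier G" for x using f that by blast
  have fc: "f x \<in> carrier G" if "x \<in> carrier G" for x using fZ center_closed that by blast
  interpret f: group_hom G G f using f is_group by (simp add: group_hom_def group_hom_axioms_def)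
  have \<phi>: "?\<phi> (x \<otimes> y) = ?\<phi> x \<otimes> ?\<phi> y" if xy: "x \<in> carrier G" "y \<in> carrier G" for x y
  proof -
    have "?\<phi> (x \<otimes> y) = x \<otimes> (y \<otimes> f x) \<otimes> f y" using xy fc by (simp add: m_assoc)
    also have "y \<otimes> f x = f x \<otimes> y" using center_commute[OF fZ] xy by simp
    finally show ?thesis using xy fc by (simp add: m_assoc)
  qed
  have hom: "?\<phi> \<in> hom G G" using fc \<phi> by (intro homI) auto
  then interpret h: group_hom G G ?\<phi> using is_group by (simp add: group_hom_def group_hom_axioms_def)
  have "x = \<one>" if x: "x \<in> carrier G" and eq: "?\<phi> x = \<one>" for x
  proof -
    have "f x \<otimes> x = \<one>" using center_commute[OF fZ] x eq by simp
    then have fx: "f x = inv x" using inv_equality[of "f x" x] fc x by simp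
    have "inv (f x) \<in> center G" using fZ[OF x] by (rule center_inv_closed)
    then have "x \<in> center G" using x by (simp add: fx)
    then show "x = \<one>" using triv fx by blast
  qed
  then have inj: "inj_on ?\<phi> (carrier G)"
    using h.inj_on_one_iff by blast
  have "?\<phi> ` carrier G \<subseteq> carrier G" using fc by auto
  then have "bij_betw ?\<phi> (carrier G) (carrier G)"
    using endo_inj_surj[OF fin _ inj] inj by (simp add: bij_betw_def)
  then have "bij_betw (restrict ?\<phi> (carrier G)) (carrier G) (carrier G)"
    by (subst bij_betw_cong[where g = ?\<phi>]) simp_all
  moreover have "restrict ?\<phi> (carrier G) \<in> hom G G"
    using hom by (auto simp: hom_def)
  ultimately have "restrict ?\<phi> (carrier G) \<in> auto G"
    by (simp add: auto_def Bij_def)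
  moreover have "inv x \<otimes> restrict ?\<phi> (carrier G) x \<in> center G" if "x \<in> carrier G" for x
    using fZ[OF that] fc[OF that] that by simp
  ultimately show ?thesis by (simp add: Aut_z_def)
qed

text \<open>The automorphism x \<mapsto> x f(x) is class preserving by \<open>eq\<close>, and x f(x)
  = g^-1 x g = x [x, g] identifies f(x).\<close>

lemma central_hom_image_commutator:
  assumes fin: "finite (carrier G)" and eq: "Aut_c G = Aut_z G"
    and f: "f \<in> hom G G" "f ` carrier G \<subseteq> center G"
    and triv: "\<And>z. z \<in> center G \<Longrightarrow> f z = inv z \<Longrightarrow> z = \<one>"
    and x: "x \<in> carrier G"
  shows "\<exists>g\<in>carrier G. f x = commutator G x g"
proof -
  have "restrict (\<lambda>x. x \<otimes> f x) (carrier G) \<in> Aut_c G"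
    using restrict_mem_Aut_z[OF fin f triv] eq by simp
  then obtain g where g: "g \<in> carrier G" "x \<otimes> f x = inv g \<otimes> x \<otimes> g"
    unfolding Aut_c_def using x by auto
  then have "x \<otimes> f x = x \<otimes> commutator G x g"
    using conjugate_eq_mult_commutator[OF x] by simp
  moreover have "f x \<in> carrier G" using f x by (auto simp: hom_def)
  ultimately show ?thesis using g x by auto
qed

lemma class2_if_Aut_c_subset_Aut_z:
  assumes eq: "Aut_c G \<subseteq> Aut_z G"
  shows "class2_group G"
proof
  fix x g assume x: "x \<in> carrier G" and g: "g \<in> carrier G"
  let ?\<phi> = "\<lambda>y. inv g \<otimes> y \<otimes> g"
  have "bij_betw ?\<phi> (carrier G) (carrier G)"
    by (rule bij_betw_byWitness[where f' = "\<lambda>y. g \<otimes> y \<otimes> inv g"])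
      (use g in \<open>auto simp: m_assoc\<close>)
  then have "bij_betw (restrict ?\<phi> (carrier G)) (carrier G) (carrier G)"
    by (subst bij_betw_cong[where g = ?\<phi>]) simp_all
  moreover have "restrict ?\<phi> (carrier G) \<in> hom G G"
    using g by (intro homI) (auto simp: m_assoc)
  ultimately have "restrict ?\<phi> (carrier G) \<in> Aut_c G"
    using g by (auto simp: Aut_c_def auto_def Bij_def)
  then have "inv x \<otimes> restrict ?\<phi> (carrier G) x \<in> center G"
    using eq x by (auto simp: Aut_z_def)
  then show "commutator G x g \<in> center G"
    using x g by (simp add: commutator_def m_assoc)
qed

end

section \<open>Orders, centralizers and the center of groups of prime power order\<close>

context group
begin

definition centralizer :: "'a \<Rightarrow> 'a set" where
  "centralizer g = {x \<in> carrier G. commutator G g x = \<one>}"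

lemma ord_mod_prime_power:
  assumes p: "Factorial_Ring.prime p" and ord: "order G = p ^ m"
    and K: "subgroup K G" and x: "x \<in> carrier G"
  obtains e where "e \<le> m" "ord_mod G K x = p ^ e"
proof -
  have fin: "finite (carrier G)"
    using ord p by (intro order_gt_0_iff_finite[THEN iffD1]) (simp add: prime_gt_0_nat)
  have "x [^] order G \<in> K" using pow_order_eq_1[OF x] subgroup.one_closed[OF K] by simp
  then have "ord_mod G K x dvd p ^ m" using nat_pow_mem_iff[OF fin K x] ord by simp
  then show ?thesis using that divides_primepow_nat[OF p] by blast
qed

text \<open>Orders modulo \<open>K\<close> are powers of \<open>p\<close>, hence totally ordered by
  divisibility: the largest one is a multiple of all others and is attained.\<close>

lemma exponent_mod_subgroup:
  assumes p: "Factorial_Ring.prime p" and ord: "order G = p ^ m" and K: "subgroup K G"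
  shows "\<exists>e. \<exists>g\<in>carrier G. ord_mod G K g = p ^ e \<and> (\<forall>x\<in>carrier G. x [^] (p ^ e) \<in> K)"
proof -
  have fin: "finite (carrier G)"
    using ord p by (intro order_gt_0_iff_finite[THEN iffD1]) (simp add: prime_gt_0_nat)
  define S where "S = {e. \<exists>g\<in>carrier G. ord_mod G K g = p ^ e}"
  have "e \<le> m" if eS: "e \<in> S" for e
  proof -
    obtain g where g: "g \<in> carrier G" "ord_mod G K g = p ^ e" using eS unfolding S_def by blast
    obtain e' where "e' \<le> m" "ord_mod G K g = p ^ e'" using ord_mod_prime_power[OF p ord K g(1)] .
    then have "p ^ e' = p ^ e" using g(2) by simp
    then show ?thesis
      using power_inject_exp[OF prime_gt_1_nat[OF p], of e' e] \<open>e' \<le> m\<close> by blast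
  qed
  then have finS: "finite S" by (meson atMost_iff finite_atMost finite_subset subsetI)
  obtain e0 where "ord_mod G K \<one> = p ^ e0" using ord_mod_prime_power[OF p ord K one_closed] .
  then have "S \<noteq> {}" unfolding S_def by blast
  then have "Max S \<in> S" using finS by simp
  then obtain g where g: "g \<in> carrier G" "ord_mod G K g = p ^ Max S"
    unfolding S_def by blast
  have "x [^] (p ^ Max S) \<in> K" if x: "x \<in> carrier G" for x
  proof -
    obtain e where e: "ord_mod G K x = p ^ e" using ord_mod_prime_power[OF p ord K x] .
    then have "e \<le> Max S" using finS x unfolding S_def by (intro Max_ge) auto
    then show ?thesis using nat_pow_mem_iff[OF fin K x] e by (simp add: le_imp_power_dvd)
  qed
  then show ?thesis using g by blast
qed

lemma commutator_kernel:
  assumes f: "f \<in> hom G G" "f ` carrier G \<subseteq> center G"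
    and x: "x \<in> carrier G" and y: "y \<in> carrier G"
  shows "f (commutator G x y) = \<one>"
proof -
  interpret f: group_hom G G f using f is_group by (simp add: group_hom_def group_hom_axioms_def)
  have "f (commutator G x y) = commutator G (f x) (f y)"
    using x y by (simp add: commutator_def)
  moreover have "f x \<in> center G" using f x by blast
  ultimately show ?thesis
    using commutator_eq_one_iff[of "f x" "f y"] center_commute[of "f x" "f y"] x y by simp
qed

end

context class2_group
begin

lemma commutator_nat_pow_left:
  "x \<in> carrier G \<Longrightarrow> y \<in> carrier G \<Longrightarrow>
    commutator G (x [^] (n::nat)) y = commutator G x y [^] n"
  using commutator_int_pow_left[of x y "int n"] by (simp add: int_pow_int)

lemma subgroup_commuting:
  assumes D: "subgroup D G" and g: "g \<in> carrier G"
  shows "subgroup {x \<in> D. commutator G g x = \<one>} G"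
proof (rule subgroupI)
  note Dc = subgroup.mem_carrier[OF D]
  show "{x \<in> D. commutator G g x = \<one>} \<subseteq> carrier G" using Dc by blast
  show "{x \<in> D. commutator G g x = \<one>} \<noteq> {}"
    using subgroup.one_closed[OF D] g by force
  show "inv x \<in> {x \<in> D. commutator G g x = \<one>}" if "x \<in> {x \<in> D. commutator G g x = \<one>}" for x
    using that Dc g subgroup.m_inv_closed[OF D] by (simp add: commutator_inv_right)
  show "x \<otimes> y \<in> {x \<in> D. commutator G g x = \<one>}"
    if "x \<in> {x \<in> D. commutator G g x = \<one>}" "y \<in> {x \<in> D. commutator G g x = \<one>}" for x y
    using that Dc g subgroup.m_closed[OF D] by (simp add: commutator_mult_right)
qed

lemma card_commuting:
  assumes fin: "finite (carrier G)" and D: "subgroup D G" and g: "g \<in> carrier G"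
  shows "card D = card (commutator G g ` D) * card {x \<in> D. commutator G g x = \<one>}"
  using subgroup.mem_carrier[OF D] g
  by (intro card_image_mult_card_kernel[OF fin D is_group]) (simp_all add: commutator_mult_right)

lemma subgroup_centralizer: "g \<in> carrier G \<Longrightarrow> subgroup (centralizer g) G"
  unfolding centralizer_def by (rule subgroup_commuting[OF subgroup_self])

lemma center_subset_centralizer: "g \<in> carrier G \<Longrightarrow> center G \<subseteq> centralizer g"
  using center_closed by (auto simp: centralizer_def)

lemma card_centralizer:
  "finite (carrier G) \<Longrightarrow> g \<in> carrier G \<Longrightarrow>
    order G = card (commutator G g ` carrier G) * card (centralizer g)"
  unfolding centralizer_def order_def by (rule card_commuting[OF _ subgroup_self])

text \<open>As \<open>g\<close> has maximal order modulo \<open>Z(G)\<close>, some homomorphism from \<open>G / Z(G)\<close> to \<open>Z(G)\<close> sends \<open>g\<close>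
  to \<open>z\<close>; it kills \<open>Z(G)\<close> and therefore gives a central automorphism.\<close>

lemma central_is_commutator:
  assumes fin: "finite (carrier G)" and eq: "Aut_c G = Aut_z G"
    and n: "0 < n" "\<And>x. x \<in> carrier G \<Longrightarrow> x [^] n \<in> center G"
    and g: "g \<in> carrier G" "ord_mod G (center G) g = n"
    and z: "z \<in> center G" "z [^] n = \<one>"
  shows "z \<in> commutator G g ` carrier G"
proof -
  obtain f where f: "f \<in> hom G G" "f ` carrier G \<subseteq> center G" "\<forall>k\<in>center G. f k = \<one>"
      "f g = z [^] (n div ord_mod G (center G) g)"
    using exists_central_hom[OF fin gamma2_subset_center subgroup_center n g(1) z] by blast
  have "w = \<one>" if "w \<in> center G" "f w = inv w" for w
    using f(3) that center_closed by (metis inv_eq_1_iff)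
  then obtain h where "h \<in> carrier G" "f g = commutator G g h"
    using central_hom_image_commutator[OF fin eq f(1,2) _ g(1)] by blast
  moreover have "f g = z" using f(4) g(2) n(1) z(1) center_closed by simp
  ultimately show ?thesis by blast
qed

text \<open>Every homomorphism f into Z(G) turns out to give a central automorphism, so f(x) lies in
  [x, G]: f takes values in gamma_2(G) and kills Z(G). Let p^k be the exponent of G / gamma_2(G) and
  y in Z(G) outside gamma_2(G). If Z(G) has exponent dividing p^k, some f takes the value y;
  otherwise Z(G) has an element z0 of order p^k, and some f with values in its powers is non-trivial
  at y.\<close>

lemma center_subset_gamma2:
  assumes p: "Factorial_Ring.prime p" and ord: "order G = p ^ m"
    and nc: "\<not> comm_group G" and eq: "Aut_c G = Aut_z G"
  shows "center G \<subseteq> gamma2 G"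
proof -
  have p1: "1 < p" using prime_gt_1_nat[OF p] .
  have fin: "finite (carrier G)"
    using ord p1 by (intro order_gt_0_iff_finite[THEN iffD1]) simp
  obtain e g where e: "\<And>x. x \<in> carrier G \<Longrightarrow> x [^] (p ^ e) \<in> center G" "g \<in> carrier G"
      "ord_mod G (center G) g = p ^ e"
    using exponent_mod_subgroup[OF p ord subgroup_center] by blast
  have "e \<noteq> 0"
  proof
    assume "e = 0"
    then have "carrier G \<subseteq> center G" using e(1) by force
    then have "comm_group G" using center_commute by (intro group_comm_groupI) blast
    then show False using nc by blast
  qed
  then have pe: "p dvd p ^ e" by simp
  \<comment> \<open>If f(z) = z^-1 with z not 1, the power \<open>w\<close> of z of order
    \<open>p\<close> also satisfies f(w) = w^-1. But w^(p^e) = 1 makes \<open>w\<close> a commutator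
    with \<open>g\<close>, and f kills commutators.\<close>
  have triv: "z = \<one>" if f: "f \<in> hom G G" "f ` carrier G \<subseteq> center G"
    and z: "z \<in> center G" and fz: "f z = inv z" for f z
  proof (rule ccontr)
    assume "z \<noteq> \<one>"
    have zc: "z \<in> carrier G" using z center_closed by blast
    interpret f: group_hom G G f using f is_group by (simp add: group_hom_def group_hom_axioms_def)
    obtain k where k: "ord_mod G {\<one>} z = p ^ k"
      using ord_mod_prime_power[OF p ord triv_subgroup zc] .
    have pow: "z [^] (n::nat) = \<one> \<longleftrightarrow> p ^ k dvd n" for n
      using nat_pow_mem_iff[OF fin triv_subgroup zc, of n] k by simp
    have "k \<noteq> 0" using pow[of 1] \<open>z \<noteq> \<one>\<close> zc by (intro notI) simp
    then obtain k' where k': "k = Suc k'" using not0_implies_Suc by blast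
    define w where "w = z [^] (p ^ k')"
    have wZ: "w \<in> center G"
      unfolding w_def int_pow_int [symmetric] by (rule center_int_pow_closed[OF z])
    have "w \<noteq> \<one>" unfolding w_def pow k' using p1 by (simp add: power_dvd_imp_le dvd_power_iff_le)
    have "w [^] p = \<one>"
      unfolding w_def nat_pow_pow[OF zc] pow k' by simp
    then have "w [^] (p ^ e) = \<one>"
      using pe wZ center_closed by (metis dvdE nat_pow_one nat_pow_pow)
    then obtain h where h: "h \<in> carrier G" "w = commutator G g h"
      using central_is_commutator[OF fin eq _ e(1) e(2,3) wZ] p1 by auto
    have "f w = \<one>" using commutator_kernel[OF f e(2) h(1)] h(2) by simp
    moreover have "f w = inv w"
      unfolding w_def using zc fz by (simp add: f.hom_nat_pow nat_pow_inv)
    ultimately show False using \<open>w \<noteq> \<one>\<close> wZ center_closed by (metis inv_eq_1_iff)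
  qed
  have img: "f x \<in> gamma2 G" "x \<in> center G \<Longrightarrow> f x = \<one>"
    if f: "f \<in> hom G G" "f ` carrier G \<subseteq> center G" and x: "x \<in> carrier G" for f x
  proof -
    obtain h where "h \<in> carrier G" "f x = commutator G x h"
      using central_hom_image_commutator[OF fin eq f triv[OF f] x] by blast
    then show "f x \<in> gamma2 G" "x \<in> center G \<Longrightarrow> f x = \<one>"
      using commutator_in_gamma2 x by simp_all
  qed
  obtain k g' where k: "\<And>x. x \<in> carrier G \<Longrightarrow> x [^] (p ^ k) \<in> gamma2 G" "g' \<in> carrier G"
      "ord_mod G (gamma2 G) g' = p ^ k"
    using exponent_mod_subgroup[OF p ord subgroup_gamma2] by blast
  have pk: "0 < p ^ k" using p1 by simp
  show ?thesis
  proof (rule ccontr)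
    assume "\<not> center G \<subseteq> gamma2 G"
    then obtain y where y: "y \<in> center G" "y \<notin> gamma2 G" by blast
    have yc: "y \<in> carrier G" using y center_closed by blast
    show False
    proof (cases "\<forall>z\<in>center G. z [^] (p ^ k) = \<one>")
      case True
      then obtain f where f: "f \<in> hom G G" "f ` carrier G \<subseteq> center G"
          "f g' = y [^] (p ^ k div ord_mod G (gamma2 G) g')"
        using exists_central_hom[OF fin subset_refl subgroup_gamma2 pk k(1,2) y(1)] y(1) by blast
      then have "f g' = y" using k(3) pk yc by simp
      then show False using img(1)[OF f(1,2) k(2)] y(2) by simp
    next
      case False
      then obtain z where z: "z \<in> center G" "z [^] (p ^ k) \<noteq> \<one>" by blast
      have zc: "z \<in> carrier G" using z center_closed by blast
      obtain l where l: "ord_mod G {\<one>} z = p ^ l"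
        using ord_mod_prime_power[OF p ord triv_subgroup zc] .
      have pow: "z [^] (n::nat) = \<one> \<longleftrightarrow> p ^ l dvd n" for n
        using nat_pow_mem_iff[OF fin triv_subgroup zc, of n] l by simp
      have "k < l" using z(2) unfolding pow by (meson le_imp_power_dvd not_le)
      then have pl: "p ^ l = p ^ (l - k) * p ^ k" by (simp flip: power_add)
      define z0 where "z0 = z [^] (p ^ (l - k))"
      have z0: "z0 \<in> center G"
        unfolding z0_def int_pow_int [symmetric] by (rule center_int_pow_closed[OF z(1)])
      have z0p: "z0 [^] (n::nat) = \<one> \<longleftrightarrow> p ^ k dvd n" for n
        unfolding z0_def nat_pow_pow[OF zc] pow pl using p1 by simp
      have z0n: "z0 [^] (p ^ k) = \<one>" using z0p by simp
      let ?d = "ord_mod G (gamma2 G) y"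
      obtain f where f: "f \<in> hom G G" "f ` carrier G \<subseteq> center G" "f y = z0 [^] (p ^ k div ?d)"
        using exists_central_hom[OF fin subset_refl subgroup_gamma2 pk k(1) yc z0 z0n] by blast
      have "f y = \<one>" using img(2)[OF f(1,2) yc y(1)] .
      \<comment> \<open>Since \<open>z0\<close> has order p^k, z0^(p^k / d) = 1 leaves only d = 1,
        that is y in gamma_2(G).\<close>
      then have dv: "p ^ k dvd p ^ k div ?d" using f(3) z0p by simp
      have "?d dvd p ^ k" using nat_pow_mem_iff[OF fin subgroup_gamma2 yc] k(1)[OF yc] by simp
      then have eqd: "p ^ k = ?d * (p ^ k div ?d)" by simp
      then have "0 < p ^ k div ?d" using pk by (metis mult_0_right neq0_conv)
      then have "p ^ k \<le> p ^ k div ?d" using dv by (rule dvd_imp_le[rotated])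
      then have "?d \<le> 1"
        using eqd \<open>0 < p ^ k div ?d\<close> by (metis mult_le_cancel2 nat_mult_1)
      then have "?d dvd 1" using ord_mod_pos[OF fin subgroup_gamma2 yc] by simp
      then show False
        using nat_pow_mem_iff[OF fin subgroup_gamma2 yc, of 1] y(2) yc by simp
    qed
  qed
qed

text \<open>The image of \<open>D\<close> under x \<mapsto> [g, x] is a non-trivial subgroup of a
  group of order \<open>p\<close>, and the elements commuting with \<open>g\<close> form the
  kernel.\<close>

lemma card_eq_prime_mult_card_commuting:
  assumes p: "Factorial_Ring.prime p" and ord: "order G = p ^ m" and Z: "card (center G) = p"
    and D: "subgroup D G" and g: "g \<in> carrier G" and h: "h \<in> D" "commutator G g h \<noteq> \<one>"
  shows "card D = p * card {x \<in> D. commutator G g x = \<one>}"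
proof -
  have fin: "finite (carrier G)"
    using ord p by (intro order_gt_0_iff_finite[THEN iffD1]) (simp add: prime_gt_0_nat)
  let ?I = "commutator G g ` D"
  note Dc = subgroup.mem_carrier[OF D]
  have card: "card D = card ?I * card {x \<in> D. commutator G g x = \<one>}"
    by (rule card_commuting[OF fin D g])
  have finZ: "finite (center G)" 
    by (rule finite_subset[OF subgroup.subset[OF subgroup_center] fin])
  have IZ: "?I \<subseteq> center G" using commutator_central g Dc by blast
  have "card D dvd p ^ m" using lagrange[OF D] ord by (metis dvd_triv_right)
  then have "card ?I dvd p ^ m" using card dvd_mult_left by metis
  then obtain j where j: "card ?I = p ^ j" using divides_primepow_nat[OF p] by blast
  have "{\<one>, commutator G g h} \<subseteq> ?I"
    using subgroup.one_closed[OF D] h g by (auto intro!: image_eqI[of _ _ \<one>])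
  then have "card {\<one>, commutator G g h} \<le> card ?I"
    using finZ IZ by (intro card_mono) (auto intro: finite_subset)
  then have "2 \<le> card ?I" using h(2) by simp
  then have "j \<noteq> 0" using j by (intro notI) simp
  then have "p \<le> card ?I"
    using power_increasing[of 1 j p] prime_ge_1_nat[OF p] j by simp
  moreover have "card ?I \<le> p" using card_mono[OF finZ IZ] Z by simp
  ultimately show ?thesis using card by simp
qed

text \<open>The commutator form on \<open>D / Z(G)\<close> is a non-degenerate alternating form over a prime field;
  a hyperbolic plane \<open>\<langle>a, b\<rangle>\<close> is split off in each step.\<close>

lemma card_odd_power:
  assumes p: "Factorial_Ring.prime p" and ord: "order G = p ^ m" and Z: "card (center G) = p"
  shows "subgroup D G \<Longrightarrow> center G \<subseteq> D \<Longrightarrow>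
    (\<And>x. x \<in> D \<Longrightarrow> (\<And>y. y \<in> D \<Longrightarrow> commutator G x y = \<one>) \<Longrightarrow> x \<in> center G) \<Longrightarrow>
    \<exists>k. card D = p ^ (2 * k + 1)"
proof (induction "card D" arbitrary: D rule: less_induct)
  case less
  note D = less.prems(1) and ZD = less.prems(2) and nd = less.prems(3)
  note Dc = subgroup.mem_carrier[OF D]
  have p1: "1 < p" using prime_gt_1_nat[OF p] .
  have fin: "finite (carrier G)"
    using ord p1 by (intro order_gt_0_iff_finite[THEN iffD1]) simp
  show ?case
  proof (cases "D = center G")
    case True
    then show ?thesis using Z by (intro exI[of _ 0]) simp
  next
    case False
    then obtain a where a: "a \<in> D" "a \<notin> center G" using ZD by blast
    then obtain b where b: "b \<in> D" "commutator G a b \<noteq> \<one>" using nd by blast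
    have ab: "a \<in> carrier G" "b \<in> carrier G" using a b Dc by blast+
    have ba: "commutator G b a \<noteq> \<one>" using b(2) ab by (metis commutator_eq_one_iff)
    \<comment> \<open>\<open>F E\<close> is the orthogonal complement of the plane of a and b inside
      E, of index p^2 if E contains a and b.\<close>
    define F where "F E = {x \<in> {x \<in> E. commutator G a x = \<one>}. commutator G b x = \<one>}" for E
    have F: "subgroup (F E) G \<and> card E = p * (p * card (F E))"
      if E: "subgroup E G" "a \<in> E" "b \<in> E" for E
    proof -
      let ?E1 = "{x \<in> E. commutator G a x = \<one>}"
      have E1: "subgroup ?E1 G" using subgroup_commuting[OF E(1) ab(1)] .
      have "card E = p * card ?E1"
        by (rule card_eq_prime_mult_card_commuting[OF p ord Z E(1) ab(1) E(3) b(2)])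
      moreover have "card ?E1 = p * card (F E)"
        unfolding F_def
        by (rule card_eq_prime_mult_card_commuting[OF p ord Z E1 ab(2) _ ba]) (use E ab in simp)
      ultimately show ?thesis using subgroup_commuting[OF E1 ab(2)] unfolding F_def by simp
    qed
    have FD: "subgroup (F D) G" "card D = p * (p * card (F D))" using F[OF D a(1) b(1)] by auto
    have ZF: "center G \<subseteq> F D" using ZD ab by (auto simp: F_def)
    have "0 < card (F D)"
      using subgroup.finite_imp_card_positive[OF FD(1)] fin by blast
    then have "card (F D) < card D" unfolding FD(2) using p1
      by (metis One_nat_def less_1_mult mult.assoc mult_less_cancel2 nat_mult_1)
    moreover have "x \<in> center G"
      if x: "x \<in> F D" and xF: "\<And>y. y \<in> F D \<Longrightarrow> commutator G x y = \<one>" for x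
    proof -
      have xD: "x \<in> D" "commutator G a x = \<one>" "commutator G b x = \<one>" using x by (auto simp: F_def)
      have xc: "x \<in> carrier G" using xD Dc by blast
      \<comment> \<open>Non-degeneracy passes to \<open>F D\<close> by counting: the part
        \<open>E\<close> of \<open>D\<close> commuting with \<open>x\<close> contains a, b and all
        of \<open>F D\<close>, so |E| = p^2 |F D| = |D| and \<open>x\<close> commutes with
        \<open>D\<close>.\<close>
      define E where "E = {y \<in> D. commutator G x y = \<one>}"
      have E: "subgroup E G" unfolding E_def by (rule subgroup_commuting[OF D xc])
      have "commutator G x a = \<one>" "commutator G x b = \<one>"
        using xD(2,3) xc ab by (metis commutator_eq_one_iff)+
      then have "a \<in> E" "b \<in> E" using a b by (auto simp: E_def)
      then have "card E = p * (p * card (F E))" using F[OF E] by blast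
      moreover have "F E = F D" using xF by (auto simp: F_def E_def)
      ultimately have "card E = card D" using FD(2) by simp
      moreover have "E \<subseteq> D" "finite D"
        using fin subgroup.subset[OF D] by (auto simp: E_def intro: finite_subset)
      ultimately have "E = D" using card_subset_eq by blast
      then show ?thesis using nd[OF xD(1)] by (auto simp: E_def)
    qed
    ultimately obtain k where "card (F D) = p ^ (2 * k + 1)"
      using less.hyps[OF _ FD(1) ZF] by blast
    then have "card D = p ^ (2 * Suc k + 1)" using FD(2) by simp
    then show ?thesis ..
  qed
qed

end

section \<open>Reduction to the normal forms\<close>

context class2_group
begin

text \<open>The centralizer of \<open>g\<close> has order p^4, as has the subgroup generated by Z(G)
  and \<open>g\<close>, so they agree. For h not commuting with g^p, the commutator c = [g, h] has
  order p^2 and generates Z(G); division by a power of h then brings any element into the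
  centralizer of \<open>g\<close>.\<close>

lemma coordinates14_exists:
  assumes p: "Factorial_Ring.prime p" and ord: "order G = p ^ 6" and Z: "card (center G) = p\<^sup>2"
    and g: "g \<in> carrier G" "ord_mod G (center G) g = p\<^sup>2"
    and img: "commutator G g ` carrier G = center G"
  shows "\<exists>a b. coordinates G a b comm14 (eq14 (p\<^sup>2))"
proof -
  have p1: "1 < p" using prime_gt_1_nat[OF p] .
  have fin: "finite (carrier G)"
    using ord p1 by (intro order_gt_0_iff_finite[THEN iffD1]) simp
  note fins = finite_subset[OF subgroup.subset fin]
  have "p ^ 6 = p\<^sup>2 * card (centralizer g)"
    using card_centralizer[OF fin g(1)] ord img Z by simp
  moreover have "p ^ 6 = p\<^sup>2 * p ^ 4" using power_add[of p 2 4] by simp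
  ultimately have "p\<^sup>2 * card (centralizer g) = p\<^sup>2 * p ^ 4" by metis
  then have "card (centralizer g) = p ^ 4"
    by (rule mult_left_cancel[THEN iffD1, rotated]) (use p1 in simp)
  moreover have "card (adjoin G (center G) g) = p ^ 4"
    using card_adjoin[OF fin subgroup_center g(1)] g(2) Z by (simp flip: power_add)
  moreover have "adjoin G (center G) g \<subseteq> centralizer g"
    using g center_subset_centralizer
    by (intro adjoin_subset subgroup_centralizer) (auto simp: centralizer_def)
  ultimately have cent: "centralizer g = adjoin G (center G) g"
    using fins[OF subgroup_centralizer[OF g(1)]] card_subset_eq by metis
  have gp: "g [^] (n::nat) \<in> center G \<longleftrightarrow> p\<^sup>2 dvd n" for n
    using nat_pow_mem_iff[OF fin subgroup_center g(1)] g(2) by simp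
  have "\<not> p\<^sup>2 dvd p" using p1 power_dvd_imp_le[of p 2 1] by auto
  then have "g [^] p \<notin> center G" using gp by blast
  then obtain h where h: "h \<in> carrier G" "commutator G (g [^] p) h \<noteq> \<one>"
    using mem_center_iff[of "g [^] p"] g(1) by blast
  define c where "c = commutator G g h"
  have cc: "c \<in> carrier G" using g h by (simp add: c_def)
  have cZ: "c \<in> center G" using g h commutator_central by (simp add: c_def)
  have "c [^] p \<noteq> \<one>" using h g by (simp add: c_def commutator_nat_pow_left)
  moreover have "c [^] (p\<^sup>2) = \<one>"
    using h g gp[of "p\<^sup>2"] commutator_nat_pow_left[OF g(1) h(1), of "p\<^sup>2"] by (simp add: c_def)
  moreover obtain l where l: "ord_mod G {\<one>} c = p ^ l"
    using ord_mod_prime_power[OF p ord triv_subgroup cc] .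
  ultimately have "p ^ l dvd p ^ 2" "\<not> p ^ l dvd p ^ 1"
    using nat_pow_mem_iff[OF fin triv_subgroup cc] by simp_all
  then have "l \<le> 2" "\<not> l \<le> 1"
    using p1 power_dvd_imp_le[of p l 2] le_imp_power_dvd[of l 1 p] by auto
  then have "l = 2" by simp
  then have ordc: "ord_mod G {\<one>} c = p\<^sup>2" using l by simp
  have "adjoin G {\<one>} c \<subseteq> center G"
    using cZ by (intro adjoin_subset subgroup_center) auto
  moreover have "card (adjoin G {\<one>} c) = p\<^sup>2"
    using card_adjoin[OF fin triv_subgroup cc] ordc by simp
  ultimately have gen: "adjoin G {\<one>} c = center G"
    using fins[OF subgroup_center] Z card_subset_eq by metis
  have "carrier G \<subseteq> adjoin G (adjoin G (center G) g) h"
  proof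
    fix x assume x: "x \<in> carrier G"
    have "commutator G g x \<in> adjoin G {\<one>} c" unfolding gen using g x commutator_central by blast
    then obtain j :: int where j: "commutator G g x = c [^] j"
      using cc by (auto simp: adjoin_def)
    have "commutator G g (x \<otimes> inv (h [^] j)) = \<one>"
      using g h x j cc
      by (simp add: commutator_mult_right commutator_inv_right commutator_int_pow_right flip: c_def)
    then have "x \<otimes> inv (h [^] j) \<in> adjoin G (center G) g"
      using x h by (simp flip: cent) (simp add: centralizer_def)
    moreover have "x = (x \<otimes> inv (h [^] j)) \<otimes> h [^] j" using x h by (simp add: m_assoc)
    ultimately show "x \<in> adjoin G (adjoin G (center G) g) h"
      unfolding adjoin_def[of G "adjoin G (center G) g"] by blast
  qed
  then have cover: "carrier G = adjoin G (adjoin G (center G) g) h"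
    using subgroup.subset[OF adjoin_chain(1)[OF adjoin_chain(1,2)[OF subgroup_center subset_refl g(1)] h(1)]]
    by blast
  have "commutator G g h [^] k = \<one> \<longleftrightarrow> int (p\<^sup>2) dvd k" for k :: int
    using int_pow_mem_iff[OF fin triv_subgroup cc, of k] ordc by (simp add: c_def)
  from coordinates14[OF g(1) h(1) cover this] show ?thesis by blast
qed

text \<open>Multiplication of \<open>a4\<close>, \<open>y\<close> by powers of \<open>a1\<close>, \<open>x\<close> completes the square in the
  characteristic polynomial \<open>T\<^sup>2 - s T - r\<close> of the map \<open>T\<close> with \<open>[a1, T w] = [a4, w]\<close>; its
  discriminant is a non-residue because \<open>T\<close> has no eigenvector.\<close>

lemma coordinates15_normal_form:
  assumes p: "Factorial_Ring.prime p" "odd p" and g: "nonresidue p g"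
    and car: "a1 \<in> carrier G" "a4 \<in> carrier G" "x \<in> carrier G" "y \<in> carrier G"
    and uvZ: "u \<in> center G" "v \<in> center G"
    and comm: "commutator G a1 x = u" "commutator G a4 x = v" "commutator G a1 y = v"
      "commutator G a4 y = u [^] (r::int) \<otimes> v [^] (s::int)" "commutator G a1 a4 = \<one>"
    and ord: "\<And>(k::int) (l::int). u [^] k \<otimes> v [^] l = \<one> \<longleftrightarrow> int p dvd k \<and> int p dvd l"
    and span: "\<And>z. z \<in> center G \<Longrightarrow> \<exists>(k::int) (l::int). z = u [^] k \<otimes> v [^] l"
    and dich: "\<And>w q. w \<in> carrier G \<Longrightarrow> q \<in> carrier G \<Longrightarrow> commutator G a1 w = \<one> \<Longrightarrow>
      commutator G w q = \<one> \<Longrightarrow> commutator G a1 q = \<one> \<or> w \<in> center G"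
  shows "\<exists>a b. coordinates G a b (comm15 g) (eq15 p)"
proof -
  define \<beta> where "\<beta> = (\<lambda>(k::int) (l::int). u [^] k \<otimes> v [^] l)"
  have uv: "u \<in> carrier G" "v \<in> carrier G" using uvZ center_closed by blast+
  have \<beta>c [simp]: "\<beta> k l \<in> carrier G" for k l using uv by (simp add: \<beta>_def)
  have \<beta>Z: "\<beta> k l \<in> center G" for k l
    unfolding \<beta>_def using uvZ center_mult_closed center_int_pow_closed by blast
  have \<beta>_mult: "\<beta> k l \<otimes> \<beta> k' l' = \<beta> (k + k') (l + l')" for k l k' l'
    unfolding \<beta>_def by (rule central_pair_mult[OF uvZ])
  have \<beta>_pow: "\<beta> k l [^] (i::int) = \<beta> (k * i) (l * i)" for k l i
    unfolding \<beta>_def by (rule central_pair_int_pow[OF uvZ])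
  have \<beta>_inv: "inv (\<beta> k l) = \<beta> (- k) (- l)" for k l
    unfolding \<beta>_def by (rule central_pair_inv[OF uvZ])
  have \<beta>_one: "\<beta> k l = \<one> \<longleftrightarrow> int p dvd k \<and> int p dvd l" for k l
    unfolding \<beta>_def by (rule ord)
  have one\<beta>: "\<one> = \<beta> 0 0" using \<beta>_one[of 0 0] by simp
  have \<beta>_eq: "\<beta> k l = \<beta> k' l' \<longleftrightarrow> int p dvd k - k' \<and> int p dvd l - l'" for k l k' l'
    using inv_solve_right'[of \<one> "\<beta> k l" "\<beta> k' l'"] \<beta>_one[of "k - k'" "l - l'"]
    by (auto simp: \<beta>_inv \<beta>_mult)
  have span\<beta>: "\<exists>k l. z = \<beta> k l" if "z \<in> center G" for z
    using span[OF that] by (simp add: \<beta>_def)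
  obtain c1 c2 where xy: "commutator G x y = \<beta> c1 c2"
    using span\<beta>[OF commutator_central] car by blast
  have base: "commutator G a1 x = \<beta> 1 0" "commutator G a4 x = \<beta> 0 1" "commutator G a1 y = \<beta> 0 1"
    "commutator G a4 y = \<beta> r s" "commutator G a1 a4 = \<beta> 0 0"
    using uv by (simp_all add: comm \<beta>_def)
  have base': "commutator G x a1 = \<beta> (-1) 0" "commutator G x a4 = \<beta> 0 (-1)"
    "commutator G y a1 = \<beta> 0 (-1)" "commutator G y a4 = \<beta> (-r) (-s)"
    "commutator G a4 a1 = \<beta> 0 0" "commutator G y x = \<beta> (-c1) (-c2)"
    using car by (simp_all add: inv_commutator [symmetric] base xy \<beta>_inv)
  note expand = commutator_mult_left commutator_mult_right commutator_int_pow_left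
    commutator_int_pow_right base base' xy one\<beta> \<beta>_mult \<beta>_pow
  \<comment> \<open>m + 1 is the inverse of 2 modulo \<open>p\<close>, so \<open>h\<close> below
    stands for s / 2.\<close>
  obtain m where m: "int p = 2 * m + 1" using p(2) by (metis even_of_nat oddE)
  define h where "h = s * (m + 1)"
  have s2h: "s - 2 * h = int p * (- s)" by (simp add: h_def m algebra_simps)
  \<comment> \<open>Modulo \<open>p\<close>, a quarter of the discriminant s^2 + 4 r.\<close>
  define D where "D = r + h\<^sup>2"
  have D: "nonresidue p D"
    unfolding nonresidue_def
  proof (intro allI impI)
    fix i j assume ij: "int p dvd i\<^sup>2 - D * j\<^sup>2"
    \<comment> \<open>With a4' = a4 a1^-h and y' = y x^-h these are a4'^j a1^-i and y'^j x^i up to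
      central factors. The mixed terms cancel and [w, q] = u^(D j^2 - i^2), so a zero of the form
      makes \<open>w\<close> and \<open>q\<close> commute, and \<open>dich\<close> forces i and j to
      vanish modulo \<open>p\<close>.\<close>
    define w where "w = a4 [^] j \<otimes> a1 [^] (- i - h * j)"
    define q where "q = y [^] j \<otimes> x [^] (i - h * j)"
    have wq: "w \<in> carrier G" "q \<in> carrier G" using car by (simp_all add: w_def q_def)
    have "commutator G w q = \<beta> (D * j\<^sup>2 - i\<^sup>2) ((s - 2 * h) * j\<^sup>2)"
      unfolding w_def q_def using car
      by (simp add: expand) (simp add: D_def algebra_simps power2_eq_square)
    moreover have "int p dvd D * j\<^sup>2 - i\<^sup>2" using ij by (subst dvd_diff_commute)
    ultimately have "commutator G w q = \<one>" by (simp add: \<beta>_one s2h)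
    moreover have "commutator G a1 w = \<one>"
      unfolding w_def using car by (simp add: expand)
    ultimately have "commutator G a1 q = \<one> \<or> w \<in> center G" using dich[OF wq] by blast
    then have "int p dvd i \<and> int p dvd j"
    proof
      assume "commutator G a1 q = \<one>"
      moreover have "commutator G a1 q = \<beta> (i - h * j) j"
        unfolding q_def using car by (simp add: expand)
      ultimately have "int p dvd i - h * j" "int p dvd j" by (simp_all add: \<beta>_one)
      then show ?thesis using dvd_add[of "int p" "i - h * j" "h * j"] by simp
    next
      assume "w \<in> center G"
      then have "commutator G w x = \<one>" using car by simp
      moreover have "commutator G w x = \<beta> (- i - h * j) j"
        unfolding w_def using car by (simp add: expand)
      ultimately have "int p dvd - i - h * j" "int p dvd j" by (simp_all add: \<beta>_one)
      then show ?thesis using dvd_add[of "int p" "- i - h * j" "h * j"] by simp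
    qed
    then show "int p dvd i \<and> int p dvd j" .
  qed
  \<comment> \<open>Non-residues agree up to squares; the exponent \<open>t\<close> in
    \<open>A4\<close> and \<open>A2\<close> replaces \<open>D\<close> by \<open>g\<close>.\<close>
  obtain t where t: "int p dvd g - D * t\<^sup>2" using nonresidue_ratio_square[OF p g D] by blast
  have nt: "\<not> int p dvd t"
  proof
    assume "int p dvd t"
    then have "int p dvd (g - D * t\<^sup>2) + D * t\<^sup>2"
      using t by (intro dvd_add) (simp_all add: power2_eq_square)
    then show False using nonresidue_not_dvd[OF p(1) g] by simp
  qed
  then have "coprime t (int p)"
    using p prime_imp_coprime[of "int p" t] by (simp add: coprime_commute)
  then obtain t' where "[t * t' = 1] (mod int p)" using cong_solve_coprime_int by blast
  then have "int p dvd t * t' - 1" by (simp add: cong_iff_dvd_diff)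
  then obtain e where "t * t' - 1 = int p * e" ..
  then have e: "t * t' = 1 + int p * e" by simp
  define A4 where "A4 = (a4 \<otimes> a1 [^] (- h)) [^] t"
  \<comment> \<open>The last factor cancels [x, y] = u^c1 v^c2, so that \<open>A2\<close> commutes
    with \<open>x\<close>. The sign of the exponent -t makes [a1, A2] and [x, A4] equal.\<close>
  define A2 where "A2 = (y \<otimes> x [^] (- h)) [^] (- t) \<otimes> (a1 [^] (- t * c1) \<otimes> a4 [^] (- t * c2))"
  have A: "A2 \<in> carrier G" "A4 \<in> carrier G" using car by (simp_all add: A2_def A4_def)
  define b1 where "b1 = \<beta> (h * t) (- t)"
  have c12: "commutator G a1 A2 = b1"
    unfolding A2_def b1_def using car by (simp add: expand)
  have c34: "commutator G x A4 = b1"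
    unfolding A4_def b1_def using car by (simp add: expand)
  have c14: "commutator G a1 A4 = \<one>"
    unfolding A4_def using car by (simp add: expand)
  have c23: "commutator G A2 x = \<one>"
    unfolding A2_def using car by (simp add: expand)
  have "commutator G A2 A4 = \<beta> (D * t\<^sup>2) ((s - 2 * h) * t\<^sup>2)"
    unfolding A2_def A4_def using car
    by (simp add: expand) (simp add: D_def algebra_simps power2_eq_square)
  also have "\<dots> = \<beta> g 0"
    using t by (simp add: \<beta>_eq s2h dvd_diff_commute[of _ g])
  also have "\<dots> = u [^] g" using uv by (simp add: \<beta>_def)
  finally have c24: "commutator G A2 A4 = u [^] g" .
  \<comment> \<open>The passage from u, v to b1, u has determinant t up to sign, which is invertible
    modulo \<open>p\<close>.\<close>
  have ord': "b1 [^] k \<otimes> u [^] l = \<one> \<longleftrightarrow> int p dvd k \<and> int p dvd l" for k l :: int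
  proof -
    have "b1 [^] k \<otimes> u [^] l = \<beta> (h * t * k) (- t * k) \<otimes> \<beta> l 0"
      using uv by (simp add: b1_def \<beta>_pow) (simp add: \<beta>_def)
    also have "\<dots> = \<beta> (h * t * k + l) (- t * k)" by (simp add: \<beta>_mult)
    finally have "b1 [^] k \<otimes> u [^] l = \<one> \<longleftrightarrow> int p dvd h * t * k + l \<and> int p dvd t * k"
      by (simp add: \<beta>_one)
    also have "\<dots> \<longleftrightarrow> int p dvd h * t * k + l \<and> int p dvd k"
      using nt p prime_dvd_mult_iff[of "int p" t k] by simp
    also have "\<dots> \<longleftrightarrow> int p dvd k \<and> int p dvd l"
      by (auto simp: dvd_add_right_iff)
    finally show ?thesis .
  qed
  note K1 = adjoin_chain[OF subgroup_center subset_refl car(1)]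
  note K2 = adjoin_chain[OF K1(1,2) A(1)]
  note K3 = adjoin_chain[OF K2(1,2) car(3)]
  note K4 = adjoin_chain[OF K3(1,2) A(2)]
  let ?K = "adjoin G (adjoin G (adjoin G (adjoin G (center G) a1) A2) x) A4"
  have mem: "a1 \<in> ?K" "A2 \<in> ?K" "x \<in> ?K" "A4 \<in> ?K"
    using K1(4) K2(3,4) K3(3,4) K4(3,4) by blast+
  note Kmult = subgroup.m_closed[OF K4(1)] and Kpow = subgroup_int_pow_closed[OF K4(1)]
  have u1: "u \<noteq> \<one>" using \<beta>_one[of 1 0] prime_gt_1_nat[OF p(1)] uv by (simp add: \<beta>_def)
  have "carrier G \<subseteq> ?K"
  proof
    fix q assume q: "q \<in> carrier G"
    obtain m n where mn: "commutator G a1 q = \<beta> m n"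
      using span\<beta>[OF commutator_central] car q by blast
    \<comment> \<open>Chosen with [a1, k] = [a1, q], where t' inverts t; hence \<open>w\<close> = q
      k^-1 commutes with \<open>a1\<close>.\<close>
    define k where "k = A2 [^] (- t' * n) \<otimes> x [^] (m + h * n)"
    have k: "k \<in> ?K" "k \<in> carrier G" using Kmult Kpow mem A car by (simp_all add: k_def)
    define w where "w = q \<otimes> inv k"
    have wc: "w \<in> carrier G" using q k by (simp add: w_def)
    have "commutator G a1 k = \<beta> (h * t * (- t' * n) + (m + h * n)) (- t * (- t' * n))"
      unfolding k_def using car A
      by (simp add: commutator_mult_right commutator_int_pow_right c12 b1_def base \<beta>_mult \<beta>_pow)
    also have "\<dots> = \<beta> m n"
    proof -
      have "h * t * (- t' * n) + (m + h * n) - m = int p * (- h * n * e)"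
        "- t * (- t' * n) - n = int p * (n * e)"
        using e by (simp_all add: algebra_simps)
      then show ?thesis unfolding \<beta>_eq by simp
    qed
    finally have "commutator G a1 w = \<one>"
      unfolding w_def using car q k mn by (simp add: commutator_mult_right commutator_inv_right)
    obtain m' n' where mn': "commutator G w x = \<beta> m' n'"
      using span\<beta>[OF commutator_central] car wc by blast
    \<comment> \<open>A product of powers of \<open>A4\<close> and \<open>a1\<close>, so it commutes
      with \<open>a1\<close>; the exponents give [k', x] = [w, x].\<close>
    define k' where "k' = A4 [^] (t' * n') \<otimes> a1 [^] (m' + h * n')"
    have k': "k' \<in> ?K" "k' \<in> carrier G" using Kmult Kpow mem A car by (simp_all add: k'_def)
    define w' where "w' = w \<otimes> inv k'"
    have wc': "w' \<in> carrier G" using wc k' by (simp add: w'_def)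
    have "commutator G A4 x = \<beta> (- h * t) t"
      unfolding A4_def using car by (simp add: expand)
    then have "commutator G k' x = \<beta> (- h * t * (t' * n') + (m' + h * n')) (t * (t' * n'))"
      unfolding k'_def using car A
      by (simp add: commutator_mult_left commutator_int_pow_left base \<beta>_mult \<beta>_pow)
    also have "\<dots> = \<beta> m' n'"
    proof -
      have "- h * t * (t' * n') + (m' + h * n') - m' = int p * (- h * n' * e)"
        "t * (t' * n') - n' = int p * (n' * e)"
        using e by (simp_all add: algebra_simps)
      then show ?thesis unfolding \<beta>_eq by simp
    qed
    finally have "commutator G w' x = \<one>"
      unfolding w'_def using car wc k' mn' by (simp add: commutator_mult_left commutator_inv_left)
    moreover have "commutator G a1 w' = \<one>"
      unfolding w'_def k'_def using car wc A \<open>commutator G a1 w = \<one>\<close> c14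
      by (simp add: commutator_mult_right commutator_inv_right commutator_int_pow_right)
    \<comment> \<open>\<open>dich\<close> for the pair w', x: as [a1, x] = u is not 1, an element
      commuting with both \<open>a1\<close> and \<open>x\<close> is central.\<close>
    ultimately have "w' \<in> center G" using dich[OF wc' car(3)] u1 comm(1) by blast
    then have "w' \<in> ?K" using K4(2) by blast
    moreover have "q = w' \<otimes> k' \<otimes> k"
      unfolding w'_def w_def using q k k' by (simp add: m_assoc)
    ultimately show "q \<in> ?K" using Kmult k k' by simp
  qed
  then have cover: "carrier G = ?K" using subgroup.subset[OF K4(1)] by blast
  have "b1 \<in> center G" by (simp add: b1_def \<beta>Z)
  from coordinates15[OF car(1) A(1) car(3) A(2) this uvZ(1) c12 c34 comm(1) c24 c14 c23 cover ord']
  show ?thesis by blast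
qed

text \<open>The centralizer W of a non-central a1 has order p^4 and is generated by Z(G), a1 and one
  more element a4. So it is abelian, and it is the centralizer of each of its non-central elements.
  For x outside W the map w \<mapsto> [w, x] on W therefore has kernel Z(G) and is onto Z(G), which
  makes [a1, x] and [a4, x] a basis of Z(G).\<close>

lemma coordinates15_exists:
  assumes p: "Factorial_Ring.prime p" "odd p" and g: "nonresidue p g"
    and ord: "order G = p ^ 6" and Z: "card (center G) = p\<^sup>2"
    and pow: "\<And>x. x \<in> carrier G \<Longrightarrow> x [^] p \<in> center G"
    and img: "\<And>x. x \<in> carrier G \<Longrightarrow> x \<notin> center G \<Longrightarrow> commutator G x ` carrier G = center G"
  shows "\<exists>a b. coordinates G a b (comm15 g) (eq15 p)"
proof -
  have p1: "1 < p" using prime_gt_1_nat[OF p(1)] .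
  have fin: "finite (carrier G)"
    using ord p1 by (intro order_gt_0_iff_finite[THEN iffD1]) simp
  note fins = finite_subset[OF subgroup.subset fin]
  have card_cent: "card (centralizer x) = p ^ 4" if x: "x \<in> carrier G" "x \<notin> center G" for x
  proof -
    have "p\<^sup>2 * card (centralizer x) = p\<^sup>2 * p ^ 4"
      using card_centralizer[OF fin x(1)] ord img[OF x] Z power_add[of p 2 4] by simp
    then show ?thesis
      by (rule mult_left_cancel[THEN iffD1, rotated]) (use p1 in simp)
  qed
  have ord_p: "ord_mod G K x = p"
    if K: "subgroup K G" "center G \<subseteq> K" and x: "x \<in> carrier G" "x \<notin> K" for K x
  proof -
    have "ord_mod G K x dvd p" using nat_pow_mem_iff[OF fin K(1) x(1)] pow[OF x(1)] K(2) by blast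
    moreover have "ord_mod G K x \<noteq> 1" using nat_pow_mem_iff[OF fin K(1) x(1), of 1] x by auto
    ultimately show ?thesis using p(1) by (metis prime_nat_iff)
  qed
  have "card (center G) < order G" unfolding Z ord using p1 by (intro power_strict_increasing) auto
  then obtain a1 where a1: "a1 \<in> carrier G" "a1 \<notin> center G"
    using subgroup.subset[OF subgroup_center] by (metis order_def psubsetI less_irrefl subsetI subset_antisym)
  define W where "W = centralizer a1"
  have W: "subgroup W G" "center G \<subseteq> W" "a1 \<in> W" "card W = p ^ 4"
    unfolding W_def
    using subgroup_centralizer center_subset_centralizer card_cent a1 by (auto simp: centralizer_def)
  note Wc = subgroup.mem_carrier[OF W(1)]
  note K1 = adjoin_chain[OF subgroup_center subset_refl a1(1)]
  let ?K1 = "adjoin G (center G) a1"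
  have card1: "card ?K1 = p ^ 3"
    using card_adjoin[OF fin subgroup_center a1(1)] ord_p[OF subgroup_center subset_refl a1] Z
    by (simp add: eval_nat_numeral)
  have K1W: "?K1 \<subseteq> W" using adjoin_subset[OF W(1,2,3)] .
  moreover have "p ^ 3 < p ^ 4" using p1 by (intro power_strict_increasing) auto
  ultimately obtain a4 where a4: "a4 \<in> W" "a4 \<notin> ?K1"
    using card1 W(4) by (metis less_irrefl subsetI subset_antisym)
  have a4c: "a4 \<in> carrier G" using Wc a4 by blast
  have a14: "commutator G a1 a4 = \<one>" using a4 by (simp add: W_def centralizer_def)
  have "card (adjoin G ?K1 a4) = p ^ 4"
    using card_adjoin[OF fin K1(1) a4c] ord_p[OF K1(1,2) a4c a4(2)] card1
    by (simp add: eval_nat_numeral)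
  moreover have "adjoin G ?K1 a4 \<subseteq> W" using adjoin_subset[OF W(1) K1W a4(1)] .
  ultimately have W_eq: "W = adjoin G ?K1 a4"
    using fins[OF W(1)] W(4) card_subset_eq by metis
  have W_subset: "W \<subseteq> centralizer w"
    if w: "w \<in> carrier G" "commutator G a1 w = \<one>" "commutator G a4 w = \<one>" for w
  proof -
    have "a1 \<in> centralizer w" "a4 \<in> centralizer w"
      using w a1 a4c by (auto simp: centralizer_def commutator_eq_one_iff)
    then show ?thesis
      unfolding W_eq using subgroup_centralizer[OF w(1)] center_subset_centralizer[OF w(1)]
      by (intro adjoin_subset) auto
  qed
  have "commutator G a4 a1 = \<one>" using a14 a1 a4c by (metis commutator_eq_one_iff)
  have abel: "commutator G a4 w = \<one>" if "w \<in> W" for w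
    using W_subset[OF a4c a14] a4c that by (auto simp: centralizer_def)
  have cent_W: "centralizer w = W" if w: "w \<in> W" "w \<notin> center G" for w
  proof -
    have wc: "w \<in> carrier G" using Wc w by blast
    have "commutator G a1 w = \<one>" using w by (simp add: W_def centralizer_def)
    then have "W \<subseteq> centralizer w" using W_subset[OF wc] abel[OF w(1)] by blast
    then show ?thesis
      using fins[OF subgroup_centralizer[OF wc]] card_cent[OF wc w(2)] W(4) card_subset_eq by metis
  qed
  have "card W < order G" unfolding W(4) ord using p1 by (intro power_strict_increasing) auto
  then obtain x where x: "x \<in> carrier G" "x \<notin> W"
    using subgroup.subset[OF W(1)] by (metis order_def less_irrefl subsetI subset_antisym)
  have central_if: "w \<in> center G" if w: "w \<in> W" and wx: "commutator G w x = \<one>" for w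
  proof (rule ccontr)
    assume "w \<notin> center G"
    then have "x \<in> W" using cent_W[OF w] x wx by (auto simp: centralizer_def)
    then show False using x by blast
  qed
  define u v where "u = commutator G a1 x" and "v = commutator G a4 x"
  have uvZ: "u \<in> center G" "v \<in> center G"
    using commutator_central a1 a4c x by (simp_all add: u_def v_def)
  have ax: "commutator G (a1 [^] k \<otimes> a4 [^] l) x = u [^] k \<otimes> v [^] l" for k l :: int
    using a1 a4c x by (simp add: commutator_mult_left commutator_int_pow_left u_def v_def)
  have up: "u [^] p = \<one>" "v [^] p = \<one>"
    using commutator_nat_pow_left[of _ x p, symmetric] a1 a4c x pow
    by (simp_all add: u_def v_def)
  have orduv: "u [^] k \<otimes> v [^] l = \<one> \<longleftrightarrow> int p dvd k \<and> int p dvd l" for k l :: int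
  proof
    assume "u [^] k \<otimes> v [^] l = \<one>"
    moreover have "a1 [^] k \<otimes> a4 [^] l \<in> W"
      using W(1,3) a4(1) subgroup_int_pow_closed subgroup.m_closed by metis
    ultimately have c: "a1 [^] k \<otimes> a4 [^] l \<in> center G" using central_if ax by simp
    have a1k: "a1 [^] k \<in> ?K1" using subgroup_int_pow_closed[OF K1(1,4)] .
    have "a4 [^] l = inv (a1 [^] k) \<otimes> (a1 [^] k \<otimes> a4 [^] l)"
      using a1 a4c by simp
    also have "\<dots> \<in> ?K1"
      using subgroup.m_closed[OF K1(1) subgroup.m_inv_closed[OF K1(1) a1k]] c K1(2) by blast
    finally have l: "int p dvd l"
      using int_pow_mem_iff[OF fin K1(1) a4c, of l] ord_p[OF K1(1,2) a4c a4(2)] by simp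
    have "int (ord_mod G (center G) a4) dvd l"
    proof -
      have "a4 \<notin> center G" using a4 K1(2) by blast
      then show ?thesis using ord_p[OF subgroup_center subset_refl a4c] l by simp
    qed
    then have "a4 [^] l \<in> center G" using int_pow_mem_iff[OF fin subgroup_center a4c] by blast
    then have "(a1 [^] k \<otimes> a4 [^] l) \<otimes> inv (a4 [^] l) \<in> center G"
      using c center_mult_closed center_inv_closed by blast
    then have "a1 [^] k \<in> center G" using a1 a4c by (simp add: m_assoc)
    then have "int p dvd k"
      using int_pow_mem_iff[OF fin subgroup_center a1(1), of k]
        ord_p[OF subgroup_center subset_refl a1] by simp
    then show "int p dvd k \<and> int p dvd l" using l by blast
  next
    assume "int p dvd k \<and> int p dvd l"
    then obtain k' l' where "k = int p * k'" "l = int p * l'" by (auto elim!: dvdE)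
    then show "u [^] k \<otimes> v [^] l = \<one>"
      using uvZ[THEN center_closed] up by (simp add: int_pow_int flip: int_pow_pow)
  qed
  have "p ^ 4 = card ((\<lambda>w. commutator G w x) ` W) * card {w \<in> W. commutator G w x = \<one>}"
    using card_image_mult_card_kernel[OF fin W(1) is_group, of "\<lambda>w. commutator G w x"]
      W(4) Wc x by (simp add: commutator_mult_left)
  moreover have "{w \<in> W. commutator G w x = \<one>} = center G"
    using central_if W(2) x by auto
  ultimately have "p\<^sup>2 * card ((\<lambda>w. commutator G w x) ` W) = p\<^sup>2 * p\<^sup>2"
    using Z by (simp add: mult.commute flip: power_add)
  then have "card ((\<lambda>w. commutator G w x) ` W) = p\<^sup>2"
    by (rule mult_left_cancel[THEN iffD1, rotated]) (use p1 in simp)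
  moreover have "(\<lambda>w. commutator G w x) ` W \<subseteq> center G"
    using commutator_central Wc x by blast
  ultimately have onto: "(\<lambda>w. commutator G w x) ` W = center G"
    using fins[OF subgroup_center] Z card_subset_eq by metis
  have span: "\<exists>(k::int) (l::int). z = u [^] k \<otimes> v [^] l" if z: "z \<in> center G" for z
  proof -
    obtain w where w: "w \<in> W" "z = commutator G w x" using onto z by blast
    obtain d and k l :: int where d: "d \<in> center G" "w = d \<otimes> a1 [^] k \<otimes> a4 [^] l"
      using w(1) unfolding W_eq adjoin_def by auto
    have "w = d \<otimes> (a1 [^] k \<otimes> a4 [^] l)"
      using d a1 a4c center_closed by (simp add: m_assoc)
    then have "commutator G w x = u [^] k \<otimes> v [^] l"
      using d(1) a1 a4c x by (simp add: commutator_center_mult_left flip: ax)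
    then show ?thesis using w(2) by blast
  qed
  \<comment> \<open>\<open>y\<close> represents T x for the map T with [a1, T w] = [a4, w]; r and s
    are then the coefficients in T^2 = s T + r.\<close>
  obtain y where y: "y \<in> carrier G" "commutator G a1 y = v"
    using img[OF a1] uvZ(2) by (metis imageE)
  obtain r s where rs: "commutator G a4 y = u [^] (r::int) \<otimes> v [^] (s::int)"
    using span[OF commutator_central[OF a4c y(1)]] by blast
  show ?thesis
  proof (rule coordinates15_normal_form[OF p g a1(1) a4c x(1) y(1) uvZ _ _ y(2) rs a14 orduv span])
    fix w q
    assume w: "w \<in> carrier G" "commutator G a1 w = \<one>" and q: "q \<in> carrier G" "commutator G w q = \<one>"
    \<comment> \<open>Here \<open>w\<close> lies in \<open>W\<close>. If it is not central, its
      centralizer is \<open>W\<close>, which is the centralizer of \<open>a1\<close>.\<close>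
    show "commutator G a1 q = \<one> \<or> w \<in> center G"
      using cent_W[of w] w q by (auto simp: W_def centralizer_def)
  qed (simp_all add: u_def v_def)
qed

end

section \<open>Isoclinism invariance and the main theorem\<close>

text \<open>For a central automorphism \<phi>, f(x) = x^-1 \<phi>(x) is a homomorphism into the
  abelian group Z(G), so it kills gamma_2(G) = Z(G). Hence x^m in Z(G) implies f(x)^m = 1, and
  \<open>full\<close> writes f(x) as [x, w], that is \<phi>(x) = w^-1 x w.\<close>

lemma (in class2_group) Aut_c_eq_Aut_z_if_full_commutators:
  assumes Z: "center G = gamma2 G" and full: "full_commutators G"
  shows "Aut_c G = Aut_z G"
proof
  show "Aut_c G \<subseteq> Aut_z G"
  proof
    fix \<alpha> assume \<alpha>: "\<alpha> \<in> Aut_c G"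
    have "inv x \<otimes> \<alpha> x \<in> center G" if x: "x \<in> carrier G" for x
    proof -
      obtain g where "g \<in> carrier G" "\<alpha> x = inv g \<otimes> x \<otimes> g"
        using \<alpha> x unfolding Aut_c_def by blast
      then show ?thesis
        using x commutator_central by (simp add: conjugate_eq_mult_commutator)
    qed
    then show "\<alpha> \<in> Aut_z G" using \<alpha> by (simp add: Aut_c_def Aut_z_def)
  qed
  show "Aut_z G \<subseteq> Aut_c G"
  proof
    fix \<phi> assume \<phi>: "\<phi> \<in> Aut_z G"
    then have hom: "\<phi> \<in> hom G G" by (simp add: Aut_z_def auto_def)
    interpret h: group_hom G G \<phi>
      using hom is_group by (simp add: group_hom_def group_hom_axioms_def)
    define f where "f x = inv x \<otimes> \<phi> x" for x
    have fZ: "f x \<in> center G" if "x \<in> carrier G" for x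
      using \<phi> that by (simp add: Aut_z_def f_def)
    have fc: "f x \<in> carrier G" if "x \<in> carrier G" for x using fZ center_closed that by blast
    have \<phi>f: "\<phi> x = x \<otimes> f x" if "x \<in> carrier G" for x using that by (simp add: f_def)
    have "f (x \<otimes> y) = f x \<otimes> f y" if xy: "x \<in> carrier G" "y \<in> carrier G" for x y
    proof -
      have "(x \<otimes> y) \<otimes> f (x \<otimes> y) = (x \<otimes> f x) \<otimes> (y \<otimes> f y)"
        using xy by (simp flip: \<phi>f)
      also have "\<dots> = x \<otimes> (f x \<otimes> y) \<otimes> f y" using xy fc by (simp add: m_assoc)
      also have "\<dots> = (x \<otimes> y) \<otimes> (f x \<otimes> f y)"
        unfolding center_commute[OF fZ[OF xy(1)] xy(2)] using xy fc by (simp add: m_assoc)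
      finally show ?thesis using xy fc by simp
    qed
    then have fhom: "f \<in> hom G G" using fc by (intro homI) auto
    interpret f: group_hom G G f
      using fhom is_group by (simp add: group_hom_def group_hom_axioms_def)
    have "f ` carrier G \<subseteq> center G" using fZ by blast
    then have "gamma2 G \<subseteq> kernel G G f"
      using gamma2_subset_iff[OF f.subgroup_kernel] commutator_kernel[OF fhom]
      by (simp add: kernel_def)
    then have fker: "f z = \<one>" if "z \<in> center G" for z
      using that Z by (auto simp: kernel_def)
    have "\<exists>g\<in>carrier G. \<phi> x = inv g \<otimes> x \<otimes> g" if x: "x \<in> carrier G" for x
    proof -
      have "f x [^] m = \<one>" if "x [^] m \<in> center G" for m :: nat
        using fker[OF that] x by (simp add: f.hom_nat_pow)
      moreover have "f x \<in> gamma2 G" using fZ[OF x] Z by simp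
      ultimately obtain w where w: "w \<in> carrier G" "commutator G x w = f x"
        using full x unfolding full_commutators_def by blast
      show ?thesis using x w by (intro bexI[of _ w]) (simp_all add: conjugate_eq_mult_commutator \<phi>f)
    qed
    then show "\<phi> \<in> Aut_c G" using \<phi> by (simp add: Aut_c_def Aut_z_def)
  qed
qed

text \<open>The order of the center is not an isoclinism invariant; \<open>card\<close> fixes it. It
  gives |G / Z(G)| |gamma_2(G)| = |G|, so Z(G) and gamma_2(G) have the same order and coincide in
  class two.\<close>

lemma Aut_c_eq_Aut_z_if_isoclinic:
  assumes G: "group G" and fin: "finite (carrier G)" and H: "class2_group H"
    and full: "full_commutators H" and iso: "isoclinic G H"
    and card: "card (carrier (H Mod center H)) * card (gamma2 H) = order G"
  shows "Aut_c G = Aut_z G"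
proof -
  interpret G: group G by fact
  interpret H: class2_group H by fact
  let ?ZG = "center G" and ?ZH = "center H"
  interpret nG: normal ?ZG G by (rule G.normal_center)
  interpret nH: normal ?ZH H by (rule H.normal_center)
  obtain \<theta> \<phi> where \<theta>: "\<theta> \<in> iso (G Mod ?ZG) (H Mod ?ZH)"
    and \<phi>: "\<phi> \<in> iso (G\<lparr>carrier := gamma2 G\<rparr>) (H\<lparr>carrier := gamma2 H\<rparr>)"
    and comm: "\<And>a b a' b'. a \<in> carrier G \<Longrightarrow> b \<in> carrier G \<Longrightarrow> a' \<in> carrier H \<Longrightarrow> b' \<in> carrier H \<Longrightarrow>
      ?ZH #>\<^bsub>H\<^esub> a' = \<theta> (?ZG #>\<^bsub>G\<^esub> a) \<Longrightarrow> ?ZH #>\<^bsub>H\<^esub> b' = \<theta> (?ZG #>\<^bsub>G\<^esub> b) \<Longrightarrow>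
      \<phi> (commutator G a b) = commutator H a' b'"
    using iso unfolding isoclinic_def by blast
  have \<theta>_bij: "bij_betw \<theta> (carrier (G Mod ?ZG)) (carrier (H Mod ?ZH))"
    and \<theta>_hom: "\<theta> \<in> hom (G Mod ?ZG) (H Mod ?ZH)"
    using \<theta> by (simp_all add: iso_def)
  have \<phi>_bij: "bij_betw \<phi> (gamma2 G) (gamma2 H)"
    and \<phi>_hom: "\<phi> \<in> hom (G\<lparr>carrier := gamma2 G\<rparr>) (H\<lparr>carrier := gamma2 H\<rparr>)"
    using \<phi> by (simp_all add: iso_def)
  have coset: "?ZG #>\<^bsub>G\<^esub> x \<in> carrier (G Mod ?ZG)" if "x \<in> carrier G" for x
    using that by (auto simp: FactGroup_def RCOSETS_def)
  have lift: "\<exists>x'\<in>carrier H. ?ZH #>\<^bsub>H\<^esub> x' = \<theta> (?ZG #>\<^bsub>G\<^esub> x)" if x: "x \<in> carrier G" for x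
  proof -
    have "\<theta> (?ZG #>\<^bsub>G\<^esub> x) \<in> carrier (H Mod ?ZH)"
      using bij_betwE[OF \<theta>_bij] coset[OF x] by blast
    then show ?thesis by (auto simp: FactGroup_def RCOSETS_def)
  qed
  have lift': "\<exists>x\<in>carrier G. ?ZH #>\<^bsub>H\<^esub> x' = \<theta> (?ZG #>\<^bsub>G\<^esub> x)" if x': "x' \<in> carrier H" for x'
  proof -
    have "?ZH #>\<^bsub>H\<^esub> x' \<in> carrier (H Mod ?ZH)"
      using x' by (auto simp: FactGroup_def RCOSETS_def)
    then have "?ZH #>\<^bsub>H\<^esub> x' \<in> \<theta> ` carrier (G Mod ?ZG)"
      using \<theta>_bij by (simp add: bij_betw_def)
    then show ?thesis by (auto simp: FactGroup_def RCOSETS_def)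
  qed
  have mulG: "(?ZG #>\<^bsub>G\<^esub> x) \<otimes>\<^bsub>G Mod ?ZG\<^esub> (?ZG #>\<^bsub>G\<^esub> y) = ?ZG #>\<^bsub>G\<^esub> (x \<otimes>\<^bsub>G\<^esub> y)"
    if "x \<in> carrier G" "y \<in> carrier G" for x y
    using nG.rcos_sum[OF that] by (simp add: FactGroup_def)
  have mulH: "(?ZH #>\<^bsub>H\<^esub> x) \<otimes>\<^bsub>H Mod ?ZH\<^esub> (?ZH #>\<^bsub>H\<^esub> y) = ?ZH #>\<^bsub>H\<^esub> (x \<otimes>\<^bsub>H\<^esub> y)"
    if "x \<in> carrier H" "y \<in> carrier H" for x y
    using nH.rcos_sum[OF that] by (simp add: FactGroup_def)
  have \<theta>_mult: "\<theta> (?ZG #>\<^bsub>G\<^esub> (x \<otimes>\<^bsub>G\<^esub> y)) = ?ZH #>\<^bsub>H\<^esub> (x' \<otimes>\<^bsub>H\<^esub> y')"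
    if "x \<in> carrier G" "y \<in> carrier G" "x' \<in> carrier H" "y' \<in> carrier H"
      "?ZH #>\<^bsub>H\<^esub> x' = \<theta> (?ZG #>\<^bsub>G\<^esub> x)" "?ZH #>\<^bsub>H\<^esub> y' = \<theta> (?ZG #>\<^bsub>G\<^esub> y)" for x y x' y'
    using hom_mult[OF \<theta>_hom coset coset, of x y] that mulG[of x y] mulH[of x' y'] by metis
  have \<theta>_inj: "?ZG #>\<^bsub>G\<^esub> x = ?ZG #>\<^bsub>G\<^esub> y"
    if "\<theta> (?ZG #>\<^bsub>G\<^esub> x) = \<theta> (?ZG #>\<^bsub>G\<^esub> y)" "x \<in> carrier G" "y \<in> carrier G" for x y
    using that \<theta>_bij coset by (meson bij_betw_def inj_onD)
  have coset_iff: "?ZG #>\<^bsub>G\<^esub> x = ?ZG \<longleftrightarrow> x \<in> ?ZG" if "x \<in> carrier G" for x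
    using G.coset_join1[OF _ that G.subgroup_center] G.coset_join2[OF that G.subgroup_center]
      nG.subset by blast
  have coset_iff': "?ZH #>\<^bsub>H\<^esub> x = ?ZH \<longleftrightarrow> x \<in> ?ZH" if "x \<in> carrier H" for x
    using H.coset_join1[OF _ that H.subgroup_center] H.coset_join2[OF that H.subgroup_center]
      nH.subset by blast
  \<comment> \<open>H / Z(H) is abelian, hence so is G / Z(G).\<close>
  interpret G: class2_group G
  proof
    fix x y assume xy: "x \<in> carrier G" "y \<in> carrier G"
    obtain x' y' where x': "x' \<in> carrier H" "?ZH #>\<^bsub>H\<^esub> x' = \<theta> (?ZG #>\<^bsub>G\<^esub> x)"
      and y': "y' \<in> carrier H" "?ZH #>\<^bsub>H\<^esub> y' = \<theta> (?ZG #>\<^bsub>G\<^esub> y)"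
      using lift xy by meson
    have "?ZH #>\<^bsub>H\<^esub> (x' \<otimes>\<^bsub>H\<^esub> y') = ?ZH #>\<^bsub>H\<^esub> (y' \<otimes>\<^bsub>H\<^esub> x')"
    proof -
      have "x' \<otimes>\<^bsub>H\<^esub> y' = commutator H x' y' \<otimes>\<^bsub>H\<^esub> (y' \<otimes>\<^bsub>H\<^esub> x')"
        using H.mult_commutator[OF x'(1) y'(1)] H.center_commute[OF H.commutator_central] x' y'
        by simp
      then have "x' \<otimes>\<^bsub>H\<^esub> y' \<in> ?ZH #>\<^bsub>H\<^esub> (y' \<otimes>\<^bsub>H\<^esub> x')"
        using H.commutator_central[OF x'(1) y'(1)] by (auto simp: r_coset_def)
      then show ?thesis
        using H.repr_independence[OF _ _ H.subgroup_center] x' y' by fastforce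
    qed
    then have "?ZG #>\<^bsub>G\<^esub> (x \<otimes>\<^bsub>G\<^esub> y) = ?ZG #>\<^bsub>G\<^esub> (y \<otimes>\<^bsub>G\<^esub> x)"
      using \<theta>_mult[OF xy x'(1) y'(1) x'(2) y'(2)] \<theta>_mult[OF xy(2,1) y'(1) x'(1) y'(2) x'(2)]
      by (intro \<theta>_inj) (use xy in simp_all)
    then have "x \<otimes>\<^bsub>G\<^esub> y \<in> ?ZG #>\<^bsub>G\<^esub> (y \<otimes>\<^bsub>G\<^esub> x)"
      using G.rcos_self[OF _ G.subgroup_center, of "x \<otimes>\<^bsub>G\<^esub> y"] xy by simp
    then obtain z where z: "z \<in> ?ZG" "x \<otimes>\<^bsub>G\<^esub> y = z \<otimes>\<^bsub>G\<^esub> (y \<otimes>\<^bsub>G\<^esub> x)"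
      by (auto simp: r_coset_def)
    then have "y \<otimes>\<^bsub>G\<^esub> x \<otimes>\<^bsub>G\<^esub> commutator G x y = y \<otimes>\<^bsub>G\<^esub> x \<otimes>\<^bsub>G\<^esub> z"
      using G.mult_commutator[OF xy] G.center_commute[OF z(1)] xy by simp
    then show "commutator G x y \<in> ?ZG" using xy z G.center_closed by simp
  qed
  have "card (rcosets\<^bsub>G\<^esub> ?ZG) * card ?ZG = order G"
    using G.lagrange[OF G.subgroup_center] .
  moreover have "card (rcosets\<^bsub>G\<^esub> ?ZG) = card (carrier (H Mod ?ZH))"
    using bij_betw_same_card[OF \<theta>_bij] by (simp add: FactGroup_def)
  moreover have cg: "card (gamma2 G) = card (gamma2 H)" using bij_betw_same_card[OF \<phi>_bij] .
  moreover have "order G \<noteq> 0" using fin G.order_gt_0_iff_finite by simp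
  ultimately have "card ?ZG = card (gamma2 G)" using card by (metis mult_is_0 mult_left_cancel)
  then have Z: "?ZG = gamma2 G"
    using G.gamma2_subset_center card_subset_eq[of ?ZG "gamma2 G"]
      finite_subset[OF nG.subset fin] by simp
  have "full_commutators G"
    unfolding full_commutators_def
  proof (intro ballI impI)
    fix x y assume x: "x \<in> carrier G" and y: "y \<in> gamma2 G"
      and xy: "\<forall>m::nat. x [^]\<^bsub>G\<^esub> m \<in> ?ZG \<longrightarrow> y [^]\<^bsub>G\<^esub> m = \<one>\<^bsub>G\<^esub>"
    obtain x' where x': "x' \<in> carrier H" "?ZH #>\<^bsub>H\<^esub> x' = \<theta> (?ZG #>\<^bsub>G\<^esub> x)"
      using lift[OF x] by blast
    have \<theta>_one: "\<theta> ?ZG = ?ZH"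
      using hom_one[OF \<theta>_hom nG.factorgroup_is_group nH.factorgroup_is_group]
      by (simp add: FactGroup_def)
    have pow: "\<theta> (?ZG #>\<^bsub>G\<^esub> (x [^]\<^bsub>G\<^esub> m)) = ?ZH #>\<^bsub>H\<^esub> (x' [^]\<^bsub>H\<^esub> m)" for m :: nat
    proof (induction m)
      case 0
      then show ?case using coset_iff[of "\<one>\<^bsub>G\<^esub>"] coset_iff'[of "\<one>\<^bsub>H\<^esub>"] \<theta>_one by simp
    next
      case (Suc m)
      then show ?case using \<theta>_mult[OF _ x _ x'(1) _ x'(2)] x x' by simp
    qed
    have \<phi>y: "\<phi> y \<in> gamma2 H" using bij_betwE[OF \<phi>_bij] y by blast
    have \<phi>pow: "\<phi> (y [^]\<^bsub>G\<^esub> m) = \<phi> y [^]\<^bsub>H\<^esub> m" for m :: nat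
    proof (induction m)
      case 0
      have "\<phi> \<one>\<^bsub>G\<^esub> = \<one>\<^bsub>H\<^esub>"
        using hom_one[OF \<phi>_hom G.subgroup_imp_group[OF G.subgroup_gamma2]
            H.subgroup_imp_group[OF H.subgroup_gamma2]] by simp
      then show ?case by simp
    next
      case (Suc m)
      have "y [^]\<^bsub>G\<^esub> m \<in> gamma2 G"
        using G.subgroup_int_pow_closed[OF G.subgroup_gamma2 y, of "int m"] by (simp add: int_pow_int)
      then show ?case using hom_mult[OF \<phi>_hom, of "y [^]\<^bsub>G\<^esub> m" y] y Suc by simp
    qed
    have "\<phi> y [^]\<^bsub>H\<^esub> m = \<one>\<^bsub>H\<^esub>" if m: "x' [^]\<^bsub>H\<^esub> m \<in> ?ZH" for m :: nat
    proof -
      have "\<theta> (?ZG #>\<^bsub>G\<^esub> (x [^]\<^bsub>G\<^esub> m)) = \<theta> (?ZG #>\<^bsub>G\<^esub> \<one>\<^bsub>G\<^esub>)"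
        using pow[of m] pow[of 0] coset_iff'[of "x' [^]\<^bsub>H\<^esub> m"] coset_iff'[of "\<one>\<^bsub>H\<^esub>"] m x' by simp
      then have "?ZG #>\<^bsub>G\<^esub> (x [^]\<^bsub>G\<^esub> m) = ?ZG"
        using \<theta>_inj[of "x [^]\<^bsub>G\<^esub> m" "\<one>\<^bsub>G\<^esub>"] coset_iff[of "\<one>\<^bsub>G\<^esub>"] x by simp
      then have "y [^]\<^bsub>G\<^esub> m = \<one>\<^bsub>G\<^esub>" using xy coset_iff[of "x [^]\<^bsub>G\<^esub> m"] x by simp
      then show ?thesis using \<phi>pow[of m] \<phi>pow[of 0] by simp
    qed
    then obtain w' where w': "w' \<in> carrier H" "commutator H x' w' = \<phi> y"
      using full x'(1) \<phi>y unfolding full_commutators_def by blast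
    obtain w where w: "w \<in> carrier G" "?ZH #>\<^bsub>H\<^esub> w' = \<theta> (?ZG #>\<^bsub>G\<^esub> w)"
      using lift'[OF w'(1)] by blast
    have "\<phi> (commutator G x w) = \<phi> y"
      using comm[OF x w(1) x'(1) w'(1) x'(2) w(2)] w'(2) by simp
    then have "commutator G x w = y"
      using \<phi>_bij y G.commutator_in_gamma2[OF x w(1)] by (meson bij_betw_def inj_onD)
    then show "\<exists>w\<in>carrier G. commutator G x w = y" using w(1) by blast
  qed
  with Z show ?thesis by (rule G.Aut_c_eq_Aut_z_if_full_commutators)
qed

lemma (in group) isoclinic_family_if_Aut_c_eq_Aut_z:
  assumes p: "Factorial_Ring.prime p" "odd p" and nc: "\<not> comm_group G" and ord: "order G = p ^ 6"
    and eq: "Aut_c G = Aut_z G"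
  shows "G \<in> Phi14 p \<or> G \<in> Phi15 p"
proof -
  interpret class2_group G using class2_if_Aut_c_subset_Aut_z eq by blast
  have p1: "1 < p" using prime_gt_1_nat[OF p(1)] .
  have fin: "finite (carrier G)"
    using ord p1 by (intro order_gt_0_iff_finite[THEN iffD1]) simp
  have Z: "center G = gamma2 G"
    using center_subset_gamma2[OF p(1) ord nc eq] gamma2_subset_center by blast
  have nc': "\<not> carrier G \<subseteq> center G"
  proof
    assume "carrier G \<subseteq> center G"
    then have "comm_group G" using center_commute by (intro group_comm_groupI) blast
    then show False using nc by blast
  qed
  obtain e g where g: "g \<in> carrier G" "ord_mod G (center G) g = p ^ e"
      and e: "\<And>x. x \<in> carrier G \<Longrightarrow> x [^] (p ^ e) \<in> center G"
    using exponent_mod_subgroup[OF p(1) ord subgroup_center] by blast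
  have e0: "e \<noteq> 0" using nc' e by (intro notI) auto
  have Zexp: "z [^] (p ^ e) = \<one>" if z: "z \<in> center G" for z
  proof -
    \<comment> \<open>Z(G) = gamma_2(G) is generated by commutators, so it suffices that these lie
      in the subgroup \<open>?K\<close>.\<close>
    let ?K = "{z \<in> center G. z [^] (p ^ e) = \<one>}"
    have "subgroup ?K G"
    proof (rule subgroupI)
      show "?K \<subseteq> carrier G" using center_closed by blast
      have "\<one> \<in> ?K" by simp
      then show "?K \<noteq> {}" by blast
      show "inv a \<in> ?K" if "a \<in> ?K" for a
        using that center_inv_closed center_closed by (simp add: nat_pow_inv)
      show "a \<otimes> b \<in> ?K" if "a \<in> ?K" "b \<in> ?K" for a b
        using that center_mult_closed center_closed center_commute
        by (simp add: pow_mult_distrib)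
    qed
    moreover have "commutator G x y \<in> ?K" if "x \<in> carrier G" "y \<in> carrier G" for x y
      using that commutator_central e commutator_nat_pow_left[of x y "p ^ e", symmetric] by simp
    ultimately have "gamma2 G \<subseteq> ?K" using gamma2_subset_iff by blast
    then show ?thesis using z Z by blast
  qed
  have img: "commutator G h ` carrier G = center G"
    if h: "h \<in> carrier G" "ord_mod G (center G) h = p ^ e" for h
  proof
    show "commutator G h ` carrier G \<subseteq> center G" using h commutator_central by blast
    show "center G \<subseteq> commutator G h ` carrier G"
      using central_is_commutator[OF fin eq _ e h] Zexp p1 by auto
  qed
  have "card (center G) dvd p ^ 6" using lagrange[OF subgroup_center] ord by (metis dvd_triv_right)
  then obtain i where i: "card (center G) = p ^ i" using divides_primepow_nat[OF p(1)] by blast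
  have "i \<noteq> 0"
  proof
    assume "i = 0"
    then obtain z where "center G = {z}" using i card_1_singletonE by auto
    then have "center G = {\<one>}" using one_mem_center by auto
    then have "commutator G x y = \<one>" if "x \<in> carrier G" "y \<in> carrier G" for x y
      using commutator_central that by blast
    then show False using nc' mem_center_iff by blast
  qed
  have "p ^ e * p ^ i \<le> card (centralizer g)"
  proof -
    have "adjoin G (center G) g \<subseteq> centralizer g"
      using g center_subset_centralizer
      by (intro adjoin_subset subgroup_centralizer) (auto simp: centralizer_def)
    moreover have "finite (centralizer g)" using fin by (simp add: centralizer_def)
    ultimately show ?thesis
      using card_mono card_adjoin[OF fin subgroup_center g(1)] g(2) i by metis
  qed
  then have "p ^ i * (p ^ e * p ^ i) \<le> p ^ 6"
    using card_centralizer[OF fin g(1)] img[OF g] ord i by simp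
  moreover have "p ^ (i + (e + i)) = p ^ i * (p ^ e * p ^ i)"
    by (simp only: power_add)
  ultimately have "p ^ (i + (e + i)) \<le> p ^ 6" by simp
  then have ie: "2 * i + e \<le> 6" using p1 by simp
  have "i \<noteq> 1"
  proof
    assume "i = 1"
    then have cZ: "card (center G) = p" using i by simp
    \<comment> \<open>The commutator form on the whole group has radical Z(G), so the order of G
      would be an odd power of \<open>p\<close>.\<close>
    have "\<exists>k. card (carrier G) = p ^ (2 * k + 1)"
      by (rule card_odd_power[OF p(1) ord cZ subgroup_self subgroup.subset[OF subgroup_center]])
        (use mem_center_iff in blast)
    then obtain k where "card (carrier G) = p ^ (2 * k + 1)" ..
    then have "p ^ 6 = p ^ (2 * k + 1)" using ord by (metis order_def)
    then have "6 = 2 * k + 1" by (rule power_inject_exp[OF p1, THEN iffD1])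
    then show False by presburger
  qed
  then have "i = 2" "e \<le> 2" using \<open>i \<noteq> 0\<close> ie e0 by auto
  then have cardZ: "card (center G) = p\<^sup>2" using i by simp
  show ?thesis
  proof (cases "e = 2")
    case True
    obtain a b where "coordinates G a b comm14 (eq14 (p\<^sup>2))"
      using coordinates14_exists[OF p(1) ord cardZ g(1) _ img[OF g]] g(2) True by blast
    moreover obtain a' b' where "coordinates (presented_group (rels14 p)) a' b' comm14 (eq14 (p\<^sup>2))"
      using coordinates_presented14[of p] p1 by auto
    ultimately have "isoclinic G (presented_group (rels14 p))" by (rule isoclinic_coordinates)
    then show ?thesis using is_group by (simp add: Phi14_def)
  next
    case False
    then have "e = 1" using e0 \<open>e \<le> 2\<close> by simp
    have surj: "commutator G x ` carrier G = center G" if x: "x \<in> carrier G" "x \<notin> center G" for x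
    proof -
      have "ord_mod G (center G) x dvd p"
        using nat_pow_mem_iff[OF fin subgroup_center x(1), of p] e[OF x(1)] \<open>e = 1\<close> by simp
      moreover have "ord_mod G (center G) x \<noteq> 1"
        using nat_pow_mem_iff[OF fin subgroup_center x(1), of 1] x by auto
      ultimately have "ord_mod G (center G) x = p ^ e" 
        using p(1) unfolding \<open>e = 1\<close> power_one_right by (metis prime_nat_iff)
      then show ?thesis using img x(1) by blast
    qed
    have "\<And>x. x \<in> carrier G \<Longrightarrow> x [^] p \<in> center G" using e \<open>e = 1\<close> by simp
    then obtain a b where "coordinates G a b (comm15 (int (least_primroot p))) (eq15 p)"
      using coordinates15_exists[OF p nonresidue_least_primroot[OF p] ord cardZ _ surj] by blast
    moreover obtain a' b' where "coordinates (presented_group (rels15 p)) a' b'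
        (comm15 (int (least_primroot p))) (eq15 p)"
      using coordinates_presented15[of p] p1 by auto
    ultimately have "isoclinic G (presented_group (rels15 p))" by (rule isoclinic_coordinates)
    then show ?thesis using is_group by (simp add: Phi15_def)
  qed
qed

theorem theorem5p3:
  fixes G :: "('a, 'b) monoid_scheme" and p :: nat
  assumes "Factorial_Ring.prime p" and "odd p"
    and "group G" and "\<not> comm_group G" and "order G = p ^ 6"
  shows "Aut_c G = Aut_z G \<longleftrightarrow> G \<in> Phi14 p \<or> G \<in> Phi15 p"
proof
  assume "Aut_c G = Aut_z G"
  then show "G \<in> Phi14 p \<or> G \<in> Phi15 p"
    using group.isoclinic_family_if_Aut_c_eq_Aut_z assms by blast
next
  have p0: "0 < p" using assms(1) by (rule prime_gt_0_nat)
  have fin: "finite (carrier G)"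
    using monoid.order_gt_0_iff_finite[OF group.is_monoid[OF assms(3)]] assms(5) p0 by simp
  assume "G \<in> Phi14 p \<or> G \<in> Phi15 p"
  then show "Aut_c G = Aut_z G"
  proof
    let ?H = "presented_group (rels14 p)"
    assume "G \<in> Phi14 p"
    then have iso: "isoclinic G ?H" by (simp add: Phi14_def)
    obtain a b where c: "coordinates ?H a b comm14 (eq14 (p\<^sup>2))"
      using coordinates_presented14[OF p0] by blast
    have "0 < p\<^sup>2" using p0 by simp
    \<comment> \<open>|H / Z(H)| |gamma_2(H)| is (p^2)^2 p^2 here and p^4 p^2 in the other family,
      both times the order of G.\<close>
    note H = card_Mod_center14[OF c this] card_gamma2_14[OF c this] full_commutators14[OF c this]
    show ?thesis
      using H assms(5)
      by (intro Aut_c_eq_Aut_z_if_isoclinic[OF assms(3) fin coordinates.axioms(1)[OF c] _ iso])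
        (simp_all flip: power_mult power_add)
  next
    let ?H = "presented_group (rels15 p)"
    assume "G \<in> Phi15 p"
    then have iso: "isoclinic G ?H" by (simp add: Phi15_def)
    obtain a b where c: "coordinates ?H a b (comm15 (int (least_primroot p))) (eq15 p)"
      using coordinates_presented15[OF p0] by blast
    note g = nonresidue_least_primroot[OF assms(1,2)]
    note H = card_Mod_center15[OF c assms(1) nonresidue_not_dvd[OF assms(1) g]]
      card_gamma2_15[OF c assms(1) nonresidue_not_dvd[OF assms(1) g]]
      full_commutators15[OF c assms(1) g]
    show ?thesis
      using H assms(5)
      by (intro Aut_c_eq_Aut_z_if_isoclinic[OF assms(3) fin coordinates.axioms(1)[OF c] _ iso])
        (simp_all flip: power_mult power_add)
  qed
qed

end
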